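(* Assume that there exist $0<q<1$ and $C>0$ such that $b_k\le Cq^k$ for all $k\ge 1$, and that $\int_0^\infty \mu(t)\,dt=+\infty$. Then the Markov chain $X(t)$ has a limiting mean $\phi(t)$ and the following bounds hold for every $\delta\in(q,1)$ and every $t\ge0$. (i) For any two solutions $\mathbf p^*(t),\mathbf p^{**}(t)$ of the forward Kolmogorov system whose initial conditions are probability vectors, with $\mathbf w(0)=DT(\mathbf z^*(0)-\mathbf z^{**}(0))$, $$\|\mathbf p^*(t)-\mathbf p^{**}(t)\|\le 4\,e^{-\int_0^t(1-\delta)\mu(u)\,du}\,\|\mathbf w(0)\|.$$ (ii) For every $k\in\mathcal X$, $$|E(t,k)-\phi(t)|\le \frac4W\,e^{-\int_0^t(1-\delta)\mu(u)\,du}\,\|\mathbf w(0)\|,$$ where $W=\inf_{k\ge1}\frac{d_k}{k}>0$, $E(t,k)=\sum_{n\in\mathcal X}n\,p_n(t)$ is the mean number of customers at time $t$ given $p_k(0)=1$, and $\mathbf w(0)=DT(\mathbf z^*(0)-\mathbf z^{**}(0))$ is formed with $\mathbf p^*(0)$ the unit mass at $k$ and $\mathbf p^{**}(0)$ an initial probability vector (independent of $k$ and $\delta$, with $\|\mathbf w(0)\|<\infty$) of a solution $\mathbf p^{**}(t)$ whose mean $\sum_{n\in\mathcal X}n\,p^{**}_n(t)$ is $\phi(t)$.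
   Context: Queue model. Let $\lambda,\mu:[0,\infty)\to[0,\infty)$ be non-random locally integrable functions with $\lambda(t)\le L<\infty$ for all $t\ge0$. Let $\{b_n,\ n\ge1\}$ be a probability distribution on $\{1,2,\dots\}$ (batch sizes) with finite mean, and put $B_k=\sum_{n\ge k}b_n$ (so $B_1=1$). Customers arrive in batches according to a Poisson process of intensity $\lambda(t)$; batch sizes are distributed as $\{b_n\}$. A batch whose size is strictly larger than the current number of customers replaces all the customers in the system; otherwise it is lost. Customers are served one by one with intensity $\mu(t)$. $X(t)$ is the number of customers at time $t$: it is a continuous-time Markov chain on $\mathcal X=\{0,1,\dots,b^*\}$, where $b^*=\max\{n: b_n>0\}$ (with $\mathcal X=\{0,1,2,\dots\}$ if the batch size has infinite support). Its transition intensities $q_{ij}(t)$ are: $q_{ij}(t)=\lambda(t)b_j$ for $j>i$; $q_{i,i-1}(t)=\mu(t)$ for $i\ge1$; $q_{00}(t)=-\lambda(t)$; $q_{ii}(t)=-(\mu(t)+\lambda(t)B_{i+1})$ for $i\ge1$; all others $0$. If $b^*<\infty$, all vectors and matrices below are truncated to the index set of $\mathcal X$ (or $\mathcal X\setminus\{0\}$). Let $Q(t)=(q_{ij}(t))$ and $A(t)=Q(t)^T$. The probability vector $\mathbf p(t)=(p_0(t),p_1(t),\dots)^T$, $p_i(t)=\mathbf P(X(t)=i)$, satisfies the forward Kolmogorov system $\frac{d}{dt}\mathbf p(t)=A(t)\mathbf p(t)$, understood for $l_1$-valued solutions (for almost every $t$, since the coefficients are only locally integrable). $\|\cdot\|$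 is the $l_1$-norm. For a solution $\mathbf p^*$ (resp. $\mathbf p^{**}$), $\mathbf z^*$ (resp. $\mathbf z^{**}$) is the vector obtained by deleting the coordinate with index $0$. Let $T$ be the upper triangular matrix, indexed by $i,j\ge1$, with all entries on and above the diagonal equal to $1$. For $\delta\in(0,1)$ let $D=\mathrm{diag}(d_1,d_2,\dots)$ with $d_1=1$, $d_{k+1}=\delta^{-k}$, $k\ge1$. For two solutions put $\mathbf w(t)=DT(\mathbf z^*(t)-\mathbf z^{**}(t))$. A bound whose right-hand side is $+\infty$ is regarded as vacuous. Limiting mean: a function $\phi(t)$ is a limiting mean of $X(t)$ if $E(t,k)-\phi(t)\to0$ as $t\to\infty$ for every $k\in\mathcal X$. *)

theory Defs
  imports "HOL-Probability.Probability"
begin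

text \<open>
  Vectors indexed by the state space, or by the state space without 0, are functions on \<^typ>\<open>nat\<close>
  that vanish outside the index set; matrices are functions \<^typ>\<open>nat \<Rightarrow> nat \<Rightarrow> real\<close>.
\<close>

definition l1_norm :: "(nat \<Rightarrow> real) \<Rightarrow> ennreal" where
  "l1_norm x = (\<Sum>n. ennreal \<bar>x n\<bar>)"

definition mat_vec :: "nat set \<Rightarrow> (nat \<Rightarrow> nat \<Rightarrow> real) \<Rightarrow> (nat \<Rightarrow> real) \<Rightarrow> nat \<Rightarrow> real" where
  "mat_vec S M x i = (if i \<in> S then \<Sum>\<^sub>\<infinity>j\<in>S. M i j * x j else 0)"

definition prob_vec :: "(nat \<Rightarrow> real) \<Rightarrow> bool" where
  "prob_vec x \<longleftrightarrow> (\<forall>i. 0 \<le> x i) \<and> x sums 1"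

definition unit_mass :: "nat \<Rightarrow> nat \<Rightarrow> real" where
  "unit_mass k i = (if i = k then 1 else 0)"

definition states :: "nat pmf \<Rightarrow> nat set" where
  "states b = (if finite (set_pmf b) then {0..Max (set_pmf b)} else UNIV)"

definition batch_tail :: "nat pmf \<Rightarrow> nat \<Rightarrow> real" where
  "batch_tail b k = (\<Sum>\<^sub>\<infinity>n\<in>{k..}. pmf b n)"

definition Q_mat :: "(real \<Rightarrow> real) \<Rightarrow> (real \<Rightarrow> real) \<Rightarrow> nat pmf \<Rightarrow> real \<Rightarrow> nat \<Rightarrow> nat \<Rightarrow> real" where
  "Q_mat lam mu b t i j =
    (if j > i then lam t * pmf b j
     else if j = i then
       (if i = 0 then - lam t else - (mu t + lam t * batch_tail b (Suc i)))
     else if Suc j = i then mu t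
     else 0)"

definition A_mat :: "(real \<Rightarrow> real) \<Rightarrow> (real \<Rightarrow> real) \<Rightarrow> nat pmf \<Rightarrow> real \<Rightarrow> nat \<Rightarrow> nat \<Rightarrow> real" where
  "A_mat lam mu b t i j = Q_mat lam mu b t j i"

text \<open>Local absolute continuity on \<open>[0, \<infinity>)\<close> with respect to the norm of \<open>l\<^sub>1\<close>.\<close>

definition l1_loc_abs_cont :: "(real \<Rightarrow> nat \<Rightarrow> real) \<Rightarrow> bool" where
  "l1_loc_abs_cont p \<longleftrightarrow>
    (\<forall>R>0. \<forall>\<epsilon>>0. \<exists>\<eta>>0. \<forall>I :: (real \<times> real) set.
       finite I \<longrightarrow> (\<forall>(u, v)\<in>I. 0 \<le> u \<and> u < v \<and> v \<le> R) \<longrightarrow>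
       disjoint_family_on (\<lambda>(u, v). {u<..<v}) I \<longrightarrow>
       (\<Sum>(u, v)\<in>I. v - u) < \<eta> \<longrightarrow>
       (\<Sum>(u, v)\<in>I. l1_norm (\<lambda>i. p v i - p u i)) < ennreal \<epsilon>)"

text \<open>
  Solutions of the forward Kolmogorov system \<open>p' = A(t) p\<close> in the sense of Caratheodory:
  \<open>l\<^sub>1\<close>-valued, locally absolutely continuous, and with the derivative in the norm of \<open>l\<^sub>1\<close> equal to
  \<open>A(t) p(t)\<close> for almost every \<open>t\<close>. (Without absolute continuity an equation that holds only almost
  everywhere would not determine the solution.) Values at negative times are irrelevant.
\<close>

definition forward_solution ::
  "(real \<Rightarrow> real) \<Rightarrow> (real \<Rightarrow> real) \<Rightarrow> nat pmf \<Rightarrow> (real \<Rightarrow> nat \<Rightarrow> real) \<Rightarrow> bool" where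
  "forward_solution lam mu b p \<longleftrightarrow>
    (\<forall>t\<ge>0. l1_norm (p t) < \<infinity> \<and> (\<forall>i. i \<notin> states b \<longrightarrow> p t i = 0)) \<and>
    l1_loc_abs_cont p \<and>
    (AE t in lebesgue. 0 < t \<longrightarrow>
       ((\<lambda>h. l1_norm (\<lambda>i. (p (t + h) i - p t i) / h - mat_vec (states b) (A_mat lam mu b t) (p t) i))
          \<longlongrightarrow> 0) (at 0))"

text \<open>
  The state probabilities \<open>P(X(t) = n)\<close> of the chain started in \<open>k\<close>. The choice operator is harmless:
  for the initial vectors considered the solution exists and is unique on \<open>[0, \<infinity>)\<close>.
\<close>

definition chain_prob ::
  "(real \<Rightarrow> real) \<Rightarrow> (real \<Rightarrow> real) \<Rightarrow> nat pmf \<Rightarrow> nat \<Rightarrow> real \<Rightarrow> nat \<Rightarrow> real" where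
  "chain_prob lam mu b k = (SOME p. forward_solution lam mu b p \<and> p 0 = unit_mass k)"

definition mean_number ::
  "(real \<Rightarrow> real) \<Rightarrow> (real \<Rightarrow> real) \<Rightarrow> nat pmf \<Rightarrow> real \<Rightarrow> nat \<Rightarrow> real" where
  "mean_number lam mu b t k = (\<Sum>\<^sub>\<infinity>n\<in>states b. real n * chain_prob lam mu b k t n)"

text \<open>The summability clause makes sure that the means are finite, as \<^const>\<open>infsum\<close> is 0 otherwise.\<close>

definition limiting_mean ::
  "(real \<Rightarrow> real) \<Rightarrow> (real \<Rightarrow> real) \<Rightarrow> nat pmf \<Rightarrow> (real \<Rightarrow> real) \<Rightarrow> bool" where
  "limiting_mean lam mu b \<phi> \<longleftrightarrow>
    (\<forall>k\<in>states b.
       (\<forall>t\<ge>0. (\<lambda>n. real n * chain_prob lam mu b k t n) summable_on states b) \<and>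
       ((\<lambda>t. mean_number lam mu b t k - \<phi> t) \<longlongrightarrow> 0) at_top)"

definition d_weight :: "real \<Rightarrow> nat \<Rightarrow> real" where
  "d_weight \<delta> k = (1 / \<delta>) ^ (k - 1)"

definition D_mat :: "real \<Rightarrow> nat \<Rightarrow> nat \<Rightarrow> real" where
  "D_mat \<delta> i j = (if i = j then d_weight \<delta> i else 0)"

definition T_mat :: "nat \<Rightarrow> nat \<Rightarrow> real" where
  "T_mat i j = (if i \<le> j then 1 else 0)"

text \<open>
  \<open>D T z\<close>, where \<open>z\<close> is \<open>x\<close> without its coordinate 0: the products run over the states other than 0.
\<close>

definition w_vec :: "nat pmf \<Rightarrow> real \<Rightarrow> (nat \<Rightarrow> real) \<Rightarrow> nat \<Rightarrow> real" where
  "w_vec b \<delta> x = mat_vec (states b - {0}) (D_mat \<delta>) (mat_vec (states b - {0}) T_mat x)"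

definition W_const :: "nat pmf \<Rightarrow> real \<Rightarrow> real" where
  "W_const b \<delta> = (INF k\<in>states b - {0}. d_weight \<delta> k / real k)"

end

theory Submission
  imports Defs
begin

text \<open>
  Let \<open>V\<^sub>k\<close> be the sum of the coordinates \<open>0, \<dots>, k - 1\<close> of the difference of two solutions. The
  forward system telescopes to \<open>V\<^sub>k' = - \<lambda> B\<^sub>k V\<^sub>k + \<mu> (V\<^sub>k\<^sub>+\<^sub>1 - V\<^sub>k)\<close> for \<open>k \<ge> 1\<close>, a pure death process with
  killing. Hence, with \<open>M(t)\<close> the integral of \<open>\<mu>\<close> over \<open>[0, t]\<close>, the modulus of \<open>V\<^sub>k(t)\<close> is at most the
  expectation of the modulus of \<open>V\<^sub>k\<^sub>+\<^sub>n(0)\<close> over a Poisson variable \<open>n\<close> with mean \<open>M(t)\<close>. Summing with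
  the weights \<open>d\<^sub>k = \<delta>\<^sup>1\<^sup>-\<^sup>k\<close> turns the Poisson weights into the factor \<open>exp (- (1 - \<delta>) M(t))\<close>. Since
  the difference of two probability vectors has total mass 0, the weighted sum at time 0 is the norm
  of \<open>w(0)\<close>; the weighted sum at time \<open>t\<close> controls both the \<open>l\<^sub>1\<close>-norm and the first moment of the
  difference.
  Solutions are built by Picard iteration in the space with weights \<open>1 + i\<close>, so that the solution
  started from the empty system has a finite mean, and this mean is taken as the limiting mean.
\<close>

section \<open>Absolutely continuous functions on a compact interval\<close>

text \<open>The unknowns are partial sums from below rather than tails: \<open>V_k\<close> has
  finitely many terms, so it is differentiated term by term, and b_k = B_k - B_(k+1) collapses all
  batch terms into a nonnegative killing rate, which can only shrink the modulus. Zero total mass at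
  time 0 makes \<open>V_k\<close> minus the k-th tail, which is what \<open>T\<close> produces; at
  time t the coordinates come back as x_i = V_(i+1) - V_i, which yields the constant 2, below the
  stated 4. Two obstacles shape the work. The coefficients are merely locally integrable, so
  derivatives exist only almost everywhere and every comparison runs through absolute continuity;
  taking moduli adds the zeros of \<open>V_k\<close> as exceptional points, but those with nonzero
  derivative are isolated. Moreover the equation for \<open>V_k\<close> refers to
  \<open>V_(k+1)\<close>, with no last equation to start from, so the Poisson expectation is cut
  after finitely many terms; a crude bound for the solutions on the compact time interval times
  M^(m+1)/(m+1)! controls the rest and vanishes as m grows. The empty start of the reference
  solution makes w(0) finitely supported for every initial state and every weight.\<close>

definition ac_on :: "real \<Rightarrow> (real \<Rightarrow> real) \<Rightarrow> bool" where
  "ac_on R f \<longleftrightarrow>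
    (\<forall>\<epsilon>>0. \<exists>\<eta>>0. \<forall>I :: (real \<times> real) set.
       finite I \<longrightarrow> (\<forall>(u, v)\<in>I. 0 \<le> u \<and> u < v \<and> v \<le> R) \<longrightarrow>
       disjoint_family_on (\<lambda>(u, v). {u<..<v}) I \<longrightarrow>
       (\<Sum>(u, v)\<in>I. v - u) < \<eta> \<longrightarrow>
       (\<Sum>(u, v)\<in>I. \<bar>f v - f u\<bar>) < \<epsilon>)"

lemma ac_onD:
  assumes "ac_on R f" "\<epsilon> > 0"
  obtains \<eta> where "\<eta> > 0"
    "\<And>I. \<lbrakk>finite I; \<And>u v. (u, v) \<in> I \<Longrightarrow> 0 \<le> u \<and> u < v \<and> v \<le> R;
       disjoint_family_on (\<lambda>(u, v). {u<..<v}) I; (\<Sum>(u, v)\<in>I. v - u) < \<eta>\<rbrakk>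
       \<Longrightarrow> (\<Sum>(u, v)\<in>I. \<bar>f v - f u\<bar>) < \<epsilon>"
  using assms unfolding ac_on_def
  by (smt (verit, best) case_prodI2)

text \<open>Common source of the closure properties below: each of them reduces to an estimate of
  increments. The \<open>K + 1\<close> in the choice of \<open>e\<close> covers
  \<open>K = 0\<close>.\<close>

lemma ac_on_dominated:
  assumes f: "ac_on R f" and g: "ac_on R g" and K: "0 \<le> K"
    and le: "\<And>u v. \<lbrakk>0 \<le> u; u < v; v \<le> R\<rbrakk> \<Longrightarrow> \<bar>h v - h u\<bar> \<le> K * (\<bar>f v - f u\<bar> + \<bar>g v - g u\<bar>)"
  shows "ac_on R h"
  unfolding ac_on_def
proof (intro allI impI)
  fix \<epsilon> :: real assume "0 < \<epsilon>"
  define e where "e = \<epsilon> / (2 * (K + 1))"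
  have "e > 0" "e * (2 * (K + 1)) = \<epsilon>"
    using \<open>0 < \<epsilon>\<close> K by (auto simp: e_def)
  then have e: "e > 0" "K * (e + e) < \<epsilon>"
    by (auto simp: algebra_simps)
  obtain \<eta>1 where 1: "\<eta>1 > 0" "\<And>I. \<lbrakk>finite I; \<And>u v. (u, v) \<in> I \<Longrightarrow> 0 \<le> u \<and> u < v \<and> v \<le> R;
       disjoint_family_on (\<lambda>(u, v). {u<..<v}) I; (\<Sum>(u, v)\<in>I. v - u) < \<eta>1\<rbrakk>
       \<Longrightarrow> (\<Sum>(u, v)\<in>I. \<bar>f v - f u\<bar>) < e"
    using ac_onD[OF f e(1)] by metis
  obtain \<eta>2 where 2: "\<eta>2 > 0" "\<And>I. \<lbrakk>finite I; \<And>u v. (u, v) \<in> I \<Longrightarrow> 0 \<le> u \<and> u < v \<and> v \<le> R;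
       disjoint_family_on (\<lambda>(u, v). {u<..<v}) I; (\<Sum>(u, v)\<in>I. v - u) < \<eta>2\<rbrakk>
       \<Longrightarrow> (\<Sum>(u, v)\<in>I. \<bar>g v - g u\<bar>) < e"
    using ac_onD[OF g e(1)] by metis
  show "\<exists>\<eta>>0. \<forall>I :: (real \<times> real) set.
       finite I \<longrightarrow> (\<forall>(u, v)\<in>I. 0 \<le> u \<and> u < v \<and> v \<le> R) \<longrightarrow>
       disjoint_family_on (\<lambda>(u, v). {u<..<v}) I \<longrightarrow>
       (\<Sum>(u, v)\<in>I. v - u) < \<eta> \<longrightarrow>
       (\<Sum>(u, v)\<in>I. \<bar>h v - h u\<bar>) < \<epsilon>"
  proof (intro exI[of _ "min \<eta>1 \<eta>2"] conjI allI impI)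
    fix I :: "(real \<times> real) set"
    assume I: "finite I" "\<forall>(u, v)\<in>I. 0 \<le> u \<and> u < v \<and> v \<le> R"
      "disjoint_family_on (\<lambda>(u, v). {u<..<v}) I" "(\<Sum>(u, v)\<in>I. v - u) < min \<eta>1 \<eta>2"
    have "(\<Sum>(u, v)\<in>I. \<bar>h v - h u\<bar>) \<le> (\<Sum>(u, v)\<in>I. K * (\<bar>f v - f u\<bar> + \<bar>g v - g u\<bar>))"
      using I(2) by (intro sum_mono) (auto intro: le)
    also have "\<dots> = K * ((\<Sum>(u, v)\<in>I. \<bar>f v - f u\<bar>) + (\<Sum>(u, v)\<in>I. \<bar>g v - g u\<bar>))"
      by (simp add: sum_distrib_left case_prod_unfold flip: sum.distrib)
    also have "\<dots> \<le> K * (e + e)"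
      using 1(2)[of I] 2(2)[of I] I K by (intro mult_left_mono add_mono) (auto intro: less_imp_le)
    finally show "(\<Sum>(u, v)\<in>I. \<bar>h v - h u\<bar>) < \<epsilon>"
      using e by simp
  qed (use 1 2 in auto)
qed

lemma ac_on_continuous:
  assumes "ac_on R f"
  shows "continuous_on {0..R} f"
  unfolding continuous_on_iff
proof (intro ballI allI impI)
  fix x e :: real assume x: "x \<in> {0..R}" and "0 < e"
  obtain \<eta> where \<eta>: "\<eta> > 0"
    "\<And>I. \<lbrakk>finite I; \<And>u v. (u, v) \<in> I \<Longrightarrow> 0 \<le> u \<and> u < v \<and> v \<le> R;
       disjoint_family_on (\<lambda>(u, v). {u<..<v}) I; (\<Sum>(u, v)\<in>I. v - u) < \<eta>\<rbrakk>
       \<Longrightarrow> (\<Sum>(u, v)\<in>I. \<bar>f v - f u\<bar>) < e"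
    using ac_onD[OF assms \<open>0 < e\<close>] by metis
  have *: "\<bar>f v - f u\<bar> < e" if "0 \<le> u" "u < v" "v \<le> R" "v - u < \<eta>" for u v
    using \<eta>(2)[of "{(u, v)}"] that by (auto simp: disjoint_family_on_def)
  show "\<exists>d>0. \<forall>x'\<in>{0..R}. dist x' x < d \<longrightarrow> dist (f x') (f x) < e"
  proof (intro exI[of _ \<eta>] conjI ballI impI)
    fix y assume "y \<in> {0..R}" "dist y x < \<eta>"
    then show "dist (f y) (f x) < e"
      using *[of x y] *[of y x] x \<open>0 < e\<close>
      by (cases x y rule: linorder_cases) (auto simp: dist_real_def abs_minus_commute)
  qed (fact \<eta>)
qed

lemma ac_on_bounded:
  assumes "ac_on R f"
  obtains K where "K \<ge> 0" "\<And>t. t \<in> {0..R} \<Longrightarrow> \<bar>f t\<bar> \<le> K"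
proof -
  have "bounded (f ` {0..R})"
    using compact_continuous_image[OF ac_on_continuous[OF assms]] by (simp add: compact_imp_bounded)
  then obtain K where "\<forall>x\<in>f ` {0..R}. \<bar>x\<bar> \<le> K"
    unfolding bounded_real by auto
  then show ?thesis
    by (intro that[of "max K 0"]) (auto simp: le_max_iff_disj)
qed

lemma ac_on_const [simp]: "ac_on R (\<lambda>t. c)"
  unfolding ac_on_def by (auto intro!: exI[of _ 1])

lemma ac_on_add:
  assumes "ac_on R f" "ac_on R g"
  shows "ac_on R (\<lambda>t. f t + g t)"
  by (rule ac_on_dominated[OF assms, of 1]) auto

lemma ac_on_diff:
  assumes "ac_on R f" "ac_on R g"
  shows "ac_on R (\<lambda>t. f t - g t)"
  by (rule ac_on_dominated[OF assms, of 1]) auto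

lemma ac_on_abs:
  assumes "ac_on R f"
  shows "ac_on R (\<lambda>t. \<bar>f t\<bar>)"
  by (rule ac_on_dominated[OF assms assms, of 1]) (auto intro: abs_triangle_ineq3[THEN order_trans])

lemma ac_on_mult:
  assumes f: "ac_on R f" and g: "ac_on R g"
  shows "ac_on R (\<lambda>t. f t * g t)"
proof -
  obtain A where A: "A \<ge> 0" "\<And>t. t \<in> {0..R} \<Longrightarrow> \<bar>f t\<bar> \<le> A"
    using ac_on_bounded[OF f] by metis
  obtain B where B: "B \<ge> 0" "\<And>t. t \<in> {0..R} \<Longrightarrow> \<bar>g t\<bar> \<le> B"
    using ac_on_bounded[OF g] by metis
  show ?thesis
  proof (rule ac_on_dominated[OF f g, of "A + B"])
    fix u v assume uv: "0 \<le> u" "u < v" "v \<le> R"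
    have "\<bar>f v * g v - f u * g u\<bar> = \<bar>f v * (g v - g u) + (f v - f u) * g u\<bar>"
      by (simp add: algebra_simps)
    also have "\<dots> \<le> \<bar>f v\<bar> * \<bar>g v - g u\<bar> + \<bar>f v - f u\<bar> * \<bar>g u\<bar>"
      by (metis abs_mult abs_triangle_ineq)
    also have "\<dots> \<le> (A + B) * \<bar>g v - g u\<bar> + \<bar>f v - f u\<bar> * (A + B)"
      using A(2)[of v] B(2)[of u] A(1) B(1) uv by (intro add_mono mult_right_mono mult_left_mono) auto
    finally show "\<bar>f v * g v - f u * g u\<bar> \<le> (A + B) * (\<bar>f v - f u\<bar> + \<bar>g v - g u\<bar>)"
      by (simp add: algebra_simps)
  qed (use A B in auto)
qed

lemma ac_on_power:
  assumes "ac_on R f"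
  shows "ac_on R (\<lambda>t. f t ^ n)"
  by (induction n) (auto intro: ac_on_mult assms)

lemma ac_on_sum:
  assumes "\<And>i. i \<in> I \<Longrightarrow> ac_on R (f i)"
  shows "ac_on R (\<lambda>t. \<Sum>i\<in>I. f i t)"
  using assms by (induction I rule: infinite_finite_induct) (auto intro: ac_on_add)

text \<open>The values of \<open>f\<close> stay in a compact interval [-A, A], where
  \<open>exp\<close> is Lipschitz with constant \<open>exp A\<close>; this follows from exp(y - x)
  >= 1 + (y - x).\<close>

lemma ac_on_exp:
  assumes f: "ac_on R f"
  shows "ac_on R (\<lambda>t. exp (f t))"
proof -
  obtain A where A: "\<And>t. t \<in> {0..R} \<Longrightarrow> \<bar>f t\<bar> \<le> A"
    using ac_on_bounded[OF f] by metis
  have *: "\<bar>exp x - exp y\<bar> \<le> exp A * \<bar>x - y\<bar>" if "\<bar>x\<bar> \<le> A" "\<bar>y\<bar> \<le> A" for x y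
  proof -
    have le: "exp x - exp y \<le> exp A * (x - y)" if "y \<le> x" "x \<le> A" for x y :: real
    proof -
      have "exp x * (1 + (y - x)) \<le> exp x * exp (y - x)"
        by (intro mult_left_mono exp_ge_add_one_self) auto
      then have "exp x - exp y \<le> exp x * (x - y)"
        by (simp add: exp_diff algebra_simps)
      also have "\<dots> \<le> exp A * (x - y)"
        using that by (intro mult_right_mono) auto
      finally show ?thesis .
    qed
    show ?thesis
      using le[of x y] le[of y x] abs_le_D1[OF that(1)] abs_le_D1[OF that(2)]
      by (cases "x \<le> y") (auto simp: abs_if)
  qed
  show ?thesis
  proof (rule ac_on_dominated[OF f f, of "exp A"])
    fix u v assume "0 \<le> u" "u < v" "v \<le> R"
    then show "\<bar>exp (f v) - exp (f u)\<bar> \<le> exp A * (\<bar>f v - f u\<bar> + \<bar>f v - f u\<bar>)"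
      using *[of "f v" "f u"] A[of u] A[of v]
      by (intro order_trans[OF *] mult_left_mono) auto
  qed auto
qed

section \<open>Monotonicity from the sign of the derivative almost everywhere\<close>

lemma negligible_open_superset:
  fixes N :: "real set"
  assumes "negligible N" "e > 0"
  obtains U where "open U" "N \<subseteq> U" "U \<in> lmeasurable" "measure lebesgue U < e"
proof -
  have N: "N \<in> sets lebesgue" "emeasure lebesgue N = 0"
    using assms by (auto simp: negligible_iff_null_sets null_sets_def)
  obtain U where U: "open U" "N \<subseteq> U" "U - N \<in> lmeasurable" "emeasure lebesgue (U - N) < ennreal e"
    using sets_lebesgue_outer_open[OF N(1) assms(2)] by metis
  have "emeasure lebesgue U \<le> emeasure lebesgue (U - N) + emeasure lebesgue N"
    using emeasure_subadditive[of "U - N" lebesgue N] U N by (simp add: Un_absorb2)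
  then have lt: "emeasure lebesgue U < ennreal e"
    using N U by simp
  then have "U \<in> lmeasurable"
    using U by (auto simp: fmeasurable_def intro: order.strict_trans)
  moreover have "measure lebesgue U < e"
    using lt assms by (simp add: measure_def) (metis enn2real_less_iff ennreal_less_top order.strict_trans)
  ultimately show ?thesis
    using that U by blast
qed

text \<open>The intervals of a fine tagged division whose tag is an exceptional point lie in an open set
  of small measure, so absolute continuity controls their contribution.\<close>

lemma ac_on_nonincreasing:
  assumes ac: "ac_on R F" and R: "0 \<le> R" and N: "negligible N"
    and D: "\<And>t. \<lbrakk>0 < t; t < R; t \<notin> N\<rbrakk> \<Longrightarrow> \<exists>D\<le>0. (F has_real_derivative D) (at t)"
  shows "F R \<le> F 0"
proof (rule field_le_epsilon)
  fix e :: real assume "0 < e"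
  \<comment> \<open>Well-tagged intervals will contribute at most \<epsilon> * R, the others at most
    \<epsilon>.\<close>
  define \<epsilon> where "\<epsilon> = e / (R + 1)"
  have "\<epsilon> > 0" "\<epsilon> * (R + 1) = e"
    using \<open>0 < e\<close> R by (auto simp: \<epsilon>_def)
  then have \<epsilon>: "\<epsilon> > 0" "\<epsilon> * R + \<epsilon> = e"
    by (auto simp: algebra_simps)
  \<comment> \<open>The endpoints count as exceptional tags, since the derivative is only given
    inside the interval.\<close>
  define N' where "N' = insert 0 (insert R N)"
  have N': "negligible N'"
    unfolding N'_def using N by simp
  obtain \<eta> where \<eta>: "\<eta> > 0"
    "\<And>I. \<lbrakk>finite I; \<And>u v. (u, v) \<in> I \<Longrightarrow> 0 \<le> u \<and> u < v \<and> v \<le> R;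
       disjoint_family_on (\<lambda>(u, v). {u<..<v}) I; (\<Sum>(u, v)\<in>I. v - u) < \<eta>\<rbrakk>
       \<Longrightarrow> (\<Sum>(u, v)\<in>I. \<bar>F v - F u\<bar>) < \<epsilon>"
    using ac_onD[OF ac \<epsilon>(1)] by metis
  obtain U where U: "open U" "N' \<subseteq> U" "U \<in> lmeasurable" "measure lebesgue U < \<eta>"
    using negligible_open_superset[OF N' \<eta>(1)] by metis
  \<comment> \<open>Straddle estimate: u and v lie on opposite sides of t, so the two linearisation
    errors add up to at most \<epsilon> * (v - u).\<close>
  have ex: "\<exists>d>0. \<forall>u v. t - d < u \<and> u \<le> t \<and> t \<le> v \<and> v < t + d \<longrightarrow> F v - F u \<le> \<epsilon> * (v - u)"
    if t: "t \<in> {0..R} - N'" for t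
  proof -
    obtain D where "D \<le> 0" "(F has_real_derivative D) (at t)"
      using D[of t] t by (auto simp: N'_def)
    then have "(F has_derivative (*) D) (at t)"
      by (simp add: has_field_derivative_def)
    then obtain d where d: "d > 0"
      "\<And>y. norm (y - t) < d \<Longrightarrow> norm (F y - F t - D * (y - t)) \<le> \<epsilon> * norm (y - t)"
      using \<epsilon>(1) unfolding has_derivative_at_alt by blast
    show ?thesis
    proof (intro exI[of _ d] conjI allI impI)
      fix u v assume uv: "t - d < u \<and> u \<le> t \<and> t \<le> v \<and> v < t + d"
      have "F v - F t - D * (v - t) \<le> \<epsilon> * (v - t)" "- (F u - F t - D * (u - t)) \<le> \<epsilon> * (t - u)"
        using d(2)[of v] d(2)[of u] uv by (simp_all add: abs_le_iff)
      moreover have "D * (v - u) \<le> 0"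
        using uv \<open>D \<le> 0\<close> by (intro mult_nonpos_nonneg) auto
      ultimately show "F v - F u \<le> \<epsilon> * (v - u)"
        by (simp add: algebra_simps)
    qed (fact d)
  qed
  then obtain d where d: "\<And>t. t \<in> {0..R} - N' \<Longrightarrow> d t > 0"
    "\<And>t u v. \<lbrakk>t \<in> {0..R} - N'; t - d t < u; u \<le> t; t \<le> v; v < t + d t\<rbrakk> \<Longrightarrow> F v - F u \<le> \<epsilon> * (v - u)"
    by metis
  define g where "g t = (if t \<in> N' then U else if t \<in> {0..R} then ball t (d t) else UNIV)" for t
  have "gauge g"
    unfolding gauge_def g_def using U d by auto
  then obtain p where p: "p tagged_division_of {0..R}" "g fine p"
    using fine_division_exists_real by blast
  have pK: "\<exists>a b. K = {a..b} \<and> a \<le> x \<and> x \<le> b \<and> 0 \<le> a \<and> b \<le> R" if "(x, K) \<in> p" for x K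
  proof -
    have "x \<in> K" "K \<subseteq> {0..R}" "\<exists>a b. K = cbox a b"
      using tagged_division_ofD[OF p(1)] that by auto
    then show ?thesis by fastforce
  qed
  have fin: "finite p" using p by auto
  \<comment> \<open>Degenerate intervals are left out: they contribute nothing, and
    \<open>\<phi>\<close> would not be injective on them.\<close>
  define B where "B = {(x, K) \<in> p. x \<in> N' \<and> Inf K < Sup K}"
  define \<phi> :: "real \<times> real set \<Rightarrow> real \<times> real" where "\<phi> = (\<lambda>(x, K). (Inf K, Sup K))"
  have finB: "finite B" using fin by (auto simp: B_def intro: finite_subset)
  have Bp: "(x, K) \<in> B \<Longrightarrow> (x, K) \<in> p" for x K by (auto simp: B_def)
  have Kint: "Inf K \<in> K" "Sup K \<in> K" "Inf K \<le> x" "x \<le> Sup K" "0 \<le> Inf K" "Sup K \<le> R"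
    and Kivl: "{Inf K<..<Sup K} \<subseteq> K" "interior K = {Inf K<..<Sup K}" if xp: "(x, K) \<in> p" for x K
  proof -
    obtain a b where "K = {a..b}" "a \<le> x" "x \<le> b" "0 \<le> a" "b \<le> R"
      using pK[OF xp] by blast
    then show "Inf K \<in> K" "Sup K \<in> K" "Inf K \<le> x" "x \<le> Sup K" "0 \<le> Inf K" "Sup K \<le> R"
      "{Inf K<..<Sup K} \<subseteq> K" "interior K = {Inf K<..<Sup K}"
      by auto
  qed
  have disj: "{Inf K<..<Sup K} \<inter> {Inf K'<..<Sup K'} = {}" if "(x, K) \<in> p" "(x', K') \<in> p" "(x, K) \<noteq> (x', K')" for x K x' K'
    using tagged_division_ofD(5)[OF p(1) that] Kivl(2)[OF that(1)] Kivl(2)[OF that(2)] by auto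
  have inj: "inj_on \<phi> B"
  proof (rule inj_onI, clarsimp simp: \<phi>_def)
    fix x K x' K' assume *: "(x, K) \<in> B" "(x', K') \<in> B" "Inf K = Inf K'" "Sup K = Sup K'"
    show "x = x' \<and> K = K'"
    proof (rule ccontr)
      assume "\<not> ?thesis"
      then have "{Inf K<..<Sup K} = {}"
        using disj[of x K x' K'] * Bp by auto
      then show False using * by (auto simp: B_def)
    qed
  qed
  have disjI: "disjoint_family_on (\<lambda>(u, v). {u<..<v}) (\<phi> ` B)"
    unfolding disjoint_family_on_def
  proof (intro ballI impI)
    fix i j assume "i \<in> \<phi> ` B" "j \<in> \<phi> ` B" "i \<noteq> j"
    then obtain x K x' K' where "(x, K) \<in> B" "i = (Inf K, Sup K)" "(x', K') \<in> B" "j = (Inf K', Sup K')"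
      by (auto simp: \<phi>_def)
    with \<open>i \<noteq> j\<close> show "(case i of (u, v) \<Rightarrow> {u<..<v}) \<inter> (case j of (u, v) \<Rightarrow> {u<..<v}) = {}"
      using disj[of x K x' K'] Bp by auto
  qed
  have "(\<Sum>(u, v)\<in>\<phi> ` B. v - u) = (\<Sum>i\<in>\<phi> ` B. measure lebesgue ((\<lambda>(u, v). {u<..<v}) i))"
    by (intro sum.cong) (auto simp: \<phi>_def B_def)
  also have "\<dots> = measure lebesgue (\<Union>i\<in>\<phi> ` B. (\<lambda>(u, v). {u<..<v}) i)"
    using finB disjI by (intro measure_finite_Union[symmetric]) (auto simp: \<phi>_def B_def)
  also have "\<dots> \<le> measure lebesgue U"
  proof (rule measure_mono_fmeasurable)
    show "(\<Union>i\<in>\<phi> ` B. (\<lambda>(u, v). {u<..<v}) i) \<subseteq> U"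
    proof
      fix y assume "y \<in> (\<Union>i\<in>\<phi> ` B. (\<lambda>(u, v). {u<..<v}) i)"
      then obtain x K where xK: "(x, K) \<in> p" "x \<in> N'" "Inf K < y" "y < Sup K"
        by (auto simp: \<phi>_def B_def)
      then have "K \<subseteq> g x" using p(2) by (auto simp: fine_def)
      then have "K \<subseteq> U" using xK by (simp add: g_def)
      then show "y \<in> U" using Kivl(1)[OF xK(1)] xK by auto
    qed
  qed (use finB U in \<open>auto intro!: sets.finite_UN simp: case_prod_unfold\<close>)
  also have "\<dots> < \<eta>" by (fact U)
  finally have len: "(\<Sum>(u, v)\<in>\<phi> ` B. v - u) < \<eta>" .
  have "(\<Sum>(u, v)\<in>\<phi> ` B. \<bar>F v - F u\<bar>) < \<epsilon>"
  proof (rule \<eta>(2))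
    fix u v assume "(u, v) \<in> \<phi> ` B"
    then obtain x K where "(x, K) \<in> p" "u = Inf K" "v = Sup K" "u < v"
      by (auto simp: \<phi>_def B_def)
    then show "0 \<le> u \<and> u < v \<and> v \<le> R"
      using Kint by blast
  qed (use finB disjI len in auto)
  also have "(\<Sum>(u, v)\<in>\<phi> ` B. \<bar>F v - F u\<bar>) = (\<Sum>(x, K)\<in>B. \<bar>F (Sup K) - F (Inf K)\<bar>)"
    by (subst sum.reindex[OF inj]) (auto simp: \<phi>_def case_prod_unfold)
  finally have bad: "(\<Sum>(x, K)\<in>B. \<bar>F (Sup K) - F (Inf K)\<bar>) < \<epsilon>" .
  have good: "F (Sup K) - F (Inf K) \<le> \<epsilon> * (Sup K - Inf K)" if "(x, K) \<in> p - B" for x K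
  proof (cases "x \<in> N'")
    case True
    then have "Inf K = Sup K" using that Kint[of x K] by (auto simp: B_def)
    then show ?thesis by simp
  next
    case False
    have xp: "(x, K) \<in> p" using that by auto
    have "x \<in> {0..R} - N'" using Kint[OF xp] False by auto
    moreover have "K \<subseteq> ball x (d x)"
    proof -
      have "K \<subseteq> g x" using p(2) xp by (auto simp: fine_def)
      then show ?thesis using False \<open>x \<in> {0..R} - N'\<close> by (simp add: g_def)
    qed
    then have "Inf K \<in> ball x (d x)" "Sup K \<in> ball x (d x)"
      using Kint[OF xp] by auto
    ultimately show ?thesis
      using Kint[OF xp] by (intro d(2)[of x]) (auto simp: dist_real_def)
  qed
  have "F R - F 0 = (\<Sum>(x, K)\<in>p. F (Sup K) - F (Inf K))"
    using additive_tagged_division_1[OF R p(1), of F] by simp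
  also have "\<dots> = (\<Sum>(x, K)\<in>p - B. F (Sup K) - F (Inf K)) + (\<Sum>(x, K)\<in>B. F (Sup K) - F (Inf K))"
    using fin by (intro sum.subset_diff) (auto simp: B_def)
  also have "\<dots> \<le> (\<Sum>(x, K)\<in>p - B. \<epsilon> * (Sup K - Inf K)) + (\<Sum>(x, K)\<in>B. \<bar>F (Sup K) - F (Inf K)\<bar>)"
    using good by (intro add_mono sum_mono) auto
  also have "(\<Sum>(x, K)\<in>p - B. \<epsilon> * (Sup K - Inf K)) \<le> (\<Sum>(x, K)\<in>p. \<epsilon> * (Sup K - Inf K))"
  proof (intro sum_mono2 fin)
    show "0 \<le> (case i of (x, K) \<Rightarrow> \<epsilon> * (Sup K - Inf K))" if "i \<in> p - (p - B)" for i
      using \<epsilon> that by (auto simp: B_def intro!: mult_nonneg_nonneg)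
  qed auto
  also have "\<dots> = \<epsilon> * R"
    using additive_tagged_division_1[OF R p(1), of "\<lambda>x. x"]
    by (simp add: sum_distrib_left[symmetric] case_prod_unfold)
  finally show "F R \<le> F 0 + e" using bad \<epsilon> by linarith
qed

section \<open>Locally integrable functions\<close>

lemma ac_on_continuous_Ici:
  assumes "\<And>R. ac_on R f"
  shows "continuous_on {0..} f"
  unfolding continuous_on_iff
proof (intro ballI allI impI)
  fix x e :: real assume x: "x \<in> {0..}" and "0 < e"
  then obtain d where d: "d > 0" "\<And>y. \<lbrakk>y \<in> {0..x + 1}; dist y x < d\<rbrakk> \<Longrightarrow> dist (f y) (f x) < e"
    using ac_on_continuous[OF assms, of "x + 1"] unfolding continuous_on_iff by fastforce
  show "\<exists>d>0. \<forall>x'\<in>{0..}. dist x' x < d \<longrightarrow> dist (f x') (f x) < e"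
    by (rule exI[of _ "min d 1"]) (use d in \<open>auto simp: dist_real_def\<close>)
qed

lemma sum_integral_disjoint_le:
  fixes h :: "real \<Rightarrow> real"
  assumes h: "h integrable_on {0..R}" "\<And>x. x \<in> {0..R} \<Longrightarrow> 0 \<le> h x"
    and I: "finite I" "\<And>u v. (u, v) \<in> I \<Longrightarrow> 0 \<le> u \<and> u < v \<and> v \<le> R"
      "disjoint_family_on (\<lambda>(u, v). {u<..<v}) I"
  shows "(\<Sum>(u, v)\<in>I. integral {u..v} h) \<le> integral {0..R} h"
proof -
  define S where "S = (\<Union>i\<in>I. (\<lambda>(u, v). {u<..<v}) i)"
  have "(h has_integral (\<Sum>i\<in>I. (\<lambda>(u, v). integral {u..v} h) i)) S"
    unfolding S_def
  proof (rule has_integral_UN)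
    show "(h has_integral (\<lambda>(u, v). integral {u..v} h) i) ((\<lambda>(u, v). {u<..<v}) i)" if i: "i \<in> I" for i
    proof -
      obtain u v where uv: "i = (u, v)" "0 \<le> u" "u < v" "v \<le> R"
        using I(2) i by (metis surj_pair)
      have "h integrable_on {u..v}"
        by (rule integrable_on_subinterval[OF h(1)]) (use uv in auto)
      then show ?thesis
        using uv by (simp add: integrable_integral flip: has_integral_Icc_iff_Ioo)
    qed
    show "pairwise (\<lambda>i i'. negligible ((\<lambda>(u, v). {u<..<v}) i \<inter> (\<lambda>(u, v). {u<..<v}) i')) I"
      using I(3) unfolding pairwise_def disjoint_family_on_def by (metis negligible_empty)
  qed (fact I)
  moreover have "S \<subseteq> {0..R}"
    using I(2) by (fastforce simp: S_def)
  ultimately show ?thesis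
    using h integrable_integral by (intro has_integral_subset_le[of S "{0..R}"]) auto
qed

text \<open>Truncation: |g| splits into a part bounded by n and an excess \<open>h n\<close> whose
  integral tends to 0 by dominated convergence. The excess is small on every family of intervals,
  the bounded part costs n times their total length.\<close>

lemma ac_on_integral:
  fixes g :: "real \<Rightarrow> real"
  assumes g: "g absolutely_integrable_on {0..R}"
  shows "ac_on R (\<lambda>t. integral {0..t} g)"
  unfolding ac_on_def
proof (intro allI impI)
  fix \<epsilon> :: real assume "0 < \<epsilon>"
  have ag: "(\<lambda>x. \<bar>g x\<bar>) absolutely_integrable_on {0..R}"
    using absolutely_integrable_norm[OF g] by (simp add: comp_def)
  have gi: "g integrable_on {0..R}" "(\<lambda>x. \<bar>g x\<bar>) integrable_on {0..R}"
    using g ag by (auto simp: absolutely_integrable_on_def)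
  define h where "h n x = \<bar>g x\<bar> - min \<bar>g x\<bar> (real n)" for n x
  have mi: "(\<lambda>x. min \<bar>g x\<bar> (real n)) integrable_on {0..R}" for n
    using absolutely_integrable_min_1[OF ag, of "\<lambda>_. real n"]
    by (auto simp: absolutely_integrable_on_def)
  have hi: "h n integrable_on {0..R}" for n
    unfolding h_def using gi mi by (intro integrable_diff) auto
  have "(\<lambda>n. integral {0..R} (h n)) \<longlonglongrightarrow> integral {0..R} (\<lambda>x. 0)"
  proof (rule dominated_convergence[OF hi gi(2)])
    show "(\<lambda>n. h n x) \<longlonglongrightarrow> 0" for x
    proof (rule tendsto_eventually)
      obtain m where "\<bar>g x\<bar> \<le> real m" using real_arch_simple by blast
      then show "\<forall>\<^sub>F n in sequentially. h n x = 0"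
        unfolding eventually_sequentially h_def by (intro exI[of _ m]) (auto simp: min_def)
    qed
  qed (auto simp: h_def)
  then have "\<forall>\<^sub>F n in sequentially. integral {0..R} (h n) < \<epsilon> / 2"
    using \<open>0 < \<epsilon>\<close> by (intro order_tendstoD(2)) auto
  then obtain n where n: "integral {0..R} (h n) < \<epsilon> / 2"
    by (auto simp: eventually_sequentially)
  show "\<exists>\<eta>>0. \<forall>I :: (real \<times> real) set.
       finite I \<longrightarrow> (\<forall>(u, v)\<in>I. 0 \<le> u \<and> u < v \<and> v \<le> R) \<longrightarrow>
       disjoint_family_on (\<lambda>(u, v). {u<..<v}) I \<longrightarrow>
       (\<Sum>(u, v)\<in>I. v - u) < \<eta> \<longrightarrow>
       (\<Sum>(u, v)\<in>I. \<bar>integral {0..v} g - integral {0..u} g\<bar>) < \<epsilon>"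
  \<comment> \<open>With this length the bounded part costs at most half of \<epsilon>; the added 1
    covers n = 0.\<close>
  proof (intro exI[of _ "\<epsilon> / (2 * (real n + 1))"] conjI allI impI)
    fix I :: "(real \<times> real) set"
    assume I: "finite I" "\<forall>(u, v)\<in>I. 0 \<le> u \<and> u < v \<and> v \<le> R"
      "disjoint_family_on (\<lambda>(u, v). {u<..<v}) I" "(\<Sum>(u, v)\<in>I. v - u) < \<epsilon> / (2 * (real n + 1))"
    have "\<bar>integral {0..v} g - integral {0..u} g\<bar> \<le> integral {u..v} (h n) + real n * (v - u)"
      if "(u, v) \<in> I" for u v
    proof -
      have uv: "0 \<le> u" "u < v" "v \<le> R" using I(2) that by auto
      have sub: "f integrable_on {u..v}" if "f integrable_on {0..R}" for f :: "real \<Rightarrow> real"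
        by (rule integrable_on_subinterval[OF that]) (use uv in auto)
      have "g integrable_on {0..v}"
        by (rule integrable_on_subinterval[OF gi(1)]) (use uv in auto)
      then have "integral {0..v} g - integral {0..u} g = integral {u..v} g"
        using Henstock_Kurzweil_Integration.integral_combine[of 0 u v g] uv by auto
      also have "\<bar>\<dots>\<bar> \<le> integral {u..v} (\<lambda>x. h n x + real n)"
      proof -
        have "(\<lambda>x. h n x + real n) integrable_on {u..v}"
          by (intro integrable_add sub hi) auto
        then show ?thesis
          using Henstock_Kurzweil_Integration.integral_norm_bound_integral[OF sub[OF gi(1)], of "\<lambda>x. h n x + real n"]
          by (auto simp: h_def)
      qed
      also have "\<dots> = integral {u..v} (h n) + real n * (v - u)"
        using sub[OF hi[of n]] uv by (subst integral_add) auto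
      finally show ?thesis .
    qed
    then have "(\<Sum>(u, v)\<in>I. \<bar>integral {0..v} g - integral {0..u} g\<bar>)
      \<le> (\<Sum>(u, v)\<in>I. integral {u..v} (h n) + real n * (v - u))"
      by (intro sum_mono) auto
    also have "\<dots> = (\<Sum>(u, v)\<in>I. integral {u..v} (h n)) + real n * (\<Sum>(u, v)\<in>I. v - u)"
      by (simp add: sum_distrib_left case_prod_unfold sum.distrib)
    also have "\<dots> \<le> integral {0..R} (h n) + real n * (\<epsilon> / (2 * (real n + 1)))"
    proof (intro add_mono mult_left_mono)
      show "(\<Sum>(u, v)\<in>I. integral {u..v} (h n)) \<le> integral {0..R} (h n)"
        using I by (intro sum_integral_disjoint_le hi) (auto simp: h_def)
    qed (use I in auto)
    also have "real n * (\<epsilon> / (2 * (real n + 1))) \<le> \<epsilon> / 2"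
      using \<open>0 < \<epsilon>\<close> by (simp add: field_simps)
    finally show "(\<Sum>(u, v)\<in>I. \<bar>integral {0..v} g - integral {0..u} g\<bar>) < \<epsilon>"
      using n by simp
  qed (use \<open>0 < \<epsilon>\<close> in auto)
qed

section \<open>Local integrability and Lebesgue differentiation\<close>

definition loc_integrable :: "(real \<Rightarrow> real) \<Rightarrow> bool" where
  "loc_integrable g \<longleftrightarrow> (\<forall>t\<ge>0. g absolutely_integrable_on {0..t})"

lemma loc_integrableD:
  assumes "loc_integrable g"
  shows "0 \<le> u \<Longrightarrow> g absolutely_integrable_on {u..v}" "0 \<le> u \<Longrightarrow> g integrable_on {u..v}"
proof -
  show "g absolutely_integrable_on {u..v}" if "0 \<le> u"
  proof -
    have "g absolutely_integrable_on {0..max 0 v}"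
      using assms by (auto simp: loc_integrable_def)
    then show ?thesis
      by (rule absolutely_integrable_on_subinterval) (use that in auto)
  qed
  then show "0 \<le> u \<Longrightarrow> g integrable_on {u..v}"
    by (simp add: absolutely_integrable_on_def)
qed

lemma loc_integrable_add: "loc_integrable f \<Longrightarrow> loc_integrable g \<Longrightarrow> loc_integrable (\<lambda>t. f t + g t)"
  unfolding loc_integrable_def by (auto intro: set_integral_add)

lemma loc_integrable_abs: "loc_integrable f \<Longrightarrow> loc_integrable (\<lambda>t. \<bar>f t\<bar>)"
  unfolding loc_integrable_def using absolutely_integrable_norm by (fastforce simp: comp_def)

lemma loc_integrable_const [simp]: "loc_integrable (\<lambda>t. c)"
  unfolding loc_integrable_def by auto

lemma loc_integrable_sum: "(\<And>i. i \<in> I \<Longrightarrow> loc_integrable (f i)) \<Longrightarrow> loc_integrable (\<lambda>t. \<Sum>i\<in>I. f i t)"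
  by (induction I rule: infinite_finite_induct) (auto intro: loc_integrable_add)

lemma loc_integrable_mult_continuous:
  assumes "loc_integrable g" "continuous_on {0..} f"
  shows "loc_integrable (\<lambda>t. f t * g t)"
  unfolding loc_integrable_def
proof (intro allI impI)
  fix t :: real assume "0 \<le> t"
  have c: "continuous_on {0..t} f" using assms(2) by (rule continuous_on_subset) auto
  show "(\<lambda>t. f t * g t) absolutely_integrable_on {0..t}"
    using c \<open>0 \<le> t\<close> assms(1)
    by (intro absolutely_integrable_bounded_measurable_product_real)
       (auto simp: loc_integrable_def intro: continuous_imp_measurable_on_sets_lebesgue
          compact_imp_bounded compact_continuous_image)
qed

lemma loc_integrable_cmult: "loc_integrable g \<Longrightarrow> loc_integrable (\<lambda>t. c * g t)"
  by (rule loc_integrable_mult_continuous) auto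

text \<open>The averages in \<open>integrable_ccontinuous_explicit\<close> are over cubes with lower
  corner at the point, so in dimension one they give the right-hand derivative.\<close>

lemma right_difference_quotient_tendsto:
  fixes f :: "real \<Rightarrow> real"
  assumes "\<And>a b. f integrable_on {a..b}"
  obtains N where "negligible N"
    "\<And>t e. \<lbrakk>t \<notin> N; 0 < e\<rbrakk> \<Longrightarrow> \<exists>d>0. \<forall>h. 0 < h \<and> h < d \<longrightarrow> \<bar>integral {t..t + h} f - f t * h\<bar> \<le> e * h"
proof -
  obtain N where N: "negligible N"
       "\<And>x e. \<lbrakk>x \<notin> N; 0 < e\<rbrakk> \<Longrightarrow> \<exists>d>0. \<forall>h. 0 < h \<and> h < d \<longrightarrow>
          norm (integral (cbox x (x + h *\<^sub>R One)) f /\<^sub>R h ^ DIM(real) - f x) < e"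
    using integrable_ccontinuous_explicit[of f] assms by (metis box_real(2))
  show ?thesis
  proof (rule that[OF N(1)])
    fix t e :: real assume "t \<notin> N" "0 < e"
    then obtain d where d: "d > 0" "\<And>h. 0 < h \<and> h < d \<Longrightarrow> \<bar>integral {t..t + h} f / h - f t\<bar> < e"
      using N(2)[of t e] by (auto simp: divide_inverse_commute)
    have "\<bar>integral {t..t + h} f - f t * h\<bar> \<le> e * h" if "0 < h \<and> h < d" for h
    proof -
      have "\<bar>integral {t..t + h} f - f t * h\<bar> = \<bar>integral {t..t + h} f / h - f t\<bar> * h"
        using that by (simp add: abs_mult_pos' field_simps)
      then show ?thesis using d(2)[OF that] that by simp
    qed
    then show "\<exists>d>0. \<forall>h. 0 < h \<and> h < d \<longrightarrow> \<bar>integral {t..t + h} f - f t * h\<bar> \<le> e * h"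
      using d by blast
  qed
qed

text \<open>The right-hand statement is applied to the function and to its reflection at 0; the
  second application gives the left-hand derivative, with the reflected exceptional set.\<close>

lemma lebesgue_differentiation:
  assumes g: "loc_integrable g"
  obtains N where "negligible N"
    "\<And>t. \<lbrakk>0 < t; t \<notin> N\<rbrakk> \<Longrightarrow> ((\<lambda>t. integral {0..t} g) has_real_derivative g t) (at t)"
proof -
  \<comment> \<open>Extension by 0 to negative times, because the one-sided lemma asks for
    integrability on every interval.\<close>
  define f where "f x = (if x \<in> {0..} then g x else 0)" for x
  have f: "f integrable_on {a..b}" for a b
  proof -
    have "f integrable_on {a..b} \<longleftrightarrow> g integrable_on ({0..} \<inter> {a..b})"
      unfolding f_def by (rule integrable_restrict_Int)
    also have "{0..} \<inter> {a..b} = {max 0 a..b}" by auto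
    finally show ?thesis using loc_integrableD(2)[OF g] by auto
  qed
  obtain N1 where N1: "negligible N1"
    "\<And>t e. \<lbrakk>t \<notin> N1; 0 < e\<rbrakk> \<Longrightarrow> \<exists>d>0. \<forall>h. 0 < h \<and> h < d \<longrightarrow> \<bar>integral {t..t + h} f - f t * h\<bar> \<le> e * h"
    using right_difference_quotient_tendsto[OF f] by metis
  have f': "(\<lambda>x. f (- x)) integrable_on {a..b}" for a b
    using f[of "-b" "-a"] Henstock_Kurzweil_Integration.integrable_reflect_real[of f "-a" "-b"]
    by simp
  obtain N2 where N2: "negligible N2"
    "\<And>t e. \<lbrakk>t \<notin> N2; 0 < e\<rbrakk> \<Longrightarrow> \<exists>d>0. \<forall>h. 0 < h \<and> h < d \<longrightarrow> \<bar>integral {t..t + h} (\<lambda>x. f (- x)) - f (- t) * h\<bar> \<le> e * h"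
    using right_difference_quotient_tendsto[OF f'] by metis
  have neg2: "negligible (uminus ` N2)"
    using N2(1) by (intro negligible_differentiable_image_negligible) auto
  show ?thesis
  proof (rule that[of "N1 \<union> uminus ` N2"])
    show "negligible (N1 \<union> uminus ` N2)" using N1 neg2 by auto
    fix t assume t: "0 < t" "t \<notin> N1 \<union> uminus ` N2"
    then have t2: "- t \<notin> N2" by force
    have "((\<lambda>t. integral {0..t} g) has_derivative (*) (g t)) (at t)"
      unfolding has_derivative_at_alt
    proof (intro conjI allI impI)
      fix e :: real assume "0 < e"
      obtain d1 where d1: "d1 > 0" "\<And>h. 0 < h \<and> h < d1 \<Longrightarrow> \<bar>integral {t..t + h} f - f t * h\<bar> \<le> e * h"
        using N1(2)[of t e] t \<open>0 < e\<close> by auto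
      obtain d2 where d2: "d2 > 0"
        "\<And>h. 0 < h \<and> h < d2 \<Longrightarrow> \<bar>integral {- t..- t + h} (\<lambda>x. f (- x)) - f (- (- t)) * h\<bar> \<le> e * h"
        using N2(2)[of "- t" e] t2 \<open>0 < e\<close> by auto
      have fg: "integral {u..v} f = integral {u..v} g" if "0 \<le> u" for u v
        by (rule integral_cong) (use that in \<open>auto simp: f_def\<close>)
      have comb: "integral {0..v} g - integral {0..u} g = integral {u..v} g" if "0 \<le> u" "u \<le> v" for u v
        using Henstock_Kurzweil_Integration.integral_combine[of 0 u v g] loc_integrableD(2)[OF g, of 0 v] that by auto
      show "\<exists>d>0. \<forall>y. norm (y - t) < d \<longrightarrow> norm (integral {0..y} g - integral {0..t} g - g t * (y - t)) \<le> e * norm (y - t)"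
      proof (intro exI[of _ "min t (min d1 d2)"] conjI allI impI)
        fix y assume y: "norm (y - t) < min t (min d1 d2)"
        then have y0: "0 < y" by auto
        consider "y = t" | "t < y" | "y < t" by linarith
        then show "norm (integral {0..y} g - integral {0..t} g - g t * (y - t)) \<le> e * norm (y - t)"
        proof cases
          case 2
          then show ?thesis
            using d1(2)[of "y - t"] y t fg[of t y] comb[of t y] by (auto simp: f_def)
        next
          case 3
          have "integral {- t..- t + (t - y)} (\<lambda>x. f (- x)) = integral {y..t} f"
            using Henstock_Kurzweil_Integration.integral_reflect_real[of t y f] by simp
          then show ?thesis
            using d2(2)[of "t - y"] y y0 t 3 fg[of y t] comb[of y t] by (auto simp: f_def abs_if algebra_simps split: if_splits)
        qed auto
      qed (use t d1 d2 in auto)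
    qed (rule bounded_linear_mult_right)
    then show "((\<lambda>t. integral {0..t} g) has_real_derivative g t) (at t)"
      by (simp add: has_field_derivative_def)
  qed
qed

text \<open>The difference of the two sides has derivative 0 almost everywhere, so the monotonicity
  lemma applies to it and to its negative.\<close>

lemma ac_on_eq_integral:
  assumes F: "ac_on R F" and f: "loc_integrable f" and R: "0 \<le> R" and N: "negligible N"
    and D: "\<And>t. \<lbrakk>0 < t; t < R; t \<notin> N\<rbrakk> \<Longrightarrow> (F has_real_derivative f t) (at t)"
  shows "F R = F 0 + integral {0..R} f"
proof -
  obtain N' where N': "negligible N'"
    "\<And>t. \<lbrakk>0 < t; t \<notin> N'\<rbrakk> \<Longrightarrow> ((\<lambda>t. integral {0..t} f) has_real_derivative f t) (at t)"
    using lebesgue_differentiation[OF f] by metis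
  have ac: "ac_on R (\<lambda>t. integral {0..t} f)"
    by (rule ac_on_integral) (use loc_integrableD(1)[OF f] in auto)
  have neg: "negligible (N \<union> N')" using N N' by auto
  have D1: "((\<lambda>t. F t - integral {0..t} f) has_real_derivative 0) (at t)"
    and D2: "((\<lambda>t. integral {0..t} f - F t) has_real_derivative 0) (at t)"
    if "0 < t" "t < R" "t \<notin> N \<union> N'" for t
    using DERIV_diff[OF D N'(2), of t] DERIV_diff[OF N'(2) D, of t] that by auto
  have "F R - integral {0..R} f \<le> F 0 - integral {0..0} f"
    using ac_on_nonincreasing[OF ac_on_diff[OF F ac] R neg] D1 by blast
  moreover have "integral {0..R} f - F R \<le> integral {0..0} f - F 0"
    using ac_on_nonincreasing[OF ac_on_diff[OF ac F] R neg] D2 by blast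
  ultimately show ?thesis by simp
qed

text \<open>Produces the factorials in the Picard estimate. As \<open>g\<close> is only locally
  integrable, the primitive is verified through absolute continuity of the power of its
  integral.\<close>

lemma integral_power_primitive:
  assumes g: "loc_integrable g" and t: "0 \<le> t"
  shows "integral {0..t} (\<lambda>u. g u * integral {0..u} g ^ n / fact n) = integral {0..t} g ^ Suc n / fact (Suc n)"
proof -
  define G where "G u = integral {0..u} g" for u
  obtain N where N: "negligible N"
    "\<And>t. \<lbrakk>0 < t; t \<notin> N\<rbrakk> \<Longrightarrow> (G has_real_derivative g t) (at t)"
    using lebesgue_differentiation[OF g] unfolding G_def by metis
  have ac: "ac_on R G" for R
    unfolding G_def by (rule ac_on_integral) (use loc_integrableD(1)[OF g] in auto)
  have "continuous_on {0..} G"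
    using ac by (rule ac_on_continuous_Ici)
  then have "loc_integrable (\<lambda>u. (G u ^ n / fact n) * g u)"
    by (intro loc_integrable_mult_continuous[OF g] continuous_intros) auto
  then have i: "loc_integrable (\<lambda>u. g u * G u ^ n / fact n)"
    by (simp add: mult.commute)
  have "G t ^ Suc n * (1 / fact (Suc n)) = G 0 ^ Suc n * (1 / fact (Suc n)) + integral {0..t} (\<lambda>u. g u * G u ^ n / fact n)"
  proof (rule ac_on_eq_integral[OF ac_on_mult[OF ac_on_power[OF ac] ac_on_const] i t N(1)])
    fix u assume "0 < u" "u \<notin> N"
    have "((\<lambda>t. G t ^ Suc n * (1 / fact (Suc n))) has_real_derivative
        (real (Suc n) * (g u * G u ^ n)) * (1 / fact (Suc n))) (at u)"
      using DERIV_cmult_right[OF DERIV_power[OF N(2), of u "Suc n"], of "1 / fact (Suc n)"] \<open>0 < u\<close> \<open>u \<notin> N\<close>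
      by simp
    also have "(real (Suc n) * (g u * G u ^ n)) * (1 / fact (Suc n)) = g u * G u ^ n / fact n"
      by (simp add: fact_Suc del: of_nat_Suc)
    finally show "((\<lambda>t. G t ^ Suc n * (1 / fact (Suc n))) has_real_derivative g u * G u ^ n / fact n) (at u)" .
  qed
  then show ?thesis by (simp add: G_def)
qed

section \<open>Norm convergence in the sequence space\<close>

lemma l1_norm_leI:
  assumes "\<And>N. (\<Sum>i<N. \<bar>x i\<bar>) \<le> c"
  shows "l1_norm x \<le> ennreal c"
  unfolding l1_norm_def suminf_eq_SUP
proof (rule SUP_least)
  fix n
  have "(\<Sum>i<n. ennreal \<bar>x i\<bar>) = ennreal (\<Sum>i<n. \<bar>x i\<bar>)"
    by (rule sum_ennreal) simp
  also have "\<dots> \<le> ennreal c"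
    by (rule ennreal_leI[OF assms])
  finally show "(\<Sum>i<n. ennreal \<bar>x i\<bar>) \<le> ennreal c" .
qed

text \<open>Discrete Scheffe lemma: coordinatewise convergence becomes norm convergence when upper
  bounds \<open>B\<close> of the norms converge to the norm of the limit. No mass can then escape to
  large indices.\<close>

lemma scheffe_l1:
  fixes a :: "'b \<Rightarrow> nat \<Rightarrow> real"
  assumes lim: "\<And>i. ((\<lambda>h. a h i) \<longlongrightarrow> \<alpha> i) F"
    and bnd: "\<forall>\<^sub>F h in F. \<forall>N. (\<Sum>i<N. \<bar>a h i\<bar>) \<le> B h" and B: "(B \<longlongrightarrow> (\<Sum>i. \<bar>\<alpha> i\<bar>)) F"
    and sm: "summable (\<lambda>i. \<bar>\<alpha> i\<bar>)"
  shows "((\<lambda>h. l1_norm (\<lambda>i. a h i - \<alpha> i)) \<longlongrightarrow> 0) F"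
proof (rule order_tendstoI)
  fix e :: ennreal assume "0 < e"
  then obtain x where x: "0 < x" "x < e" using dense by blast
  define r where "r = enn2real x"
  have "x < \<top>" using x(2) by (rule order.strict_trans2) simp
  then have r: "ennreal r < e" "r > 0"
    using x by (auto simp: r_def enn2real_positive_iff)
  have "(\<lambda>N. \<Sum>i<N. \<bar>\<alpha> i\<bar>) \<longlonglongrightarrow> (\<Sum>i. \<bar>\<alpha> i\<bar>)"
    by (rule summable_LIMSEQ[OF sm])
  then have "\<forall>\<^sub>F N in sequentially. (\<Sum>i. \<bar>\<alpha> i\<bar>) - r / 4 < (\<Sum>i<N. \<bar>\<alpha> i\<bar>)"
    using \<open>r > 0\<close> by (intro order_tendstoD(1)) auto
  then obtain N where N: "(\<Sum>i. \<bar>\<alpha> i\<bar>) - r / 4 < (\<Sum>i<N. \<bar>\<alpha> i\<bar>)"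
    by (auto simp: eventually_sequentially)
  \<comment> \<open>The error on the first N coordinates plus the budget left for the tail of
    \<open>a h\<close>; in the limit only the tail of \<open>\<alpha>\<close> beyond N remains,
    which is below r / 4.\<close>
  have "((\<lambda>h. (\<Sum>i<N. \<bar>a h i - \<alpha> i\<bar>) + (B h - (\<Sum>i<N. \<bar>a h i\<bar>)))
      \<longlongrightarrow> (\<Sum>i<N. \<bar>\<alpha> i - \<alpha> i\<bar>) + ((\<Sum>i. \<bar>\<alpha> i\<bar>) - (\<Sum>i<N. \<bar>\<alpha> i\<bar>))) F"
    by (intro tendsto_intros lim B)
  then have "\<forall>\<^sub>F h in F. (\<Sum>i<N. \<bar>a h i - \<alpha> i\<bar>) + (B h - (\<Sum>i<N. \<bar>a h i\<bar>)) < r / 2"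
    by (rule order_tendstoD(2)) (use N \<open>r > 0\<close> in simp)
  with bnd show "\<forall>\<^sub>F h in F. l1_norm (\<lambda>i. a h i - \<alpha> i) < e"
  proof eventually_elim
    case (elim h)
    have "(\<Sum>i<M. \<bar>a h i - \<alpha> i\<bar>) \<le> r" for M
    proof -
      have "(\<Sum>i<M. \<bar>a h i - \<alpha> i\<bar>) \<le> (\<Sum>i<max M N. \<bar>a h i - \<alpha> i\<bar>)"
        by (rule sum_mono2) auto
      also have "\<dots> = (\<Sum>i<N. \<bar>a h i - \<alpha> i\<bar>) + (\<Sum>i\<in>{N..<max M N}. \<bar>a h i - \<alpha> i\<bar>)"
        by (subst sum.union_disjoint[symmetric]) (auto intro: sum.cong)
      also have "(\<Sum>i\<in>{N..<max M N}. \<bar>a h i - \<alpha> i\<bar>) \<le> (\<Sum>i\<in>{N..<max M N}. \<bar>a h i\<bar>) + (\<Sum>i\<in>{N..<max M N}. \<bar>\<alpha> i\<bar>)"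
        unfolding sum.distrib[symmetric] by (intro sum_mono) auto
      also have "(\<Sum>i\<in>{N..<max M N}. \<bar>a h i\<bar>) = (\<Sum>i<max M N. \<bar>a h i\<bar>) - (\<Sum>i<N. \<bar>a h i\<bar>)"
        using sum_diff_nat_ivl[of 0 N "max M N" "\<lambda>i. \<bar>a h i\<bar>"] by (simp add: atLeast0LessThan)
      also have "(\<Sum>i\<in>{N..<max M N}. \<bar>\<alpha> i\<bar>) = (\<Sum>i<max M N. \<bar>\<alpha> i\<bar>) - (\<Sum>i<N. \<bar>\<alpha> i\<bar>)"
        using sum_diff_nat_ivl[of 0 N "max M N" "\<lambda>i. \<bar>\<alpha> i\<bar>"] by (simp add: atLeast0LessThan)
      finally show ?thesis
        using elim(1)[rule_format, of "max M N"] elim(2) N sum_le_suminf[OF sm, of "{..<max M N}"] \<open>r > 0\<close>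
        by (simp add: field_simps)
    qed
    then have "l1_norm (\<lambda>i. a h i - \<alpha> i) \<le> ennreal r"
      by (rule l1_norm_leI)
    then show ?case using r by simp
  qed
qed auto

section \<open>Curves in \<open>l\<^sub>1\<close> given by integrals\<close>

text \<open>The weights \<open>c\<close> will be 1 for plain norm estimates and \<open>1 + i\<close>
  for the Picard estimates.\<close>

lemma sum_abs_integral_le:
  fixes f :: "nat \<Rightarrow> real \<Rightarrow> real"
  assumes f: "\<And>i. i < N \<Longrightarrow> f i absolutely_integrable_on S" and h: "h integrable_on S"
    and le: "\<And>u. u \<in> S \<Longrightarrow> (\<Sum>i<N. c i * \<bar>f i u\<bar>) \<le> h u" and c: "\<And>i. 0 \<le> c i"
  shows "(\<Sum>i<N. c i * \<bar>integral S (f i)\<bar>) \<le> integral S h"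
proof -
  have af: "(\<lambda>u. \<bar>f i u\<bar>) integrable_on S" if "i < N" for i
    using absolutely_integrable_norm[OF f[OF that]] by (simp add: comp_def absolutely_integrable_on_def)
  have "(\<Sum>i<N. c i * \<bar>integral S (f i)\<bar>) \<le> (\<Sum>i<N. c i * integral S (\<lambda>u. \<bar>f i u\<bar>))"
  proof (intro sum_mono mult_left_mono c)
    fix i assume "i \<in> {..<N}"
    then show "\<bar>integral S (f i)\<bar> \<le> integral S (\<lambda>u. \<bar>f i u\<bar>)"
      using Henstock_Kurzweil_Integration.integral_norm_bound_integral[of "f i" S "\<lambda>u. \<bar>f i u\<bar>"] f af
      by (auto simp: absolutely_integrable_on_def)
  qed
  also have "\<dots> = integral S (\<lambda>u. \<Sum>i<N. c i * \<bar>f i u\<bar>)"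
    using af by (subst integral_sum) (auto intro: integrable_on_mult_right)
  also have "\<dots> \<le> integral S h"
    using af h le by (intro integral_le integrable_sum integrable_on_mult_right) auto
  finally show ?thesis .
qed

lemma integral_diff_interval:
  assumes "loc_integrable g" "0 \<le> u" "u \<le> v"
  shows "integral {0..v} g - integral {0..u} g = integral {u..v} g"
  using Henstock_Kurzweil_Integration.integral_combine[of 0 u v g] loc_integrableD(2)[OF assms(1), of 0 v] assms
  by auto

context
  fixes p :: "real \<Rightarrow> nat \<Rightarrow> real" and f :: "nat \<Rightarrow> real \<Rightarrow> real" and h :: "real \<Rightarrow> real"
  assumes f: "\<And>i. loc_integrable (f i)" and h: "loc_integrable h"
    and le: "\<And>u N. 0 \<le> u \<Longrightarrow> (\<Sum>i<N. \<bar>f i u\<bar>) \<le> h u"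
    and p: "\<And>t i. 0 \<le> t \<Longrightarrow> p t i = p 0 i + integral {0..t} (f i)"
begin

text \<open>The norm of an increment of \<open>p\<close> is at most the increment of the integral of
  \<open>h\<close>, which is absolutely continuous.\<close>

lemma l1_curve_loc_abs_cont: "l1_loc_abs_cont p"
  unfolding l1_loc_abs_cont_def
proof (intro allI impI)
  fix R \<epsilon> :: real assume "0 < R" "0 < \<epsilon>"
  define H where "H t = integral {0..t} h" for t
  have acH: "ac_on R H"
    unfolding H_def by (rule ac_on_integral) (use loc_integrableD(1)[OF h] in auto)
  obtain \<eta> where \<eta>: "\<eta> > 0"
    "\<And>I. \<lbrakk>finite I; \<And>u v. (u, v) \<in> I \<Longrightarrow> 0 \<le> u \<and> u < v \<and> v \<le> R;
       disjoint_family_on (\<lambda>(u, v). {u<..<v}) I; (\<Sum>(u, v)\<in>I. v - u) < \<eta>\<rbrakk>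
       \<Longrightarrow> (\<Sum>(u, v)\<in>I. \<bar>H v - H u\<bar>) < \<epsilon>"
    using ac_onD[OF acH \<open>0 < \<epsilon>\<close>] by metis
  have le1: "l1_norm (\<lambda>i. p v i - p u i) \<le> ennreal \<bar>H v - H u\<bar>" if "0 \<le> u" "u < v" for u v
  proof (rule l1_norm_leI)
    fix N
    have "p v i - p u i = integral {u..v} (f i)" for i
      using that p[of v i] p[of u i] integral_diff_interval[OF f, of u v i] by linarith
    then have "(\<Sum>i<N. \<bar>p v i - p u i\<bar>) = (\<Sum>i<N. 1 * \<bar>integral {u..v} (f i)\<bar>)"
      by simp
    also have "\<dots> \<le> integral {u..v} h"
      using le that loc_integrableD[OF f] loc_integrableD[OF h] by (intro sum_abs_integral_le) auto
    also have "\<dots> = H v - H u"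
      using integral_diff_interval[OF h] that by (simp add: H_def)
    finally show "(\<Sum>i<N. \<bar>p v i - p u i\<bar>) \<le> \<bar>H v - H u\<bar>" by simp
  qed
  show "\<exists>\<eta>>0. \<forall>I :: (real \<times> real) set.
       finite I \<longrightarrow> (\<forall>(u, v)\<in>I. 0 \<le> u \<and> u < v \<and> v \<le> R) \<longrightarrow>
       disjoint_family_on (\<lambda>(u, v). {u<..<v}) I \<longrightarrow>
       (\<Sum>(u, v)\<in>I. v - u) < \<eta> \<longrightarrow>
       (\<Sum>(u, v)\<in>I. l1_norm (\<lambda>i. p v i - p u i)) < ennreal \<epsilon>"
  proof (intro exI[of _ \<eta>] conjI allI impI)
    fix I :: "(real \<times> real) set"
    assume I: "finite I" "\<forall>(u, v)\<in>I. 0 \<le> u \<and> u < v \<and> v \<le> R"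
      "disjoint_family_on (\<lambda>(u, v). {u<..<v}) I" "(\<Sum>(u, v)\<in>I. v - u) < \<eta>"
    have "(\<Sum>(u, v)\<in>I. l1_norm (\<lambda>i. p v i - p u i)) \<le> (\<Sum>(u, v)\<in>I. ennreal \<bar>H v - H u\<bar>)"
      using I(2) le1 by (intro sum_mono) auto
    also have "\<dots> = ennreal (\<Sum>(u, v)\<in>I. \<bar>H v - H u\<bar>)"
      by (subst sum_ennreal[symmetric]) (auto simp: case_prod_unfold)
    also have "\<dots> < ennreal \<epsilon>"
      using \<eta>(2)[of I] I by (intro ennreal_lessI \<open>0 < \<epsilon>\<close>) auto
    finally show "(\<Sum>(u, v)\<in>I. l1_norm (\<lambda>i. p v i - p u i)) < ennreal \<epsilon>" .
  qed (fact \<eta>)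
qed

text \<open>Scalar Lebesgue differentiation is applied to each of the countably many coordinates and
  to \<open>s\<close>, the norm of the derivative. The difference quotients of the integral of
  \<open>s\<close> bound the norms of those of \<open>p\<close> and converge to the norm of the
  limit, so Scheffe's lemma upgrades the convergence.\<close>

lemma l1_curve_derivative:
  "AE t in lebesgue. 0 < t \<longrightarrow> ((\<lambda>h. l1_norm (\<lambda>i. (p (t + h) i - p t i) / h - f i t)) \<longlongrightarrow> 0) (at 0)"
proof -
  define s where "s u = (\<Sum>i. \<bar>f i u\<bar>)" for u
  have sm: "summable (\<lambda>i. \<bar>f i u\<bar>)" if "0 \<le> u" for u
    by (rule bounded_imp_summable[of _ "h u"])
       (use le[OF that] in \<open>auto simp del: sum.lessThan_Suc simp: lessThan_Suc_atMost[symmetric]\<close>)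
  have s_le: "(\<Sum>i<N. \<bar>f i u\<bar>) \<le> s u" if "0 \<le> u" for u N
    unfolding s_def by (rule sum_le_suminf[OF sm[OF that]]) auto
  have s: "loc_integrable s"
    unfolding loc_integrable_def
  proof (intro allI impI)
    fix t :: real assume "0 \<le> t"
    show "s absolutely_integrable_on {0..t}"
    proof (rule dominated_convergence_absolutely_integrable[where f = "\<lambda>N u. \<Sum>i<N. \<bar>f i u\<bar>" and h = h])
      show "(\<lambda>u. \<Sum>i<N. \<bar>f i u\<bar>) absolutely_integrable_on {0..t}" for N
        using loc_integrable_sum[of "{..<N}" "\<lambda>i u. \<bar>f i u\<bar>"] loc_integrable_abs[OF f] \<open>0 \<le> t\<close>
        by (auto simp: loc_integrable_def)
      show "h integrable_on {0..t}"
        using loc_integrableD(2)[OF h] by auto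
      show "norm (s u) \<le> h u" if "u \<in> {0..t}" for u
        using that suminf_le_const[OF sm, of u "h u"] le[of u] suminf_nonneg[OF sm, of u]
        by (auto simp: s_def)
      show "(\<lambda>N. \<Sum>i<N. \<bar>f i u\<bar>) \<longlonglongrightarrow> s u" if "u \<in> {0..t}" for u
        unfolding s_def by (rule summable_LIMSEQ) (use sm that in auto)
    qed
  qed
  obtain Ns where Ns: "negligible Ns"
    "\<And>t. \<lbrakk>0 < t; t \<notin> Ns\<rbrakk> \<Longrightarrow> ((\<lambda>t. integral {0..t} s) has_real_derivative s t) (at t)"
    using lebesgue_differentiation[OF s] by metis
  have "\<exists>N. negligible N \<and> (\<forall>t. 0 < t \<longrightarrow> t \<notin> N \<longrightarrow>
      ((\<lambda>t. integral {0..t} (f i)) has_real_derivative f i t) (at t))" for i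
    using lebesgue_differentiation[OF f[of i]] by metis
  then obtain Nf where Nf: "\<And>i. negligible (Nf i)"
    "\<And>i t. \<lbrakk>0 < t; t \<notin> Nf i\<rbrakk> \<Longrightarrow> ((\<lambda>t. integral {0..t} (f i)) has_real_derivative f i t) (at t)"
    by metis
  define N where "N = Ns \<union> (\<Union>i. Nf i)"
  have neg: "negligible N"
    unfolding N_def using Ns(1) Nf(1) by (intro negligible_Un negligible_countable_Union) auto
  have "((\<lambda>h. l1_norm (\<lambda>i. (p (t + h) i - p t i) / h - f i t)) \<longlongrightarrow> 0) (at 0)"
    if t: "0 < t" "t \<notin> N" for t
  proof -
    have ev: "\<forall>\<^sub>F h in at 0. 0 < t + h \<and> h \<noteq> 0"
      using t unfolding eventually_at by (intro exI[of _ t]) (auto simp: dist_real_def)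
    have "((\<lambda>h. l1_norm (\<lambda>i. (integral {0..t + h} (f i) - integral {0..t} (f i)) / h - f i t)) \<longlongrightarrow> 0) (at 0)"
    proof (rule scheffe_l1)
      show "((\<lambda>h. (integral {0..t + h} (f i) - integral {0..t} (f i)) / h) \<longlongrightarrow> f i t) (at 0)" for i
        using Nf(2)[of t i] t by (auto simp: DERIV_def N_def)
      show "((\<lambda>h. (integral {0..t + h} s - integral {0..t} s) / h) \<longlongrightarrow> (\<Sum>i. \<bar>f i t\<bar>)) (at 0)"
        using Ns(2)[of t] t by (auto simp: DERIV_def N_def s_def)
      show "summable (\<lambda>i. \<bar>f i t\<bar>)" using sm t by auto
      show "\<forall>\<^sub>F h in at 0. \<forall>N. (\<Sum>i<N. \<bar>(integral {0..t + h} (f i) - integral {0..t} (f i)) / h\<bar>)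
          \<le> (integral {0..t + h} s - integral {0..t} s) / h"
        using ev
      proof eventually_elim
        case (elim x)
        have *: "(\<Sum>i<N. \<bar>integral {u..v} (f i)\<bar>) \<le> integral {u..v} s" if "0 \<le> u" for u v N
          using sum_abs_integral_le[where f = f and S = "{u..v}" and h = s and c = "\<lambda>_. 1" and N = N] s_le that loc_integrableD[OF f] loc_integrableD[OF s]
          by auto
        show ?case
        proof
          fix N
          have "(\<Sum>i<N. \<bar>integral {0..t + x} (f i) - integral {0..t} (f i)\<bar>) / \<bar>x\<bar>
              \<le> \<bar>integral {0..t + x} s - integral {0..t} s\<bar> / \<bar>x\<bar>"
          proof (intro divide_right_mono)
            show "(\<Sum>i<N. \<bar>integral {0..t + x} (f i) - integral {0..t} (f i)\<bar>) \<le> \<bar>integral {0..t + x} s - integral {0..t} s\<bar>"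
            proof (cases "0 < x")
              case True
              then show ?thesis
                using *[of t "t + x" N] t integral_diff_interval[OF f, of t "t + x"] integral_diff_interval[OF s, of t "t + x"]
                by simp
            next
              case False
              then show ?thesis
                using *[of "t + x" t N] elim integral_diff_interval[OF f, of "t + x" t] integral_diff_interval[OF s, of "t + x" t]
                by (simp add: abs_minus_commute)
            qed
          qed auto
          moreover have "\<bar>integral {0..t + x} s - integral {0..t} s\<bar> / \<bar>x\<bar> = (integral {0..t + x} s - integral {0..t} s) / x"
          proof (cases "0 < x")
            case True
            have "0 \<le> integral {t..t + x} s"
              using *[of t "t + x" 0] t by auto
            then show ?thesis
              using True t integral_diff_interval[OF s, of t "t + x"] by simp
          next
            case False
            have "0 \<le> integral {t + x..t} s"
              using *[of "t + x" t 0] elim by auto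
            then show ?thesis
              using False elim integral_diff_interval[OF s, of "t + x" t] by (simp add: abs_if field_simps)
          qed
          ultimately show "(\<Sum>i<N. \<bar>(integral {0..t + x} (f i) - integral {0..t} (f i)) / x\<bar>)
              \<le> (integral {0..t + x} s - integral {0..t} s) / x"
            by (simp add: sum_divide_distrib)
        qed
      qed
    qed
    then show ?thesis
    proof (rule Lim_transform_eventually)
      show "\<forall>\<^sub>F h in at 0. l1_norm (\<lambda>i. (integral {0..t + h} (f i) - integral {0..t} (f i)) / h - f i t)
          = l1_norm (\<lambda>i. (p (t + h) i - p t i) / h - f i t)"
        using ev
      proof eventually_elim
        case (elim x)
        have "p (t + x) i = p 0 i + integral {0..t + x} (f i)" "p t i = p 0 i + integral {0..t} (f i)" for i
          using p[of "t + x" i] p[of t i] elim t by auto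
        then show ?case by simp
      qed
    qed
  qed
  then show ?thesis
    using neg by (intro AE_I'[of N]) (auto simp: negligible_iff_null_sets)
qed

end

section \<open>Tails of the batch-size distribution\<close>

lemma batch_tail_eq_measure: "batch_tail b k = measure (measure_pmf b) {k..}"
  unfolding batch_tail_def measure_pmf_conv_infsetsum
  by (rule infsetsum_infsum[symmetric, OF pmf_abs_summable])

lemma batch_tail_rec: "batch_tail b k = pmf b k + batch_tail b (Suc k)"
proof -
  have "{k..} = {k} \<union> {Suc k..}" by auto
  then have "measure (measure_pmf b) {k..} = measure (measure_pmf b) {k} + measure (measure_pmf b) {Suc k..}"
    by (simp only:) (rule measure_pmf.finite_measure_Union, auto)
  then show ?thesis
    by (simp add: batch_tail_eq_measure measure_pmf_single)
qed

lemma batch_tail_nonneg: "0 \<le> batch_tail b k"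
  by (simp add: batch_tail_eq_measure)

lemma batch_tail_le_1: "batch_tail b k \<le> 1"
  by (simp add: batch_tail_eq_measure)

lemma batch_tail_1: "pmf b 0 = 0 \<Longrightarrow> batch_tail b (Suc 0) = 1"
  using batch_tail_rec[of b 0] by (simp add: batch_tail_eq_measure atLeast_0)

section \<open>Existence of solutions by Picard iteration\<close>

text \<open>Closed form of the vector A(t) y. Row i of A(t) has no nonzero entry beyond column i +
  1, so finite sums suffice and no summability has to be tracked. The formula covers i = 0 as well,
  because B_1 = 1 for batches of positive size.\<close>

definition forward_rhs ::
  "(real \<Rightarrow> real) \<Rightarrow> (real \<Rightarrow> real) \<Rightarrow> nat pmf \<Rightarrow> real \<Rightarrow> (nat \<Rightarrow> real) \<Rightarrow> nat \<Rightarrow> real" where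
  "forward_rhs lam mu b t y i =
    lam t * (pmf b i * (\<Sum>j<i. y j) - batch_tail b (Suc i) * y i)
    + mu t * (y (Suc i) - (if i = 0 then 0 else y i))"

lemma pmf_eq_0_not_states: "i \<notin> states b \<Longrightarrow> pmf b i = 0"
  by (metis Max_ge UNIV_I atLeastAtMost_iff le0 set_pmf_iff states_def)

lemma Suc_not_states: "i \<notin> states b \<Longrightarrow> Suc i \<notin> states b"
  by (auto simp: states_def split: if_splits)

text \<open>Both summation ranges can be exchanged because the matrix entries vanish beyond column i
  + 1 and \<open>y\<close> vanishes off the state space. Off the state space the closed form is 0
  too: the batch probability, \<open>y i\<close> and \<open>y (Suc i)\<close> all vanish
  there.\<close>

lemma mat_vec_eq_forward_rhs:
  assumes b0: "pmf b 0 = 0" and y: "\<And>i. i \<notin> states b \<Longrightarrow> y i = 0"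
  shows "mat_vec (states b) (A_mat lam mu b t) y i = forward_rhs lam mu b t y i"
proof (cases "i \<in> states b")
  case True
  have "(\<Sum>\<^sub>\<infinity>j\<in>states b. A_mat lam mu b t i j * y j) = (\<Sum>\<^sub>\<infinity>j\<in>{..Suc i}. A_mat lam mu b t i j * y j)"
    by (rule infsum_cong_neutral) (auto simp: y A_mat_def Q_mat_def)
  also have "\<dots> = lam t * (pmf b i * (\<Sum>j<i. y j)) + A_mat lam mu b t i i * y i + A_mat lam mu b t i (Suc i) * y (Suc i)"
    by (simp add: sum.atMost_Suc lessThan_Suc_atMost[symmetric] A_mat_def Q_mat_def
        sum_distrib_left mult.assoc)
  also have "\<dots> = forward_rhs lam mu b t y i"
    by (simp add: A_mat_def Q_mat_def forward_rhs_def batch_tail_1[OF b0] algebra_simps)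
  finally show ?thesis using True by (simp add: mat_vec_def)
next
  case False
  then show ?thesis
    by (simp add: mat_vec_def forward_rhs_def y Suc_not_states pmf_eq_0_not_states)
qed

lemma forward_rhs_diff:
  "forward_rhs lam mu b t x i - forward_rhs lam mu b t y i = forward_rhs lam mu b t (\<lambda>i. x i - y i) i"
  by (simp add: forward_rhs_def sum_subtractf algebra_simps)

locale batch_queue =
  fixes lam mu :: "real \<Rightarrow> real" and b :: "nat pmf"
  assumes lam_nonneg: "0 \<le> t \<Longrightarrow> 0 \<le> lam t"
    and mu_nonneg: "0 \<le> t \<Longrightarrow> 0 \<le> mu t"
    and lam_int: "loc_integrable lam"
    and mu_int: "loc_integrable mu"
    and b_pos: "pmf b 0 = 0"
    and b_mean: "integrable (measure_pmf b) real"
begin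

abbreviation "rhs \<equiv> forward_rhs lam mu b"

definition bmean :: real where "bmean = measure_pmf.expectation b real"

text \<open>Bounds the operator norm of A(t) on the space with weights 1 + i: arriving batches give
  lam * (1 + bmean), removal by replacement gives lam, and service gives 2 * mu.\<close>

definition rate :: "real \<Rightarrow> real" where "rate t = (2 + bmean) * lam t + 2 * mu t"

lemma sum_weighted_pmf_le: "(\<Sum>i<N. (1 + real i) * pmf b i) \<le> 1 + bmean"
proof -
  have "(\<Sum>i<N. (1 + real i) * pmf b i) = measure_pmf.expectation b (\<lambda>i. indicator {..<N} i * (1 + real i))"
    by (subst integral_measure_pmf_real[of "{..<N}"]) (auto split: split_indicator_asm)
  also have "\<dots> \<le> measure_pmf.expectation b (\<lambda>i. 1 + real i)"
    using b_mean integrable_real_mult_indicator[of "{..<N}" "measure_pmf b" "\<lambda>i. 1 + real i"]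
    by (intro integral_mono) (auto split: split_indicator simp: mult.commute)
  also have "\<dots> = 1 + bmean"
    using b_mean by (simp add: bmean_def)
  finally show ?thesis .
qed

lemma bmean_nonneg: "0 \<le> bmean"
  unfolding bmean_def by (rule integral_nonneg_AE) auto

lemma rate_nonneg: "0 \<le> t \<Longrightarrow> 0 \<le> rate t"
  using lam_nonneg mu_nonneg bmean_nonneg by (simp add: rate_def)

lemma rate_int: "loc_integrable rate"
  unfolding rate_def by (intro loc_integrable_add loc_integrable_cmult lam_int mu_int)

lemma sum_weighted_rhs_le:
  assumes t: "0 \<le> t" and y: "\<And>N. (\<Sum>i<N. (1 + real i) * \<bar>y i\<bar>) \<le> c"
  shows "(\<Sum>i<N. (1 + real i) * \<bar>rhs t y i\<bar>) \<le> rate t * c"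
proof -
  have c: "0 \<le> c" using y[of 0] by simp
  have l0: "0 \<le> lam t" and m0: "0 \<le> mu t" using t lam_nonneg mu_nonneg by auto
  have V: "\<bar>\<Sum>j<i. y j\<bar> \<le> c" for i
  proof -
    have "\<bar>\<Sum>j<i. y j\<bar> \<le> (\<Sum>j<i. 1 * \<bar>y j\<bar>)" by simp
    also have "\<dots> \<le> (\<Sum>j<i. (1 + real j) * \<bar>y j\<bar>)"
      by (intro sum_mono mult_right_mono) auto
    finally show ?thesis using y[of i] by simp
  qed
  have "(1 + real i) * \<bar>rhs t y i\<bar> \<le> lam t * (c * ((1 + real i) * pmf b i) + (1 + real i) * \<bar>y i\<bar>)
      + mu t * ((1 + real (Suc i)) * \<bar>y (Suc i)\<bar> + (1 + real i) * \<bar>y i\<bar>)" for i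
  proof -
    have "\<bar>pmf b i * (\<Sum>j<i. y j) - batch_tail b (Suc i) * y i\<bar>
        \<le> pmf b i * \<bar>\<Sum>j<i. y j\<bar> + batch_tail b (Suc i) * \<bar>y i\<bar>"
      by (intro order_trans[OF abs_triangle_ineq4]) (simp add: abs_mult batch_tail_nonneg)
    also have "\<dots> \<le> pmf b i * c + 1 * \<bar>y i\<bar>"
      using V batch_tail_le_1 by (intro add_mono mult_left_mono mult_right_mono) auto
    finally have 1: "\<bar>pmf b i * (\<Sum>j<i. y j) - batch_tail b (Suc i) * y i\<bar> \<le> pmf b i * c + \<bar>y i\<bar>" by simp
    have 2: "\<bar>y (Suc i) - (if i = 0 then 0 else y i)\<bar> \<le> \<bar>y (Suc i)\<bar> + \<bar>y i\<bar>" by auto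
    have "\<bar>rhs t y i\<bar> \<le> lam t * (pmf b i * c + \<bar>y i\<bar>) + mu t * (\<bar>y (Suc i)\<bar> + \<bar>y i\<bar>)"
      unfolding forward_rhs_def
      by (intro order_trans[OF abs_triangle_ineq] add_mono)
         (simp_all only: abs_mult abs_of_nonneg[OF l0] abs_of_nonneg[OF m0] mult_left_mono[OF 1 l0] mult_left_mono[OF 2 m0])
    then have "(1 + real i) * \<bar>rhs t y i\<bar> \<le> (1 + real i) * (lam t * (pmf b i * c + \<bar>y i\<bar>) + mu t * (\<bar>y (Suc i)\<bar> + \<bar>y i\<bar>))"
      by (intro mult_left_mono) auto
    \<comment> \<open>The extra term raises the weight of \<open>y (Suc i)\<close> from 1 + i to 1 +
      (i + 1), so the shifted sum is again a weighted sum bounded by \<open>c\<close>.\<close>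
    also have "\<dots> \<le> \<dots> + mu t * \<bar>y (Suc i)\<bar>"
      using m0 by simp
    finally show ?thesis by (simp add: algebra_simps)
  qed
  then have "(\<Sum>i<N. (1 + real i) * \<bar>rhs t y i\<bar>) \<le>
      (\<Sum>i<N. lam t * (c * ((1 + real i) * pmf b i) + (1 + real i) * \<bar>y i\<bar>)
      + mu t * ((1 + real (Suc i)) * \<bar>y (Suc i)\<bar> + (1 + real i) * \<bar>y i\<bar>))"
    by (intro sum_mono)
  also have "\<dots> = lam t * (c * (\<Sum>i<N. (1 + real i) * pmf b i) + (\<Sum>i<N. (1 + real i) * \<bar>y i\<bar>))
      + mu t * ((\<Sum>i<N. (1 + real (Suc i)) * \<bar>y (Suc i)\<bar>) + (\<Sum>i<N. (1 + real i) * \<bar>y i\<bar>))"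
    by (simp only: sum.distrib flip: sum_distrib_left)
  also have "\<dots> \<le> lam t * (c * (1 + bmean) + c) + mu t * (c + c)"
  proof -
    have "(\<Sum>i<N. (1 + real (Suc i)) * \<bar>y (Suc i)\<bar>) \<le> (\<Sum>i<Suc N. (1 + real i) * \<bar>y i\<bar>)"
      unfolding sum.lessThan_Suc_shift by simp
    then have "(\<Sum>i<N. (1 + real (Suc i)) * \<bar>y (Suc i)\<bar>) \<le> c"
      using y[of "Suc N"] by linarith
    then show ?thesis
      using y[of N] sum_weighted_pmf_le l0 m0 c by (intro add_mono mult_left_mono) auto
  qed
  also have "\<dots> = rate t * c"
    by (simp add: rate_def algebra_simps)
  finally show ?thesis .
qed

lemma rhs_loc_integrable:
  assumes "\<And>i. continuous_on {0..} (\<lambda>u. y u i)"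
  shows "loc_integrable (\<lambda>u. rhs u (y u) i)"
proof -
  have "loc_integrable (\<lambda>u. (pmf b i * (\<Sum>j<i. y u j) - batch_tail b (Suc i) * y u i) * lam u
      + (y u (Suc i) - (if i = 0 then 0 else y u i)) * mu u)"
  proof (intro loc_integrable_add loc_integrable_mult_continuous[OF lam_int] loc_integrable_mult_continuous[OF mu_int])
    show "continuous_on {0..} (\<lambda>u. y u (Suc i) - (if i = 0 then 0 else y u i))"
      by (cases "i = 0") (auto intro!: continuous_intros assms)
  qed (intro continuous_intros assms)
  then show ?thesis
    by (simp add: forward_rhs_def mult.commute)
qed

fun picard :: "(nat \<Rightarrow> real) \<Rightarrow> nat \<Rightarrow> real \<Rightarrow> nat \<Rightarrow> real" where
  "picard y0 0 t i = y0 i"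
| "picard y0 (Suc n) t i = y0 i + integral {0..t} (\<lambda>u. rhs u (picard y0 n u) i)"

lemma picard_0: "picard y0 0 t = y0"
  by (rule ext) simp

lemma picard_continuous: "continuous_on {0..} (\<lambda>t. picard y0 n t i)"
proof (induction n arbitrary: i)
  case (Suc n)
  have "ac_on R (\<lambda>t. integral {0..t} (\<lambda>u. rhs u (picard y0 n u) i))" for R
    by (rule ac_on_integral, rule loc_integrableD(1)[OF rhs_loc_integrable[OF Suc]]) simp
  then show ?case
    by (simp only: picard.simps) (intro continuous_intros ac_on_continuous_Ici)
qed auto

lemma picard_rhs_int: "loc_integrable (\<lambda>u. rhs u (picard y0 n u) i)"
  by (intro rhs_loc_integrable picard_continuous)

context
  fixes y0 :: "nat \<Rightarrow> real" and c :: real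
  assumes y0: "\<And>N. (\<Sum>i<N. (1 + real i) * \<bar>y0 i\<bar>) \<le> c"
begin

lemma c_nonneg: "0 \<le> c"
  using y0[of 0] by simp

text \<open>The map is linear, so consecutive differences iterate: each step multiplies by
  \<open>rate\<close> and integrates, which turns the n-th power of the integral over n! into the
  next one.\<close>

lemma picard_diff_le:
  assumes "0 \<le> t"
  shows "(\<Sum>i<N. (1 + real i) * \<bar>picard y0 (Suc n) t i - picard y0 n t i\<bar>) \<le> c * (integral {0..t} rate ^ Suc n / fact (Suc n))"
  using assms
proof (induction n arbitrary: t N)
  case 0
  have "(\<Sum>i<N. (1 + real i) * \<bar>integral {0..t} (\<lambda>u. rhs u y0 i)\<bar>) \<le> integral {0..t} (\<lambda>u. rate u * c)"
  proof (rule sum_abs_integral_le)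
    show "(\<lambda>u. rhs u y0 i) absolutely_integrable_on {0..t}" for i
      using loc_integrableD(1)[OF picard_rhs_int[of y0 0 i], of 0 t] by (simp only: picard_0)
    show "(\<lambda>u. rate u * c) integrable_on {0..t}"
      using loc_integrableD(2)[OF loc_integrable_cmult[OF rate_int, of c], of 0 t] by (simp add: mult.commute)
  qed (use sum_weighted_rhs_le[OF _ y0] in auto)
  then show ?case by (simp add: mult.commute picard_0)
next
  case (Suc n)
  define h where "h u = c * (rate u * integral {0..u} rate ^ Suc n / fact (Suc n))" for u
  have "integral {0..u} rate \<ge> 0" if "0 \<le> u" for u
    using rate_nonneg that by (intro integral_nonneg loc_integrableD(2)[OF rate_int]) auto
  have hint: "loc_integrable h"
  proof -
    have "continuous_on {0..} (\<lambda>u. integral {0..u} rate)"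
      by (intro ac_on_continuous_Ici ac_on_integral loc_integrableD(1)[OF rate_int]) auto
    then have "loc_integrable (\<lambda>u. (c * (integral {0..u} rate ^ Suc n / fact (Suc n))) * rate u)"
      by (intro loc_integrable_mult_continuous[OF rate_int] continuous_intros) auto
    then show ?thesis by (simp add: h_def[abs_def] mult_ac)
  qed
  have diff: "picard y0 (Suc (Suc n)) t i - picard y0 (Suc n) t i
    = integral {0..t} (\<lambda>u. rhs u (\<lambda>i. picard y0 (Suc n) u i - picard y0 n u i) i)" for i
  proof -
    have "picard y0 (Suc (Suc n)) t i - picard y0 (Suc n) t i
      = integral {0..t} (\<lambda>u. rhs u (picard y0 (Suc n) u) i) - integral {0..t} (\<lambda>u. rhs u (picard y0 n u) i)"
      by (simp only: picard.simps(2)[of y0 "Suc n"] picard.simps(2)[of y0 n t i])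
    also have "\<dots> = integral {0..t} (\<lambda>u. rhs u (picard y0 (Suc n) u) i - rhs u (picard y0 n u) i)"
      by (intro integral_diff[symmetric] loc_integrableD(2)[OF picard_rhs_int]) auto
    finally show ?thesis by (simp only: forward_rhs_diff)
  qed
  have "(\<Sum>i<N. (1 + real i) * \<bar>integral {0..t} (\<lambda>u. rhs u (\<lambda>i. picard y0 (Suc n) u i - picard y0 n u i) i)\<bar>)
      \<le> integral {0..t} h"
  proof (rule sum_abs_integral_le)
    show "(\<lambda>u. rhs u (\<lambda>i. picard y0 (Suc n) u i - picard y0 n u i) i) absolutely_integrable_on {0..t}" for i
      by (rule loc_integrableD(1)[OF rhs_loc_integrable]) (intro continuous_intros picard_continuous, rule order_refl)
    show "h integrable_on {0..t}" using loc_integrableD(2)[OF hint] by auto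
    show "(\<Sum>i<N. (1 + real i) * \<bar>rhs u (\<lambda>i. picard y0 (Suc n) u i - picard y0 n u i) i\<bar>) \<le> h u"
      if "u \<in> {0..t}" for u
      using sum_weighted_rhs_le[OF _ Suc.IH] that by (simp only: h_def) (simp add: mult_ac)
  qed auto
  also have "integral {0..t} h = c * (integral {0..t} rate ^ Suc (Suc n) / fact (Suc (Suc n)))"
    unfolding h_def integral_mult_right integral_power_primitive[OF rate_int Suc.prems] ..
  finally show ?case by (simp only: diff)
qed

lemma picard_le:
  assumes t: "0 \<le> t"
  shows "(\<Sum>i<N. (1 + real i) * \<bar>picard y0 n t i\<bar>) \<le> c * exp (integral {0..t} rate)"
proof -
  define G where "G = integral {0..t} rate"
  have G: "0 \<le> G"
    unfolding G_def using rate_nonneg by (intro integral_nonneg loc_integrableD(2)[OF rate_int]) auto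
  have "(\<Sum>i<N. (1 + real i) * \<bar>picard y0 n t i\<bar>) \<le> c * (\<Sum>k<Suc n. G ^ k / fact k)"
  proof (induction n)
    case 0
    then show ?case using y0 by simp
  next
    case (Suc n)
    have "(\<Sum>i<N. (1 + real i) * \<bar>picard y0 (Suc n) t i\<bar>) \<le>
      (\<Sum>i<N. (1 + real i) * \<bar>picard y0 n t i\<bar> + (1 + real i) * \<bar>picard y0 (Suc n) t i - picard y0 n t i\<bar>)"
      unfolding distrib_left[symmetric] by (intro sum_mono mult_left_mono) auto
    also have "\<dots> \<le> c * (\<Sum>k<Suc n. G ^ k / fact k) + c * (G ^ Suc n / fact (Suc n))"
      unfolding sum.distrib using Suc picard_diff_le[OF t, of n N] by (simp only: G_def add_mono)
    also have "\<dots> = c * (\<Sum>k<Suc (Suc n). G ^ k / fact k)"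
      unfolding sum.lessThan_Suc[of _ "Suc n"] distrib_left ..
    finally show ?case .
  qed
  also have "\<dots> \<le> c * exp G"
  proof (intro mult_left_mono c_nonneg)
    show "(\<Sum>k<Suc n. G ^ k / fact k) \<le> exp G"
      using sum_le_suminf[OF summable_exp[of G], of "{..<Suc n}"] G
      by (simp add: exp_def divide_inverse mult.commute del: sum.lessThan_Suc)
  qed
  finally show ?thesis by (simp add: G_def)
qed

text \<open>Limit of the iterates, written as a telescoping series so that
  \<open>picard_diff_le\<close> gives convergence by comparison with the exponential series.\<close>

definition sol :: "real \<Rightarrow> nat \<Rightarrow> real" where
  "sol t i = y0 i + (\<Sum>n. picard y0 (Suc n) t i - picard y0 n t i)"

lemma picard_tendsto:
  assumes t: "0 \<le> t"
  shows "(\<lambda>n. picard y0 n t i) \<longlonglongrightarrow> sol t i"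
proof -
  define G where "G = integral {0..t} rate"
  have "summable (\<lambda>n. picard y0 (Suc n) t i - picard y0 n t i)"
  proof (rule summable_comparison_test')
    have "summable (\<lambda>n. G ^ Suc n / fact (Suc n))"
      using summable_Suc_iff[of "\<lambda>n. G ^ n / fact n"] summable_exp[of G] by (simp add: field_simps)
    then show "summable (\<lambda>n. c * (G ^ Suc n / fact (Suc n)))"
      by (rule summable_mult)
    fix n :: nat
    have "\<bar>picard y0 (Suc n) t i - picard y0 n t i\<bar> \<le> (1 + real i) * \<bar>picard y0 (Suc n) t i - picard y0 n t i\<bar>"
      by (simp only: distrib_right) simp
    also have "\<dots> \<le> (\<Sum>i<Suc i. (1 + real i) * \<bar>picard y0 (Suc n) t i - picard y0 n t i\<bar>)"
      by (rule member_le_sum) auto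
    also have "\<dots> \<le> c * (G ^ Suc n / fact (Suc n))"
      unfolding G_def by (rule picard_diff_le[OF t])
    finally show "norm (picard y0 (Suc n) t i - picard y0 n t i) \<le> c * (G ^ Suc n / fact (Suc n))"
      by simp
  qed
  then have "(\<lambda>m. y0 i + (\<Sum>n<m. picard y0 (Suc n) t i - picard y0 n t i)) \<longlonglongrightarrow> sol t i"
    unfolding sol_def by (intro tendsto_intros summable_LIMSEQ)
  then show ?thesis
    unfolding sum_lessThan_telescope[of "\<lambda>n. picard y0 n t i"] by simp
qed

lemma sol_le: 
  assumes t: "0 \<le> t"
  shows "(\<Sum>i<N. (1 + real i) * \<bar>sol t i\<bar>) \<le> c * exp (integral {0..t} rate)"
proof (rule LIMSEQ_le_const2)
  show "(\<lambda>n. \<Sum>i<N. (1 + real i) * \<bar>picard y0 n t i\<bar>) \<longlonglongrightarrow> (\<Sum>i<N. (1 + real i) * \<bar>sol t i\<bar>)"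
    by (intro tendsto_intros picard_tendsto t)
qed (use picard_le[OF t] in blast)

lemma rate_exp_int: "loc_integrable (\<lambda>t. rate t * (c * exp (integral {0..t} rate)))"
proof -
  have "continuous_on {0..} (\<lambda>u. integral {0..u} rate)"
    by (intro ac_on_continuous_Ici ac_on_integral loc_integrableD(1)[OF rate_int]) auto
  then have "loc_integrable (\<lambda>t. (c * exp (integral {0..t} rate)) * rate t)"
    by (intro loc_integrable_mult_continuous[OF rate_int] continuous_intros) auto
  then show ?thesis by (simp add: mult_ac)
qed

lemma unweighted_le:
  assumes "\<And>N. (\<Sum>i<N. (1 + real i) * \<bar>x i\<bar>) \<le> d"
  shows "(\<Sum>i<N. \<bar>x i\<bar>) \<le> d"
proof -
  have "(\<Sum>i<N. 1 * \<bar>x i\<bar>) \<le> (\<Sum>i<N. (1 + real i) * \<bar>x i\<bar>)"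
    by (intro sum_mono mult_right_mono) auto
  then show ?thesis using assms[of N] by simp
qed

text \<open>Passage to the limit under the integral by dominated convergence; the uniform bound
  \<open>picard_le\<close> supplies the majorant. The integrands converge pointwise because each
  coordinate of the right-hand side involves finitely many coordinates.\<close>

lemma sol_integral:
  assumes t: "0 \<le> t"
  shows "(\<lambda>u. rhs u (sol u) i) absolutely_integrable_on {0..t}"
    and "sol t i = y0 i + integral {0..t} (\<lambda>u. rhs u (sol u) i)"
proof -
  define h where "h u = rate u * (c * exp (integral {0..u} rate))" for u
  have hint: "h integrable_on {0..t}"
    using loc_integrableD(2)[OF rate_exp_int] by (simp add: h_def[abs_def])
  have le: "norm (rhs u (picard y0 n u) i) \<le> h u" if "0 \<le> u" for u n
  proof -
    have "norm (rhs u (picard y0 n u) i) \<le> (\<Sum>j<Suc i. \<bar>rhs u (picard y0 n u) j\<bar>)"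
      by (simp only: real_norm_def) (rule member_le_sum, auto)
    also have "\<dots> \<le> h u"
      unfolding h_def by (intro unweighted_le sum_weighted_rhs_le picard_le that)
    finally show ?thesis .
  qed
  have lim: "(\<lambda>n. rhs u (picard y0 n u) i) \<longlonglongrightarrow> rhs u (sol u) i" if "0 \<le> u" for u
    unfolding forward_rhs_def
    by (cases "i = 0") (auto intro!: tendsto_intros picard_tendsto that simp del: picard.simps)
  have pint: "(\<lambda>u. rhs u (picard y0 n u) i) absolutely_integrable_on {0..t}" for n
    by (rule loc_integrableD(1)[OF picard_rhs_int]) simp
  show "(\<lambda>u. rhs u (sol u) i) absolutely_integrable_on {0..t}"
  proof (rule dominated_convergence_absolutely_integrable[where f = "\<lambda>n u. rhs u (picard y0 n u) i" and h = h])
    show "norm (rhs u (sol u) i) \<le> h u" if "u \<in> {0..t}" for u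
      by (rule LIMSEQ_le_const2[OF tendsto_norm[OF lim]]) (use that le in auto)
  qed (use pint hint lim in auto)
  have "(\<lambda>n. integral {0..t} (\<lambda>u. rhs u (picard y0 n u) i)) \<longlonglongrightarrow> integral {0..t} (\<lambda>u. rhs u (sol u) i)"
    by (rule dominated_convergence(2)[of _ _ h]) (use pint hint le lim in \<open>auto simp: absolutely_integrable_on_def\<close>)
  then have "(\<lambda>n. picard y0 (Suc n) t i) \<longlonglongrightarrow> y0 i + integral {0..t} (\<lambda>u. rhs u (sol u) i)"
    by (simp only: picard.simps) (intro tendsto_intros)
  moreover have "(\<lambda>n. picard y0 (Suc n) t i) \<longlonglongrightarrow> sol t i"
    by (rule LIMSEQ_Suc[OF picard_tendsto[OF t]])
  ultimately show "sol t i = y0 i + integral {0..t} (\<lambda>u. rhs u (sol u) i)"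
    using LIMSEQ_unique by blast
qed

text \<open>For bounded batch sizes this keeps the iteration inside the truncated state space:
  nothing enters from below, since the batch probability is 0, nor from above.\<close>

lemma picard_not_states:
  assumes z: "\<And>i. i \<notin> states b \<Longrightarrow> y0 i = 0" and i: "i \<notin> states b"
  shows "picard y0 n t i = 0"
  using i
proof (induction n arbitrary: t i)
  case (Suc n)
  have "rhs u (picard y0 n u) i = 0" for u
    using Suc.IH[of i] Suc.IH[of "Suc i"] Suc.prems
    by (simp add: forward_rhs_def Suc_not_states pmf_eq_0_not_states del: picard.simps)
  then show ?case using z Suc.prems by simp
qed (use z in auto)

text \<open>The weighted bound is exported along with the solution because it gives a finite first
  moment at every time.\<close>

lemma forward_solution_exists:
  assumes z: "\<And>i. i \<notin> states b \<Longrightarrow> y0 i = 0"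
  obtains p where "forward_solution lam mu b p" "p 0 = y0"
    "\<And>t N. 0 \<le> t \<Longrightarrow> (\<Sum>i<N. (1 + real i) * \<bar>p t i\<bar>) \<le> c * exp (integral {0..t} rate)"
proof
  have sol0: "sol 0 i = y0 i" for i
    using sol_integral(2)[of 0 i] by simp
  then show "sol 0 = y0" by auto
  have zero: "sol t i = 0" if "0 \<le> t" "i \<notin> states b" for t i
    using picard_tendsto[OF that(1), of i] picard_not_states[OF z that(2)]
    by (simp add: LIMSEQ_const_iff del: picard.simps)
  have rint: "loc_integrable (\<lambda>u. rhs u (sol u) i)" for i
    using sol_integral(1) by (auto simp: loc_integrable_def)
  note curve = rint rate_exp_int unweighted_le[OF sum_weighted_rhs_le[OF _ sol_le]]
  have eq: "sol t i = sol 0 i + integral {0..t} (\<lambda>u. rhs u (sol u) i)" if "0 \<le> t" for t i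
    unfolding sol0 by (rule sol_integral(2)[OF that])
  have ac: "l1_loc_abs_cont sol"
    by (rule l1_curve_loc_abs_cont[where f = "\<lambda>i u. rhs u (sol u) i" and h = "\<lambda>t. rate t * (c * exp (integral {0..t} rate))"])
       (auto intro: curve eq)
  have ae: "AE t in lebesgue. 0 < t \<longrightarrow>
      ((\<lambda>h. l1_norm (\<lambda>i. (sol (t + h) i - sol t i) / h - rhs t (sol t) i)) \<longlongrightarrow> 0) (at 0)"
    by (rule l1_curve_derivative[where f = "\<lambda>i u. rhs u (sol u) i" and h = "\<lambda>t. rate t * (c * exp (integral {0..t} rate))"])
       (auto intro: curve eq)
  have mv: "mat_vec (states b) (A_mat lam mu b t) (sol t) = rhs t (sol t)" if "0 < t" for t
    using mat_vec_eq_forward_rhs[OF b_pos, of "sol t" lam mu t] zero that by (intro ext) auto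
  have fin: "l1_norm (sol t) < \<infinity>" if "0 \<le> t" for t
    using l1_norm_leI[OF unweighted_le[OF sol_le[OF that]]] by (rule order.strict_trans1) simp
  show "forward_solution lam mu b sol"
    unfolding forward_solution_def
    using ac fin zero ae by (auto simp: mv elim!: eventually_mono)
qed (rule sol_le)

end

end

section \<open>Comparison with a pure death process\<close>

text \<open>These are the points where the modulus of a differentiable function has a corner. Such a
  zero is isolated, so it is the only zero in some interval with rational endpoints, and there are
  countably many of those.\<close>

lemma countable_simple_zeros:
  fixes f :: "real \<Rightarrow> real"
  shows "countable {t. f t = 0 \<and> (\<exists>D. D \<noteq> 0 \<and> (f has_real_derivative D) (at t))}" (is "countable ?S")
proof -
  define T where "T = (\<lambda>(r, s). {t. r < t \<and> t < s \<and> f t = 0 \<and> (\<forall>y. r < y \<and> y < s \<and> y \<noteq> t \<longrightarrow> f y \<noteq> 0)})"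
  have "countable (T i)" for i
  proof (cases i)
    case (Pair r s)
    have "t = t'" if "t \<in> T (r, s)" "t' \<in> T (r, s)" for t t'
      using that unfolding T_def by blast
    \<comment> \<open>A set with at most one element lies in the singleton of its chosen element,
      whether or not it is empty.\<close>
    then have "T (r, s) \<subseteq> {SOME t. t \<in> T (r, s)}"
      by (metis singletonI someI subsetI)
    then show ?thesis using Pair countable_subset by blast
  qed
  then have "countable (\<Union>i\<in>\<rat> \<times> \<rat>. T i)"
    using countable_rat by (intro countable_UN countable_SIGMA) auto
  moreover have "?S \<subseteq> (\<Union>i\<in>\<rat> \<times> \<rat>. T i)"
  proof
    fix t assume "t \<in> ?S"
    then obtain D where t: "f t = 0" "D \<noteq> 0" "(f has_real_derivative D) (at t)" by auto
    then have "((\<lambda>h. f (t + h) / h) \<longlongrightarrow> D) (at 0)" by (simp add: DERIV_def)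
    then have "\<forall>\<^sub>F h in at 0. f (t + h) / h \<noteq> 0"
      using t(2) by (rule tendsto_imp_eventually_ne)
    then obtain d where d: "d > 0" "\<And>h. \<lbrakk>h \<noteq> 0; \<bar>h\<bar> < d\<rbrakk> \<Longrightarrow> f (t + h) \<noteq> 0"
      unfolding eventually_at by (auto simp: dist_real_def)
    obtain r where r: "r \<in> \<rat>" "t - d < r" "r < t" using Rats_dense_in_real[of "t - d" t] d by auto
    obtain s where s: "s \<in> \<rat>" "t < s" "s < t + d" using Rats_dense_in_real[of t "t + d"] d by auto
    have "f y \<noteq> 0" if "r < y \<and> y < s \<and> y \<noteq> t" for y
    proof -
      have "\<bar>y - t\<bar> < d" using that r s by linarith
      then show ?thesis using d(2)[of "y - t"] that by simp
    qed
    then have "t \<in> T (r, s)" using t r s by (auto simp: T_def)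
    then show "t \<in> (\<Union>i\<in>\<rat> \<times> \<rat>. T i)" using r s by blast
  qed
  ultimately show ?thesis by (rule countable_subset[rotated])
qed

text \<open>At a zero with vanishing derivative the quotients of the modulus also tend to 0, and
  \<open>sgn 0 = 0\<close> makes one formula cover both cases. Elsewhere the modulus is locally
  \<open>f\<close> times a fixed sign.\<close>

lemma has_real_derivative_abs:
  assumes "(f has_real_derivative D) (at t)" "f t = 0 \<Longrightarrow> D = 0"
  shows "((\<lambda>t. \<bar>f t\<bar>) has_real_derivative sgn (f t) * D) (at t)"
proof (cases "f t = 0")
  case True
  have "((\<lambda>h. f (t + h) / h) \<longlongrightarrow> 0) (at 0)"
    using assms True by (simp add: DERIV_def)
  then have "((\<lambda>h. \<bar>f (t + h)\<bar> / h) \<longlongrightarrow> 0) (at 0)"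
    by (subst (asm) tendsto_rabs_zero_iff[symmetric], subst tendsto_rabs_zero_iff[symmetric]) simp
  then show ?thesis using True by (simp add: DERIV_def)
next
  case False
  then have ne: "sgn (f t) * f t > 0" by (simp add: sgn_if)
  have "isCont f t" using assms(1) by (rule DERIV_isCont)
  then have "((\<lambda>s. sgn (f t) * f s) \<longlongrightarrow> sgn (f t) * f t) (nhds t)"
    by (intro tendsto_intros) (simp add: isCont_def tendsto_at_iff_tendsto_nhds)
  then have "\<forall>\<^sub>F s in nhds t. 0 < sgn (f t) * f s"
    using ne by (rule order_tendstoD(1))
  then have "\<forall>\<^sub>F s in nhds t. \<bar>f s\<bar> = sgn (f t) * f s"
    by eventually_elim (auto simp: sgn_if zero_less_mult_iff split: if_splits)
  then show ?thesis
    using DERIV_cmult[OF assms(1), of "sgn (f t)"] by (simp add: DERIV_cong_ev)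
qed

context
  fixes V :: "nat \<Rightarrow> real \<Rightarrow> real" and a :: "nat \<Rightarrow> real \<Rightarrow> real" and mu :: "real \<Rightarrow> real"
    and R K :: real and N :: "real set"
  assumes R: "0 \<le> R" and mu_nonneg: "\<And>t. 0 \<le> t \<Longrightarrow> 0 \<le> mu t" and mu_int: "loc_integrable mu"
    and N: "negligible N" and ac: "\<And>k. ac_on R (V k)"
    and a: "\<And>k t. 0 \<le> t \<Longrightarrow> 0 \<le> a k t"
    and D: "\<And>k t. \<lbrakk>1 \<le> k; 0 < t; t < R; t \<notin> N\<rbrakk> \<Longrightarrow>
      (V k has_real_derivative (mu t * (V (Suc k) t - V k t) - a k t * V k t)) (at t)"
    and K: "\<And>k t. \<lbrakk>0 \<le> t; t \<le> R\<rbrakk> \<Longrightarrow> \<bar>V k t\<bar> \<le> K"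
begin

text \<open>In the proof, \<open>H(u)\<close> is the truncated Poisson expectation started from the moduli at time \<open>u\<close>
  instead of 0, plus a crude bound for the truncated terms. It is nonincreasing in \<open>u\<close>, because the
  derivatives of consecutive terms telescope.\<close>

lemma poisson_comparison:
  assumes k: "1 \<le> k"
  defines "M \<equiv> integral {0..R} mu"
  shows "\<bar>V k R\<bar> \<le> exp (- M) * ((\<Sum>n<Suc m. M ^ n / fact n * \<bar>V (k + n) 0\<bar>) + M ^ Suc m / fact (Suc m) * (K * exp M))"
proof -
  define I where "I t = integral {0..t} mu" for t
  have I0: "I 0 = 0" "I R = M" by (auto simp: I_def M_def)
  have I_nonneg: "0 \<le> I t" "I t \<le> M" if "0 \<le> t" "t \<le> R" for t
  proof -
    show "0 \<le> I t"
      unfolding I_def using mu_nonneg by (intro integral_nonneg loc_integrableD(2)[OF mu_int]) auto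
    have "0 \<le> integral {t..R} mu"
      using mu_nonneg that by (intro integral_nonneg loc_integrableD(2)[OF mu_int]) auto
    then show "I t \<le> M"
      using integral_diff_interval[OF mu_int that] by (simp add: I_def M_def)
  qed
  have acI: "ac_on R I"
    unfolding I_def by (intro ac_on_integral loc_integrableD(1)[OF mu_int]) simp
  obtain N1 where N1: "negligible N1" "\<And>t. \<lbrakk>0 < t; t \<notin> N1\<rbrakk> \<Longrightarrow> (I has_real_derivative mu t) (at t)"
    using lebesgue_differentiation[OF mu_int] unfolding I_def by metis
  define Z where "Z j = {t. V j t = 0 \<and> (\<exists>D. D \<noteq> 0 \<and> (V j has_real_derivative D) (at t))}" for j
  define E where "E = N \<union> N1 \<union> (\<Union>j. Z j)"
  have "countable (\<Union>j. Z j)"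
    unfolding Z_def by (intro countable_UN countable_simple_zeros) auto
  then have "negligible (\<Union>j. Z j)"
    by (metis countable_imp_null_set_lborel negligible_iff_null_sets null_sets_completionI)
  then have E: "negligible E"
    unfolding E_def using N N1 by (intro negligible_Un)
  \<comment> \<open>The exponential is an integrating factor: it removes the loss term with rate
    \<open>mu\<close>, leaving only the inflow from level j + 1. Killing has a favourable
    sign.\<close>
  define g where "g j t = exp (I t) * \<bar>V j t\<bar>" for j t
  have Dg: "\<exists>D'. (g j has_real_derivative D') (at t) \<and> D' \<le> mu t * g (Suc j) t"
    if "1 \<le> j" "0 < t" "t < R" "t \<notin> E" for j t
  proof -
    define D0 where "D0 = mu t * (V (Suc j) t - V j t) - a j t * V j t"
    have D0: "(V j has_real_derivative D0) (at t)"
      unfolding D0_def by (rule D) (use that in \<open>auto simp: E_def\<close>)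
    have z: "D0 = 0" if "V j t = 0"
      using \<open>t \<notin> E\<close> D0 that by (auto simp: E_def Z_def)
    have "(I has_real_derivative mu t) (at t)"
      by (rule N1) (use that in \<open>auto simp: E_def\<close>)
    then have "(g j has_real_derivative (exp (I t) * mu t) * \<bar>V j t\<bar> + (sgn (V j t) * D0) * exp (I t)) (at t)"
      unfolding g_def by (intro DERIV_mult DERIV_fun_exp has_real_derivative_abs[OF D0 z])
    moreover have "sgn (V j t) * D0 \<le> mu t * (\<bar>V (Suc j) t\<bar> - \<bar>V j t\<bar>)"
    proof -
      have "sgn (V j t) * D0 = mu t * (sgn (V j t) * V (Suc j) t - \<bar>V j t\<bar>) - a j t * \<bar>V j t\<bar>"
        by (simp add: D0_def algebra_simps abs_sgn)
      also have "\<dots> \<le> mu t * (sgn (V j t) * V (Suc j) t - \<bar>V j t\<bar>)"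
        using a[of t j] that by simp
      also have "\<dots> \<le> mu t * (\<bar>V (Suc j) t\<bar> - \<bar>V j t\<bar>)"
        using mu_nonneg[of t] that by (intro mult_left_mono diff_right_mono) (auto simp: sgn_if)
      finally show ?thesis .
    qed
    then have "(exp (I t) * mu t) * \<bar>V j t\<bar> + (sgn (V j t) * D0) * exp (I t)
      \<le> (exp (I t) * mu t) * \<bar>V j t\<bar> + (mu t * (\<bar>V (Suc j) t\<bar> - \<bar>V j t\<bar>)) * exp (I t)"
      by (intro add_left_mono mult_right_mono) auto
    then have "(exp (I t) * mu t) * \<bar>V j t\<bar> + (sgn (V j t) * D0) * exp (I t) \<le> mu t * g (Suc j) t"
      by (simp add: g_def algebra_simps)
    ultimately show ?thesis by blast
  qed
  \<comment> \<open>Poisson weights for the remaining interval from u to R, without their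
    exponential factor, which is restored at the end.\<close>
  define c where "c n u = (M - I u) ^ n / fact n" for n u
  define K' where "K' = K * exp M"
  define H where "H u = (\<Sum>n<Suc m. c n u * g (k + n) u) + c (Suc m) u * K'" for u
  have "H R \<le> H 0"
  proof (rule ac_on_nonincreasing[OF _ R E])
    have "ac_on R (c n)" for n
      unfolding c_def using ac_on_mult[OF ac_on_power[OF ac_on_diff[OF ac_on_const acI]] ac_on_const, of M n "1 / fact n"]
      by simp
    moreover have "ac_on R (g j)" for j
      unfolding g_def by (intro ac_on_mult ac_on_exp acI ac_on_abs ac)
    ultimately show "ac_on R H"
      unfolding H_def by (intro ac_on_add ac_on_sum ac_on_mult ac_on_const)
    fix t assume t: "0 < t" "t < R" "t \<notin> E"
    have DI: "(I has_real_derivative mu t) (at t)"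
      by (rule N1) (use t in \<open>auto simp: E_def\<close>)
    define c' where "c' n = (case n of 0 \<Rightarrow> 0 | Suc n \<Rightarrow> - (mu t * c n t))" for n
    have Dc: "(c n has_real_derivative c' n) (at t)" for n
    proof (cases n)
      case (Suc i)
      have "((\<lambda>u. (M - I u) ^ Suc i / fact (Suc i)) has_real_derivative
          (real (Suc i) * ((0 - mu t) * (M - I t) ^ i)) / fact (Suc i)) (at t)"
        by (rule DERIV_cdivide) (use DERIV_power[OF DERIV_diff[OF DERIV_const DI], of M "Suc i"] in simp)
      moreover have "(real (Suc i) * ((0 - mu t) * (M - I t) ^ i)) / fact (Suc i) = c' n"
        by (simp add: c'_def c_def Suc fact_Suc del: of_nat_Suc)
      ultimately show ?thesis by (simp add: c_def[abs_def] Suc)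
    qed (simp add: c'_def c_def[abs_def])
    have c_nonneg: "0 \<le> c n t" for n
      using I_nonneg(2)[of t] t by (simp add: c_def)
    have m0: "0 \<le> mu t" using mu_nonneg t by simp
    have "\<forall>n. \<exists>D'. (g (k + n) has_real_derivative D') (at t) \<and> D' \<le> mu t * g (Suc (k + n)) t"
      using Dg k t by auto
    then obtain g' where g': "\<And>n. (g (k + n) has_real_derivative g' n) (at t)"
      "\<And>n. g' n \<le> mu t * g (Suc (k + n)) t" by metis
    have "(H has_real_derivative (\<Sum>n<Suc m. c' n * g (k + n) t + g' n * c n t) + (c' (Suc m) * K' + 0 * c (Suc m) t)) (at t)"
      unfolding H_def by (intro DERIV_add DERIV_sum DERIV_mult Dc g' DERIV_const)
    moreover have "(\<Sum>n<Suc m. c' n * g (k + n) t + g' n * c n t) + (c' (Suc m) * K' + 0 * c (Suc m) t) \<le> 0"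
    proof -
      have "(\<Sum>n<Suc m. c' n * g (k + n) t) = - (\<Sum>n<m. mu t * c n t * g (Suc (k + n)) t)"
        unfolding sum.lessThan_Suc_shift by (simp add: c'_def sum_negf)
      moreover have "(\<Sum>n<Suc m. g' n * c n t) \<le> (\<Sum>n<Suc m. mu t * c n t * g (Suc (k + n)) t)"
        using mult_right_mono[OF g'(2) c_nonneg] by (intro sum_mono) (simp add: mult_ac)
      ultimately have "(\<Sum>n<Suc m. c' n * g (k + n) t + g' n * c n t) \<le> mu t * c m t * g (Suc (k + m)) t"
        unfolding sum.distrib by simp
      \<comment> \<open>After telescoping only the inflow into the last retained level survives; the
        derivative of the remainder term, - mu * c m * K', cancels its bound exactly.\<close>
      also have "\<dots> \<le> mu t * c m t * K'"
      proof (intro mult_left_mono mult_nonneg_nonneg m0 c_nonneg)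
        have "g (Suc (k + m)) t \<le> exp M * K"
          unfolding g_def using I_nonneg(2)[of t] t K by (intro mult_mono) auto
        then show "g (Suc (k + m)) t \<le> K'" by (simp add: K'_def mult.commute)
      qed
      finally show ?thesis by (simp add: c'_def)
    qed
    ultimately show "\<exists>D\<le>0. (H has_real_derivative D) (at t)" by blast
  qed
  \<comment> \<open>At u = R the weights of positive index vanish and the weight of index 0 is
    1.\<close>
  moreover have "H R = exp M * \<bar>V k R\<bar>"
    unfolding H_def sum.lessThan_Suc_shift by (simp add: c_def g_def I0)
  moreover have "H 0 = (\<Sum>n<Suc m. M ^ n / fact n * \<bar>V (k + n) 0\<bar>) + M ^ Suc m / fact (Suc m) * (K * exp M)"
    by (simp add: H_def c_def g_def I0 K'_def)
  ultimately have le: "exp M * \<bar>V k R\<bar> \<le> (\<Sum>n<Suc m. M ^ n / fact n * \<bar>V (k + n) 0\<bar>) + M ^ Suc m / fact (Suc m) * (K * exp M)"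
    by simp
  have "\<bar>V k R\<bar> = exp (- M) * (exp M * \<bar>V k R\<bar>)"
    by (simp add: mult.assoc[symmetric] exp_add[symmetric])
  also have "\<dots> \<le> exp (- M) * ((\<Sum>n<Suc m. M ^ n / fact n * \<bar>V (k + n) 0\<bar>) + M ^ Suc m / fact (Suc m) * (K * exp M))"
    using le by (rule mult_left_mono) simp
  finally show ?thesis .
qed

text \<open>Writing \<delta>^(-j) as \<delta>^n * \<delta>^(-(j + n)) turns the Poisson mean M into
  \<delta> * M and the inner sum into a shifted piece of the weighted sum at time 0. The exponential
  series then gives exp(-M) * exp(\<delta> * M).\<close>

lemma weighted_decay:
  assumes \<delta>: "0 < \<delta>"
    and W: "\<And>J. (\<Sum>j<J. (1 / \<delta>) ^ j * \<bar>V (Suc j) 0\<bar>) \<le> W"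
  shows "(\<Sum>j<J. (1 / \<delta>) ^ j * \<bar>V (Suc j) R\<bar>) \<le> exp (- integral {0..R} (\<lambda>u. (1 - \<delta>) * mu u)) * W"
proof -
  define M where "M = integral {0..R} mu"
  define w where "w j = (1 / \<delta>) ^ j * \<bar>V (Suc j) 0\<bar>" for j
  \<comment> \<open>Collects the truncation errors. It depends on J but not on m, so for fixed J the
    error vanishes as m grows.\<close>
  define A where "A = (\<Sum>j<J. (1 / \<delta>) ^ j) * (K * exp M)"
  have M: "0 \<le> M"
    unfolding M_def using mu_nonneg by (intro integral_nonneg loc_integrableD(2)[OF mu_int]) auto
  have W0: "0 \<le> W" using W[of 0] by simp
  have shift: "(\<Sum>j<J. w (j + n)) \<le> W" for n
  proof -
    have "(\<Sum>j<J. w (j + n)) = sum w {0 + n..<J + n}"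
      by (simp only: sum.shift_bounds_nat_ivl atLeast0LessThan)
    also have "\<dots> \<le> sum w {..<J + n}"
      using \<delta> by (intro sum_mono2) (auto simp: w_def)
    finally show ?thesis using W[of "J + n"] by (simp add: w_def)
  qed
  have bound: "(\<Sum>j<J. (1 / \<delta>) ^ j * \<bar>V (Suc j) R\<bar>) \<le> exp (- M) * (exp (\<delta> * M) * W + M ^ Suc m / fact (Suc m) * A)" for m
  proof -
    have "(\<Sum>j<J. (1 / \<delta>) ^ j * \<bar>V (Suc j) R\<bar>) \<le>
      (\<Sum>j<J. (1 / \<delta>) ^ j * (exp (- M) * ((\<Sum>n<Suc m. M ^ n / fact n * \<bar>V (Suc j + n) 0\<bar>) + M ^ Suc m / fact (Suc m) * (K * exp M))))"
      unfolding M_def by (intro sum_mono mult_left_mono poisson_comparison) (use \<delta> in auto)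
    also have "\<dots> = (\<Sum>j<J. exp (- M) * ((\<Sum>n<Suc m. (\<delta> * M) ^ n / fact n * w (j + n)) + (1 / \<delta>) ^ j * (M ^ Suc m / fact (Suc m) * (K * exp M))))"
    proof (rule sum.cong[OF refl])
      fix j
      have "(1 / \<delta>) ^ j * (\<Sum>n<Suc m. M ^ n / fact n * \<bar>V (Suc j + n) 0\<bar>) = (\<Sum>n<Suc m. (\<delta> * M) ^ n / fact n * w (j + n))"
        unfolding sum_distrib_left
        by (rule sum.cong[OF refl]) (use \<delta> in \<open>simp add: w_def power_add power_mult_distrib power_divide field_simps\<close>)
      then show "(1 / \<delta>) ^ j * (exp (- M) * ((\<Sum>n<Suc m. M ^ n / fact n * \<bar>V (Suc j + n) 0\<bar>) + M ^ Suc m / fact (Suc m) * (K * exp M)))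
        = exp (- M) * ((\<Sum>n<Suc m. (\<delta> * M) ^ n / fact n * w (j + n)) + (1 / \<delta>) ^ j * (M ^ Suc m / fact (Suc m) * (K * exp M)))"
        by (simp only: distrib_left mult.left_commute)
    qed
    also have "\<dots> = exp (- M) * ((\<Sum>j<J. \<Sum>n<Suc m. (\<delta> * M) ^ n / fact n * w (j + n)) + M ^ Suc m / fact (Suc m) * A)"
      by (simp only: A_def sum_distrib_left[symmetric] sum_distrib_right[symmetric] sum.distrib mult.left_commute)
    also have "(\<Sum>j<J. \<Sum>n<Suc m. (\<delta> * M) ^ n / fact n * w (j + n)) = (\<Sum>n<Suc m. (\<delta> * M) ^ n / fact n * (\<Sum>j<J. w (j + n)))"
      by (subst sum.swap) (simp only: sum_distrib_left)
    also have "\<dots> \<le> (\<Sum>n<Suc m. (\<delta> * M) ^ n / fact n * W)"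
      using \<delta> M by (intro sum_mono mult_left_mono shift) auto
    also have "\<dots> = (\<Sum>n<Suc m. (\<delta> * M) ^ n / fact n) * W"
      by (simp only: sum_distrib_right)
    also have "\<dots> \<le> exp (\<delta> * M) * W"
      using sum_le_suminf[OF summable_exp[of "\<delta> * M"], of "{..<Suc m}"] \<delta> M
      by (intro mult_right_mono W0) (simp add: exp_def divide_inverse mult.commute del: sum.lessThan_Suc)
    finally show ?thesis by simp
  qed
  have "(\<lambda>m. M ^ m / fact m) \<longlonglongrightarrow> 0"
    using summable_LIMSEQ_zero[OF summable_exp[of M]] by (simp add: divide_inverse mult.commute)
  then have "(\<lambda>m. M ^ Suc m / fact (Suc m)) \<longlonglongrightarrow> 0"
    by (rule LIMSEQ_Suc)
  then have "(\<lambda>m. exp (- M) * (exp (\<delta> * M) * W + M ^ Suc m / fact (Suc m) * A))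
      \<longlonglongrightarrow> exp (- M) * (exp (\<delta> * M) * W + 0 * A)"
    by (intro tendsto_intros)
  then have "(\<Sum>j<J. (1 / \<delta>) ^ j * \<bar>V (Suc j) R\<bar>) \<le> exp (- M) * (exp (\<delta> * M) * W + 0 * A)"
    by (rule LIMSEQ_le_const) (use bound in blast)
  also have "\<dots> = exp (- integral {0..R} (\<lambda>u. (1 - \<delta>) * mu u)) * W"
  proof -
    have "integral {0..R} (\<lambda>u. (1 - \<delta>) * mu u) = (1 - \<delta>) * M"
      unfolding M_def by (rule integral_mult_right)
    then have "exp (- integral {0..R} (\<lambda>u. (1 - \<delta>) * mu u)) = exp (- M) * exp (\<delta> * M)"
      by (simp add: mult_exp_exp algebra_simps)
    then show ?thesis by simp
  qed
  finally show ?thesis .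
qed

end

section \<open>Coordinates of solutions of the forward system\<close>

text \<open>Used for two kinds of functional that are 1-Lipschitz in the norm: single coordinates
  and the norm itself.\<close>

lemma ac_on_of_l1:
  assumes p: "l1_loc_abs_cont p"
    and le: "\<And>u v. \<lbrakk>0 \<le> u; u < v; v \<le> R\<rbrakk> \<Longrightarrow> ennreal \<bar>\<phi> v - \<phi> u\<bar> \<le> l1_norm (\<lambda>i. p v i - p u i)"
    and R: "0 < R"
  shows "ac_on R \<phi>"
  unfolding ac_on_def
proof (intro allI impI)
  fix \<epsilon> :: real assume "0 < \<epsilon>"
  have "\<exists>\<eta>>0. \<forall>I :: (real \<times> real) set.
       finite I \<longrightarrow> (\<forall>(u, v)\<in>I. 0 \<le> u \<and> u < v \<and> v \<le> R) \<longrightarrow>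
       disjoint_family_on (\<lambda>(u, v). {u<..<v}) I \<longrightarrow>
       (\<Sum>(u, v)\<in>I. v - u) < \<eta> \<longrightarrow>
       (\<Sum>(u, v)\<in>I. l1_norm (\<lambda>i. p v i - p u i)) < ennreal \<epsilon>"
    by (rule p[unfolded l1_loc_abs_cont_def, THEN spec, THEN mp, OF R, THEN spec, THEN mp, OF \<open>0 < \<epsilon>\<close>])
  then obtain \<eta> where \<eta>: "\<eta> > 0" "\<forall>I :: (real \<times> real) set.
       finite I \<longrightarrow> (\<forall>(u, v)\<in>I. 0 \<le> u \<and> u < v \<and> v \<le> R) \<longrightarrow>
       disjoint_family_on (\<lambda>(u, v). {u<..<v}) I \<longrightarrow>
       (\<Sum>(u, v)\<in>I. v - u) < \<eta> \<longrightarrow>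
       (\<Sum>(u, v)\<in>I. l1_norm (\<lambda>i. p v i - p u i)) < ennreal \<epsilon>"
    by (elim exE conjE) (rule that)
  show "\<exists>\<eta>>0. \<forall>I :: (real \<times> real) set.
       finite I \<longrightarrow> (\<forall>(u, v)\<in>I. 0 \<le> u \<and> u < v \<and> v \<le> R) \<longrightarrow>
       disjoint_family_on (\<lambda>(u, v). {u<..<v}) I \<longrightarrow>
       (\<Sum>(u, v)\<in>I. v - u) < \<eta> \<longrightarrow>
       (\<Sum>(u, v)\<in>I. \<bar>\<phi> v - \<phi> u\<bar>) < \<epsilon>"
  proof (intro exI[of _ \<eta>] conjI allI impI)
    fix I :: "(real \<times> real) set"
    assume I: "finite I" "\<forall>(u, v)\<in>I. 0 \<le> u \<and> u < v \<and> v \<le> R"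
      "disjoint_family_on (\<lambda>(u, v). {u<..<v}) I" "(\<Sum>(u, v)\<in>I. v - u) < \<eta>"
    have "ennreal (\<Sum>(u, v)\<in>I. \<bar>\<phi> v - \<phi> u\<bar>) = (\<Sum>(u, v)\<in>I. ennreal \<bar>\<phi> v - \<phi> u\<bar>)"
      by (subst sum_ennreal[symmetric]) (auto simp: case_prod_unfold)
    also have "\<dots> \<le> (\<Sum>(u, v)\<in>I. l1_norm (\<lambda>i. p v i - p u i))"
    proof (rule sum_mono, clarify)
      fix u v assume "(u, v) \<in> I"
      with I(2) have "0 \<le> u" "u < v" "v \<le> R" by blast+
      then show "ennreal \<bar>\<phi> v - \<phi> u\<bar> \<le> l1_norm (\<lambda>i. p v i - p u i)" by (rule le)
    qed
    also have "\<dots> < ennreal \<epsilon>"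
      by (rule \<eta>(2)[THEN spec, THEN mp, OF I(1), THEN mp, OF I(2), THEN mp, OF I(3), THEN mp, OF I(4)])
    finally show "(\<Sum>(u, v)\<in>I. \<bar>\<phi> v - \<phi> u\<bar>) < \<epsilon>"
    proof (subst (asm) ennreal_less_iff)
      show "0 \<le> (\<Sum>(u, v)\<in>I. \<bar>\<phi> v - \<phi> u\<bar>)"
        by (rule sum_nonneg) (simp add: case_prod_unfold)
    qed
  qed (fact \<eta>)
qed

lemma component_le_l1_norm: "ennreal \<bar>x i\<bar> \<le> l1_norm x"
proof -
  have "(\<Sum>n\<in>{i}. ennreal \<bar>x n\<bar>) \<le> l1_norm x"
    unfolding l1_norm_def by (rule sum_le_suminf[OF summableI]) (simp_all only: finite.intros zero_le)
  then show ?thesis by (simp only: sum.insert sum.empty finite.emptyI empty_iff add_0_right not_False_eq_True)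
qed

lemma l1_norm_triangle: "l1_norm x \<le> l1_norm y + l1_norm (\<lambda>i. x i - y i)"
proof -
  have "l1_norm x \<le> (\<Sum>n. ennreal \<bar>y n\<bar> + ennreal \<bar>x n - y n\<bar>)"
    unfolding l1_norm_def
  proof (rule suminf_le)
    show "ennreal \<bar>x n\<bar> \<le> ennreal \<bar>y n\<bar> + ennreal \<bar>x n - y n\<bar>" for n
      unfolding ennreal_plus[OF abs_ge_zero abs_ge_zero, symmetric] by (rule ennreal_leI) linarith
  qed (rule summableI)+
  also have "\<dots> = l1_norm y + l1_norm (\<lambda>i. x i - y i)"
    unfolding l1_norm_def by (rule suminf_add[symmetric]) (rule summableI)+
  finally show ?thesis .
qed

lemma l1_norm_minus_commute: "l1_norm (\<lambda>i. x i - y i) = l1_norm (\<lambda>i. y i - x i)"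
  unfolding l1_norm_def by (subst abs_minus_commute) (rule refl)

lemma sum_abs_le_l1_norm:
  assumes "l1_norm x < \<infinity>"
  shows "(\<Sum>i<N. \<bar>x i\<bar>) \<le> enn2real (l1_norm x)"
proof -
  have "ennreal (\<Sum>i<N. \<bar>x i\<bar>) = (\<Sum>i<N. ennreal \<bar>x i\<bar>)"
    by (rule sum_ennreal[symmetric]) simp
  also have "\<dots> \<le> l1_norm x"
    unfolding l1_norm_def by (rule sum_le_suminf) (simp_all only: summableI finite_lessThan zero_le)
  also have "\<dots> = ennreal (enn2real (l1_norm x))"
    using assms by simp
  finally show ?thesis
    by (simp add: ennreal_le_iff)
qed

lemma forward_solutionD:
  assumes "forward_solution lam mu b p"
  shows "0 \<le> t \<Longrightarrow> l1_norm (p t) < \<infinity>" "0 \<le> t \<Longrightarrow> i \<notin> states b \<Longrightarrow> p t i = 0" "l1_loc_abs_cont p"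
    "AE t in lebesgue. 0 < t \<longrightarrow>
       ((\<lambda>h. l1_norm (\<lambda>i. (p (t + h) i - p t i) / h - mat_vec (states b) (A_mat lam mu b t) (p t) i))
          \<longlongrightarrow> 0) (at 0)"
proof -
  note p = assms[unfolded forward_solution_def]
  show "l1_norm (p t) < \<infinity>" if "0 \<le> t"
    by (rule p[THEN conjunct1, rule_format, OF that, THEN conjunct1])
  show "p t i = 0" if "0 \<le> t" "i \<notin> states b"
    by (rule p[THEN conjunct1, rule_format, OF that(1), THEN conjunct2, rule_format, OF that(2)])
  show "l1_loc_abs_cont p"
    by (rule p[THEN conjunct2, THEN conjunct1])
  show "AE t in lebesgue. 0 < t \<longrightarrow>
       ((\<lambda>h. l1_norm (\<lambda>i. (p (t + h) i - p t i) / h - mat_vec (states b) (A_mat lam mu b t) (p t) i))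
          \<longlongrightarrow> 0) (at 0)"
    by (rule p[THEN conjunct2, THEN conjunct2])
qed

lemma forward_solution_component_ac:
  assumes "forward_solution lam mu b p" "0 < R"
  shows "ac_on R (\<lambda>t. p t i)"
proof -
  have le: "ennreal \<bar>p v i - p u i\<bar> \<le> l1_norm (\<lambda>i. p v i - p u i)" for u v
    using component_le_l1_norm[of "\<lambda>i. p v i - p u i" i] .
  show ?thesis
    using ac_on_of_l1[where p = p and \<phi> = "\<lambda>t. p t i", OF forward_solutionD(3)[OF assms(1)] le assms(2)] .
qed

text \<open>By the reverse triangle inequality the norm along a solution is absolutely continuous,
  hence bounded on compact intervals. This is the crude bound behind the Poisson truncation.\<close>

lemma forward_solution_bounded:
  assumes p: "forward_solution lam mu b p" and R: "0 < R"
  obtains K where "\<And>t k. \<lbrakk>0 \<le> t; t \<le> R\<rbrakk> \<Longrightarrow> (\<Sum>i<k. \<bar>p t i\<bar>) \<le> K"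
proof -
  have fin: "l1_norm (p t) < \<infinity>" if "0 \<le> t" for t
    by (rule forward_solutionD(1)[OF p that])
  define \<nu> where "\<nu> t = enn2real (l1_norm (p t))" for t
  have \<nu>: "l1_norm (p t) = ennreal (\<nu> t)" if "0 \<le> t" for t
    using fin[OF that] unfolding \<nu>_def by (simp only: infinity_ennreal_def ennreal_enn2real)
  have le: "\<nu> v \<le> \<nu> u + r" if "0 \<le> u" "0 \<le> v" "l1_norm (\<lambda>i. p v i - p u i) = ennreal r" "0 \<le> r" for u v r
  proof -
    have "ennreal (\<nu> v) \<le> ennreal (\<nu> u) + ennreal r"
      using l1_norm_triangle[of "p v" "p u"] unfolding \<nu>[OF that(1)] \<nu>[OF that(2)] that(3) .
    also have "\<dots> = ennreal (\<nu> u + r)"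
      by (rule ennreal_plus[symmetric]) (simp_all add: \<nu>_def that)
    finally show ?thesis
      by (subst (asm) ennreal_le_iff) (simp_all add: \<nu>_def that)
  qed
  have le2: "ennreal \<bar>\<nu> v - \<nu> u\<bar> \<le> l1_norm (\<lambda>i. p v i - p u i)" if "0 \<le> u" "u < v" for u v
  proof (cases "l1_norm (\<lambda>i. p v i - p u i)")
    case (real r)
    have "\<nu> v \<le> \<nu> u + r" "\<nu> u \<le> \<nu> v + r"
      using le[of u v r] le[of v u r] real that by (simp_all add: l1_norm_minus_commute[of "p u"])
    then have "\<bar>\<nu> v - \<nu> u\<bar> \<le> r" by linarith
    then show ?thesis unfolding real by (rule ennreal_leI)
  next
    case top
    then show ?thesis by (simp only: top_greatest)
  qed
  have "ac_on R \<nu>"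
    using ac_on_of_l1[where p = p and \<phi> = \<nu>, OF forward_solutionD(3)[OF p] le2 R] .
  then obtain K where K: "\<And>t. t \<in> {0..R} \<Longrightarrow> \<bar>\<nu> t\<bar> \<le> K"
    by (rule ac_on_bounded) (rule that)
  show ?thesis
  proof (rule that)
    fix t k assume t: "0 \<le> t" "t \<le> R"
    show "(\<Sum>i<k. \<bar>p t i\<bar>) \<le> K"
      using sum_abs_le_l1_norm[OF fin[OF t(1)], of k] K[of t] t by (simp add: \<nu>_def)
  qed
qed

text \<open>Convergence in norm dominates every coordinate, so a single null set serves all
  i.\<close>

lemma forward_solution_derivative:
  assumes p: "forward_solution lam mu b p" and b0: "pmf b 0 = 0"
  obtains N where "negligible N"
    "\<And>t i. \<lbrakk>0 < t; t \<notin> N\<rbrakk> \<Longrightarrow> ((\<lambda>t. p t i) has_real_derivative forward_rhs lam mu b t (p t) i) (at t)"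
proof -
  have "AE t in lebesgue. 0 < t \<longrightarrow>
       ((\<lambda>h. l1_norm (\<lambda>i. (p (t + h) i - p t i) / h - mat_vec (states b) (A_mat lam mu b t) (p t) i))
          \<longlongrightarrow> 0) (at 0)"
    by (rule forward_solutionD(4)[OF p])
  then obtain N where N: "N \<in> null_sets lebesgue" "\<And>t. \<lbrakk>t \<notin> N; 0 < t\<rbrakk> \<Longrightarrow>
       ((\<lambda>h. l1_norm (\<lambda>i. (p (t + h) i - p t i) / h - mat_vec (states b) (A_mat lam mu b t) (p t) i))
          \<longlongrightarrow> 0) (at 0)"
    unfolding eventually_ae_filter by auto
  show ?thesis
  proof (rule that[of N])
    show "negligible N" using N(1) by (simp add: negligible_iff_null_sets)
    fix t i assume t: "0 < t" "t \<notin> N"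
    have mv: "mat_vec (states b) (A_mat lam mu b t) (p t) i = forward_rhs lam mu b t (p t) i" for i
      using forward_solutionD(2)[OF p] t by (intro mat_vec_eq_forward_rhs b0) auto
    show "((\<lambda>t. p t i) has_real_derivative forward_rhs lam mu b t (p t) i) (at t)"
      unfolding DERIV_def tendsto_iff
    proof (intro allI impI)
      fix e :: real assume "0 < e"
      then have "\<forall>\<^sub>F h in at 0. l1_norm (\<lambda>i. (p (t + h) i - p t i) / h - forward_rhs lam mu b t (p t) i) < ennreal e"
        using N(2)[OF t(2,1)] by (intro order_tendstoD(2)[of _ 0]) (auto simp: mv)
      then show "\<forall>\<^sub>F h in at 0. dist ((p (t + h) i - p t i) / h) (forward_rhs lam mu b t (p t) i) < e"
      proof eventually_elim
        case (elim h)
        have "ennreal \<bar>(p (t + h) i - p t i) / h - forward_rhs lam mu b t (p t) i\<bar> < ennreal e"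
          using component_le_l1_norm elim by (rule order.strict_trans1)
        then show ?case by (simp add: dist_real_def ennreal_less_iff)
      qed
    qed
  qed
qed

text \<open>Induction on k with b_k = B_k - B_(k+1): the term B_k times the partial sum cancels, the
  service terms telescope, and only the inflow into state k - 1 and the loss at rate lam * B_k
  remain. It starts at k = 1 because state 0 has no service loss.\<close>

lemma sum_forward_rhs:
  assumes "1 \<le> k"
  shows "(\<Sum>i<k. forward_rhs lam mu b t y i) = mu t * y k - lam t * batch_tail b k * (\<Sum>i<k. y i)"
  using assms
proof (induction k rule: dec_induct)
  case base
  show ?case by (simp add: forward_rhs_def)
next
  case (step k)
  have "k \<noteq> 0" using step.hyps by simp
  have pmf: "pmf b k = batch_tail b k - batch_tail b (Suc k)"
    using batch_tail_rec[of b k] by (simp only: add_diff_cancel_right')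
  have "(\<Sum>i<Suc k. forward_rhs lam mu b t y i)
    = (mu t * y k - lam t * batch_tail b k * (\<Sum>i<k. y i)) + forward_rhs lam mu b t y k"
    by (simp only: sum.lessThan_Suc step.IH)
  also have "forward_rhs lam mu b t y k =
      lam t * ((batch_tail b k - batch_tail b (Suc k)) * (\<Sum>i<k. y i) - batch_tail b (Suc k) * y k) + mu t * (y (Suc k) - y k)"
    by (simp only: forward_rhs_def pmf \<open>k \<noteq> 0\<close> if_False)
  finally show ?case
    by (simp only: sum.lessThan_Suc) (simp only: algebra_simps)
qed

context batch_queue
begin

lemma solution_decay:
  assumes p1: "forward_solution lam mu b p1" and p2: "forward_solution lam mu b p2"
    and t: "0 \<le> t" and \<delta>: "0 < \<delta>"
    and W: "\<And>J. (\<Sum>j<J. (1 / \<delta>) ^ j * \<bar>\<Sum>i<Suc j. p1 0 i - p2 0 i\<bar>) \<le> W"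
  shows "(\<Sum>j<J. (1 / \<delta>) ^ j * \<bar>\<Sum>i<Suc j. p1 t i - p2 t i\<bar>) \<le> exp (- integral {0..t} (\<lambda>u. (1 - \<delta>) * mu u)) * W"
\<comment> \<open>The regularity lemmas for solutions are stated for intervals of positive
  length.\<close>
proof (cases "t = 0")
  case True
  have "exp (- integral {0..t} (\<lambda>u. (1 - \<delta>) * mu u)) = 1"
    unfolding True by simp
  then show ?thesis using W[of J] by (simp only: True mult_1_left)
next
  case False
  then have t: "0 < t" using t by simp
  define V where "V k s = (\<Sum>i<k. p1 s i - p2 s i)" for k s
  obtain K1 where K1: "\<And>s k. \<lbrakk>0 \<le> s; s \<le> t\<rbrakk> \<Longrightarrow> (\<Sum>i<k. \<bar>p1 s i\<bar>) \<le> K1"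
    by (rule forward_solution_bounded[OF p1 t]) (rule that)
  obtain K2 where K2: "\<And>s k. \<lbrakk>0 \<le> s; s \<le> t\<rbrakk> \<Longrightarrow> (\<Sum>i<k. \<bar>p2 s i\<bar>) \<le> K2"
    by (rule forward_solution_bounded[OF p2 t]) (rule that)
  obtain N1 where N1: "negligible N1"
    "\<And>t i. \<lbrakk>0 < t; t \<notin> N1\<rbrakk> \<Longrightarrow> ((\<lambda>t. p1 t i) has_real_derivative rhs t (p1 t) i) (at t)"
    by (rule forward_solution_derivative[OF p1 b_pos]) (rule that)
  obtain N2 where N2: "negligible N2"
    "\<And>t i. \<lbrakk>0 < t; t \<notin> N2\<rbrakk> \<Longrightarrow> ((\<lambda>t. p2 t i) has_real_derivative rhs t (p2 t) i) (at t)"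
    by (rule forward_solution_derivative[OF p2 b_pos]) (rule that)
  have "(\<Sum>j<J. (1 / \<delta>) ^ j * \<bar>V (Suc j) t\<bar>) \<le> exp (- integral {0..t} (\<lambda>u. (1 - \<delta>) * mu u)) * W"
  \<comment> \<open>The killing rate at level k is lam * B_k; the modulus, harmless for nonnegative
    times, makes its sign immediate.\<close>
  proof (rule weighted_decay[where N = "N1 \<union> N2" and K = "K1 + K2" and a = "\<lambda>k s. \<bar>lam s * batch_tail b k\<bar>"])
    show "ac_on t (V k)" for k
      unfolding V_def by (intro ac_on_sum ac_on_diff forward_solution_component_ac[OF p1 t] forward_solution_component_ac[OF p2 t])
    show "\<bar>V k s\<bar> \<le> K1 + K2" if "0 \<le> s" "s \<le> t" for k s
    proof -
      have "\<bar>V k s\<bar> \<le> (\<Sum>i<k. \<bar>p1 s i\<bar> + \<bar>p2 s i\<bar>)"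
        unfolding V_def by (intro order_trans[OF sum_abs] sum_mono) auto
      then show ?thesis using K1[OF that, of k] K2[OF that, of k] by (simp add: sum.distrib)
    qed
    show "(V k has_real_derivative mu s * (V (Suc k) s - V k s) - \<bar>lam s * batch_tail b k\<bar> * V k s) (at s)"
      if "1 \<le> k" "0 < s" "s < t" "s \<notin> N1 \<union> N2" for k s
    proof -
      have "(V k has_real_derivative (\<Sum>i<k. rhs s (p1 s) i - rhs s (p2 s) i)) (at s)"
        unfolding V_def by (intro DERIV_sum DERIV_diff N1(2) N2(2)) (use that in simp_all)
      also have "(\<Sum>i<k. rhs s (p1 s) i - rhs s (p2 s) i) = mu s * (p1 s k - p2 s k) - lam s * batch_tail b k * V k s"
        by (simp only: forward_rhs_diff sum_forward_rhs[OF that(1)] V_def)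
      also have "\<dots> = mu s * (V (Suc k) s - V k s) - \<bar>lam s * batch_tail b k\<bar> * V k s"
        using lam_nonneg[of s] batch_tail_nonneg[of b k] that by (simp add: V_def)
      finally show ?thesis .
    qed
    show "negligible (N1 \<union> N2)" using N1(1) N2(1) by (rule negligible_Un)
    show "(\<Sum>j<J. (1 / \<delta>) ^ j * \<bar>V (Suc j) 0\<bar>) \<le> W" for J
      unfolding V_def by (rule W)
    show "0 \<le> t" using t by simp
  qed (simp_all add: mu_nonneg mu_int \<delta>)
  then show ?thesis by (simp only: V_def)
qed

end

section \<open>Weighted norms\<close>

lemma prob_vec_has_sum: "prob_vec x \<Longrightarrow> (x has_sum 1) UNIV"
  unfolding prob_vec_def by (auto intro: sums_nonneg_imp_has_sum)

lemma prob_vec_unit_mass: "prob_vec (unit_mass k)"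
  using sums_single[of k "\<lambda>_. 1 :: real"] by (simp add: prob_vec_def unit_mass_def[abs_def])

lemma infsum_tail:
  fixes x :: "nat \<Rightarrow> real"
  assumes "(x has_sum 0) UNIV"
  shows "infsum x {k..} = - (\<Sum>i<k. x i)"
proof -
  have sm: "x summable_on A" for A
    by (rule summable_on_subset_banach[of x UNIV]) (use assms in \<open>auto simp: summable_on_def\<close>)
  have "infsum x ({..<k} \<union> {k..}) = infsum x {..<k} + infsum x {k..}"
    by (rule infsum_Un_disjoint) (auto intro: sm)
  moreover have "{..<k} \<union> {k..} = UNIV" by auto
  moreover have "infsum x UNIV = 0" using assms by (rule infsumI)
  ultimately show ?thesis by simp
qed

text \<open>Link between the stated norm and the partial sums: \<open>T\<close> forms tails, and
  zero total mass makes each tail minus the complementary partial sum.\<close>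

lemma w_vec_eq:
  assumes x: "(x has_sum 0) UNIV" and z: "\<And>i. i \<notin> states b \<Longrightarrow> x i = 0"
  shows "\<bar>w_vec b \<delta> x k\<bar> = (if k = 0 then 0 else \<bar>d_weight \<delta> k\<bar> * \<bar>\<Sum>i<k. x i\<bar>)"
proof -
  define S where "S = states b - {0}"
  have T: "mat_vec S T_mat x i = (if i \<in> S then - (\<Sum>j<i. x j) else 0)" for i
  proof (cases "i \<in> S")
    case True
    have "(\<Sum>\<^sub>\<infinity>j\<in>S. T_mat i j * x j) = infsum x {i..}"
      by (rule infsum_cong_neutral) (use True z in \<open>auto simp: T_mat_def S_def\<close>)
    then show ?thesis using True by (simp add: mat_vec_def infsum_tail[OF x])
  qed (simp add: mat_vec_def)
  have D: "mat_vec S (D_mat \<delta>) y i = (if i \<in> S then d_weight \<delta> i * y i else 0)" for y i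
  proof (cases "i \<in> S")
    case True
    have "(\<Sum>\<^sub>\<infinity>j\<in>S. D_mat \<delta> i j * y j) = (\<Sum>\<^sub>\<infinity>j\<in>{i}. D_mat \<delta> i j * y j)"
      by (rule infsum_cong_neutral) (use True in \<open>auto simp: D_mat_def\<close>)
    then show ?thesis using True by (simp add: mat_vec_def D_mat_def)
  qed (simp add: mat_vec_def)
  have w: "w_vec b \<delta> x k = (if k \<in> S then - (d_weight \<delta> k * (\<Sum>j<k. x j)) else 0)"
    by (simp add: w_vec_def D T flip: S_def)
  \<comment> \<open>Beyond the last state the partial sum is the total mass 0, so the truncation to
    the state space leaves no trace in the formula.\<close>
  have "(\<Sum>i<k. x i) = 0" if k: "k \<notin> states b"
  proof -
    have nz: "j \<notin> states b" if "k \<le> j" for j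
      using that by (induction rule: dec_induct) (simp_all add: k Suc_not_states)
    have "infsum x {k..} = 0"
      by (rule infsum_0) (use z nz in auto)
    then show ?thesis by (simp add: infsum_tail[OF x])
  qed
  then show ?thesis
    by (auto simp: w S_def abs_mult)
qed

lemma d_weight_Suc [simp]: "d_weight \<delta> (Suc j) = (1 / \<delta>) ^ j"
  by (simp add: d_weight_def)

lemma d_weight_pos: "0 < \<delta> \<Longrightarrow> 0 < d_weight \<delta> k"
  by (simp add: d_weight_def)

lemma d_weight_mono: "0 < \<delta> \<Longrightarrow> \<delta> < 1 \<Longrightarrow> d_weight \<delta> k \<le> d_weight \<delta> (Suc k)"
  unfolding d_weight_def by (intro power_increasing) auto

lemma d_weight_ge_1: "0 < \<delta> \<Longrightarrow> \<delta> < 1 \<Longrightarrow> 1 \<le> d_weight \<delta> k"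
  unfolding d_weight_def by (intro one_le_power) auto

section \<open>From weighted partial sums back to the norm and the first moment\<close>

context
  fixes x :: "nat \<Rightarrow> real" and \<delta> c :: real
  assumes \<delta>: "0 < \<delta>" "\<delta> < 1"
    and c: "\<And>J. (\<Sum>j<J. (1 / \<delta>) ^ j * \<bar>\<Sum>i<Suc j. x i\<bar>) \<le> c"
begin

text \<open>Origin of the factor 2: both pieces are sums of the same sequence up to a shift, and the
  term of index 0 vanishes because its partial sum is empty.\<close>

lemma sum_two_weights_le:
  "(\<Sum>i<N. d_weight \<delta> (Suc i) * \<bar>\<Sum>j<Suc i. x j\<bar> + d_weight \<delta> i * \<bar>\<Sum>j<i. x j\<bar>) \<le> 2 * c"
proof -
  define D where "D i = d_weight \<delta> i * \<bar>\<Sum>j<i. x j\<bar>" for i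
  have 1: "(\<Sum>i<N. D (Suc i)) \<le> c"
    using c[of N] by (simp only: D_def d_weight_Suc)
  have "(\<Sum>i<N. D i) \<le> (\<Sum>i<Suc N. D i)"
    using d_weight_pos[OF \<delta>(1), of N] by (simp add: D_def)
  also have "\<dots> = (\<Sum>i<N. D (Suc i))"
    unfolding sum.lessThan_Suc_shift by (simp add: D_def)
  finally have "(\<Sum>i<N. D (Suc i) + D i) \<le> 2 * c"
    using 1 by (simp only: sum.distrib)
  then show ?thesis by (simp only: D_def)
qed

lemma abs_component_le: "\<bar>x i\<bar> \<le> \<bar>\<Sum>j<Suc i. x j\<bar> + \<bar>\<Sum>j<i. x j\<bar>"
  unfolding sum.lessThan_Suc by linarith

lemma sum_abs_le: "(\<Sum>i<N. \<bar>x i\<bar>) \<le> 2 * c"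
proof -
  have "\<bar>x i\<bar> \<le> d_weight \<delta> (Suc i) * \<bar>\<Sum>j<Suc i. x j\<bar> + d_weight \<delta> i * \<bar>\<Sum>j<i. x j\<bar>" for i
  proof -
    have "1 * \<bar>\<Sum>j<i. x j\<bar> \<le> d_weight \<delta> i * \<bar>\<Sum>j<i. x j\<bar>" for i
      by (intro mult_right_mono d_weight_ge_1 \<delta>) simp
    from this[of i] this[of "Suc i"] show ?thesis
      using abs_component_le[of i] by linarith
  qed
  then show ?thesis
    by (intro order_trans[OF sum_mono sum_two_weights_le])
qed

text \<open>The factor i is absorbed by the weight, since W * i \<le> d_i \<le> d_(i+1). This is
  asked only where \<open>x\<close> is nonzero, which suits a constant defined as an infimum over
  the states alone.\<close>

lemma sum_moment_le:
  assumes W: "0 < W" "\<And>i. 0 < i \<Longrightarrow> x i \<noteq> 0 \<Longrightarrow> W * real i \<le> d_weight \<delta> i"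
  shows "(\<Sum>i<N. \<bar>real i * x i\<bar>) \<le> 2 * c / W"
proof -
  have "W * \<bar>real i * x i\<bar> \<le> d_weight \<delta> (Suc i) * \<bar>\<Sum>j<Suc i. x j\<bar> + d_weight \<delta> i * \<bar>\<Sum>j<i. x j\<bar>" for i
  proof (cases "0 < i \<and> x i \<noteq> 0")
    case True
    have le: "W * real i \<le> d_weight \<delta> i" using W(2) True by blast
    have "W * \<bar>real i * x i\<bar> = (W * real i) * \<bar>x i\<bar>"
      by (simp add: abs_mult)
    also have "\<dots> \<le> d_weight \<delta> i * (\<bar>\<Sum>j<Suc i. x j\<bar> + \<bar>\<Sum>j<i. x j\<bar>)"
      using le abs_component_le d_weight_pos[OF \<delta>(1), of i] by (intro mult_mono) auto
    also have "\<dots> \<le> d_weight \<delta> (Suc i) * \<bar>\<Sum>j<Suc i. x j\<bar> + d_weight \<delta> i * \<bar>\<Sum>j<i. x j\<bar>"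
      unfolding distrib_left by (intro add_right_mono mult_right_mono d_weight_mono \<delta>) simp
    finally show ?thesis .
  next
    case False
    then have "W * \<bar>real i * x i\<bar> = 0" by auto
    also have "0 \<le> d_weight \<delta> (Suc i) * \<bar>\<Sum>j<Suc i. x j\<bar> + d_weight \<delta> i * \<bar>\<Sum>j<i. x j\<bar>"
      by (intro add_nonneg_nonneg mult_nonneg_nonneg less_imp_le[OF d_weight_pos] \<delta>) auto
    finally show ?thesis .
  qed
  then have "(\<Sum>i<N. W * \<bar>real i * x i\<bar>) \<le> 2 * c"
    by (intro order_trans[OF sum_mono sum_two_weights_le])
  then have "W * (\<Sum>i<N. \<bar>real i * x i\<bar>) \<le> 2 * c"
    by (simp only: sum_distrib_left)
  then show ?thesis
    using W(1) by (simp add: pos_le_divide_eq mult.commute)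
qed

end

section \<open>The constant W\<close>

lemma states_nonzero:
  assumes "pmf b 0 = 0"
  shows "states b - {0} \<noteq> {}"
proof -
  obtain n where n: "n \<in> set_pmf b" using set_pmf_not_empty[of b] by blast
  then have "n \<noteq> 0" using assms by (metis set_pmf_iff)
  moreover have "n \<in> states b" using n pmf_eq_0_not_states by (metis set_pmf_iff)
  ultimately show ?thesis by blast
qed

text \<open>Bernoulli's inequality: \<delta>^(-j) \<ge> 1 + j * (1/\<delta> - 1) \<ge> r * (j + 1),
  where \<open>r\<close> is the smaller of the two coefficients.\<close>

lemma W_const_pos:
  assumes b: "pmf b 0 = 0" and \<delta>: "0 < \<delta>" "\<delta> < 1"
  shows "0 < W_const b \<delta>"
proof -
  define r where "r = min 1 (1 / \<delta> - 1)"
  have r: "0 < r" using \<delta> by (simp add: r_def)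
  have "r \<le> W_const b \<delta>"
    unfolding W_const_def
  proof (rule cINF_greatest[OF states_nonzero[OF b]])
    fix k assume "k \<in> states b - {0}"
    then obtain j where k: "k = Suc j" by (cases k) auto
    have "1 + real j * (1 / \<delta> - 1) \<le> (1 + (1 / \<delta> - 1)) ^ j"
      using \<delta> by (intro Bernoulli_inequality) (simp add: field_simps)
    moreover have "r * real (Suc j) \<le> 1 + real j * (1 / \<delta> - 1)"
    proof -
      have "r * real j \<le> real j * (1 / \<delta> - 1)"
        by (subst mult.commute) (auto simp: r_def intro!: mult_left_mono)
      moreover have "r \<le> 1" by (simp add: r_def)
      ultimately show ?thesis by (simp add: algebra_simps)
    qed
    ultimately show "r \<le> d_weight \<delta> k / real k"
      unfolding k by (simp add: pos_le_divide_eq)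
  qed
  then show ?thesis using r by linarith
qed

lemma W_const_le:
  assumes "0 < \<delta>" "k \<in> states b" "0 < k"
  shows "W_const b \<delta> * real k \<le> d_weight \<delta> k"
proof -
  have "bdd_below ((\<lambda>k. d_weight \<delta> k / real k) ` (states b - {0}))"
    using d_weight_pos[OF assms(1)] by (intro bdd_belowI2[of _ 0]) (auto intro!: divide_nonneg_nonneg less_imp_le)
  then have "W_const b \<delta> \<le> d_weight \<delta> k / real k"
    unfolding W_const_def using assms by (intro cINF_lower) auto
  then show ?thesis using assms by (simp add: pos_le_divide_eq)
qed

section \<open>Summability from bounded partial sums, and divergence of the integral of the service
  rate\<close>

lemma bounded_sums_summable:
  fixes f :: "nat \<Rightarrow> real"
  assumes "\<And>N. (\<Sum>i<N. \<bar>f i\<bar>) \<le> c"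
  shows "f summable_on A" "\<bar>infsum f A\<bar> \<le> c"
proof -
  have fin: "(\<Sum>i\<in>F. \<bar>f i\<bar>) \<le> c" if F: "finite F" for F
  proof -
    obtain N where "F \<subseteq> {..<N}" using finite_nat_iff_bounded[of F] F by blast
    then have "(\<Sum>i\<in>F. \<bar>f i\<bar>) \<le> (\<Sum>i<N. \<bar>f i\<bar>)" by (intro sum_mono2) auto
    then show ?thesis using assms[of N] by linarith
  qed
  have abs: "(\<lambda>i. \<bar>f i\<bar>) summable_on A"
  proof (rule nonneg_bdd_above_summable_on)
    show "bdd_above (sum (\<lambda>i. \<bar>f i\<bar>) ` {F. F \<subseteq> A \<and> finite F})"
      by (rule bdd_aboveI2[where M = c]) (simp add: fin)
  qed simp
  then show sm: "f summable_on A"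
    by (rule abs_summable_summable[where f = f, unfolded real_norm_def])
  have "\<bar>infsum f A\<bar> \<le> (\<Sum>\<^sub>\<infinity>i\<in>A. \<bar>f i\<bar>)"
    using norm_infsum_bound[of f A] abs by (simp only: real_norm_def)
  also have "\<dots> \<le> c"
    by (rule infsum_le_finite_sums[OF abs]) (rule fin)
  finally show "\<bar>infsum f A\<bar> \<le> c" .
qed

text \<open>The integral is monotone in its upper limit; were it bounded along the integers,
  monotone convergence would make the Lebesgue integral over the half-line finite.\<close>

lemma filterlim_integral_at_top:
  assumes nn: "\<And>t. 0 \<le> t \<Longrightarrow> 0 \<le> f t" and f: "loc_integrable f"
    and inf: "(\<integral>\<^sup>+ t \<in> {0..}. ennreal (f t) \<partial>lebesgue) = \<infinity>"
  shows "filterlim (\<lambda>t. integral {0..t} f) at_top at_top"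
proof -
  have nni: "(\<integral>\<^sup>+ t \<in> {0..real n}. ennreal (f t) \<partial>lebesgue) = ennreal (integral {0..real n} f)" for n
  proof -
    have i: "f absolutely_integrable_on {0..real n}"
      using loc_integrableD(1)[OF f] by simp
    have "(\<integral>\<^sup>+ t \<in> {0..real n}. ennreal (f t) \<partial>lebesgue) = (\<integral>\<^sup>+ t. ennreal (indicator {0..real n} t *\<^sub>R f t) \<partial>lebesgue)"
      by (intro nn_integral_cong) (auto split: split_indicator)
    also have "\<dots> = ennreal (\<integral>t. indicator {0..real n} t *\<^sub>R f t \<partial>lebesgue)"
      using i nn by (intro nn_integral_eq_integral) (auto simp: set_integrable_def split: split_indicator)
    also have "(\<integral>t. indicator {0..real n} t *\<^sub>R f t \<partial>lebesgue) = integral {0..real n} f"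
      using set_lebesgue_integral_eq_integral(2)[OF i] by (simp add: set_lebesgue_integral_def)
    finally show ?thesis .
  qed
  have mono: "integral {0..s} f \<le> integral {0..t} f" if "s \<le> t" for s t
    using nn that by (intro integral_subset_le loc_integrableD(2)[OF f]) auto
  show ?thesis
    unfolding filterlim_at_top
  proof
    fix Z :: real
    have "\<exists>n. Z \<le> integral {0..real n} f"
    proof (rule ccontr)
      assume "\<not> ?thesis"
      then have Z: "integral {0..real n} f \<le> Z" for n by (meson linear)
      have "(\<integral>\<^sup>+ t \<in> {0..}. ennreal (f t) \<partial>lebesgue) = (\<integral>\<^sup>+ t. (SUP n. ennreal (f t) * indicator {0..real n} t) \<partial>lebesgue)"
      proof (intro nn_integral_cong)
        fix t :: real
        show "ennreal (f t) * indicator {0..} t = (SUP n. ennreal (f t) * indicator {0..real n} t)"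
        proof (rule antisym)
          obtain n where "t \<le> real n" using real_arch_simple by blast
          then have "ennreal (f t) * indicator {0..} t = ennreal (f t) * indicator {0..real n} t"
            by (auto split: split_indicator)
          also have "\<dots> \<le> (SUP n. ennreal (f t) * indicator {0..real n} t)"
            by (rule SUP_upper) simp
          finally show "ennreal (f t) * indicator {0..} t \<le> (SUP n. ennreal (f t) * indicator {0..real n} t)" .
        qed (auto intro!: SUP_least split: split_indicator)
      qed
      also have "\<dots> = (SUP n. \<integral>\<^sup>+ t \<in> {0..real n}. ennreal (f t) \<partial>lebesgue)"
      proof (rule nn_integral_monotone_convergence_SUP)
        show "incseq (\<lambda>n t. ennreal (f t) * indicator {0..real n} t)"
          by (auto simp: incseq_def le_fun_def split: split_indicator)
        show "(\<lambda>t. ennreal (f t) * indicator {0..real n} t) \<in> borel_measurable lebesgue" for n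
        proof -
          have "(\<lambda>t. indicator {0..real n} t *\<^sub>R f t) \<in> borel_measurable lebesgue"
            using loc_integrableD(1)[OF f, of 0 "real n"] by (auto simp: set_integrable_def)
          then have "(\<lambda>t. ennreal (indicator {0..real n} t *\<^sub>R f t)) \<in> borel_measurable lebesgue"
            by measurable
          also have "(\<lambda>t. ennreal (indicator {0..real n} t *\<^sub>R f t)) = (\<lambda>t. ennreal (f t) * indicator {0..real n} t)"
            by (auto split: split_indicator)
          finally show ?thesis .
        qed
      qed
      also have "\<dots> \<le> ennreal Z"
        unfolding nni by (intro SUP_least ennreal_leI Z)
      finally show False using inf by (simp add: top_unique)
    qed
    then obtain n where "Z \<le> integral {0..real n} f" by blast
    then show "\<forall>\<^sub>F t in at_top. Z \<le> integral {0..t} f"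
      using mono by (intro eventually_at_top_linorderI[of "real n"]) (meson order_trans)
  qed
qed

section \<open>Convergence of the means\<close>

lemma prob_vec_diff_has_sum:
  assumes "prob_vec x" "prob_vec y"
  shows "((\<lambda>i. x i - y i) has_sum 0) UNIV"
  using has_sum_add[OF prob_vec_has_sum[OF assms(1)] has_sum_cmult_right[OF prob_vec_has_sum[OF assms(2)], of "- 1"]]
  by simp

context batch_queue
begin

lemma decay_exp_at_top:
  assumes "filterlim (\<lambda>t. integral {0..t} mu) at_top at_top" "\<delta> < 1"
  shows "((\<lambda>t. exp (- integral {0..t} (\<lambda>u. (1 - \<delta>) * mu u))) \<longlongrightarrow> 0) at_top"
proof -
  have "filterlim (\<lambda>t. (1 - \<delta>) * integral {0..t} mu) at_top at_top"
    by (rule filterlim_tendsto_pos_mult_at_top[OF tendsto_const _ assms(1)]) (use assms(2) in simp)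
  then have "filterlim (\<lambda>t. - ((1 - \<delta>) * integral {0..t} mu)) at_bot at_top"
    by (simp only: filterlim_uminus_at_bot minus_minus)
  then have "((\<lambda>t. exp (- ((1 - \<delta>) * integral {0..t} mu))) \<longlongrightarrow> 0) at_top"
    by (rule filterlim_compose[OF exp_at_bot])
  then show ?thesis
    by (simp only: integral_mult_right)
qed

context
  fixes p1 p2 :: "real \<Rightarrow> nat \<Rightarrow> real" and \<delta> t :: real
  assumes p1: "forward_solution lam mu b p1" "prob_vec (p1 0)"
    and p2: "forward_solution lam mu b p2" "prob_vec (p2 0)"
    and \<delta>: "0 < \<delta>" "\<delta> < 1" and t: "0 \<le> t"
begin

abbreviation (input) "w0 \<equiv> w_vec b \<delta> (\<lambda>i. p1 0 i - p2 0 i)"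
abbreviation (input) "decay \<equiv> exp (- integral {0..t} (\<lambda>u. (1 - \<delta>) * mu u))"

lemma distribution_decay:
  assumes fin: "l1_norm w0 < \<infinity>"
  shows "(\<Sum>j<J. (1 / \<delta>) ^ j * \<bar>\<Sum>i<Suc j. p1 t i - p2 t i\<bar>) \<le> decay * enn2real (l1_norm w0)"
proof (rule solution_decay[OF p1(1) p2(1) t \<delta>(1)])
  fix J
  have hs: "((\<lambda>i. p1 0 i - p2 0 i) has_sum 0) UNIV"
    by (rule prob_vec_diff_has_sum[OF p1(2) p2(2)])
  have z: "p1 0 i - p2 0 i = 0" if "i \<notin> states b" for i
    using forward_solutionD(2)[OF p1(1) order_refl that] forward_solutionD(2)[OF p2(1) order_refl that] by simp
  have "\<bar>w0 (Suc j)\<bar> = (1 / \<delta>) ^ j * \<bar>\<Sum>i<Suc j. p1 0 i - p2 0 i\<bar>" for j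
    using \<delta>(1) by (subst w_vec_eq[OF hs]) (simp_all add: z del: sum.lessThan_Suc)
  then have "(\<Sum>j<J. (1 / \<delta>) ^ j * \<bar>\<Sum>i<Suc j. p1 0 i - p2 0 i\<bar>) = (\<Sum>j<J. \<bar>w0 (Suc j)\<bar>)"
    by (simp only:)
  also have "\<dots> \<le> (\<Sum>j<Suc J. \<bar>w0 j\<bar>)"
    unfolding sum.lessThan_Suc_shift by simp
  also have "\<dots> \<le> enn2real (l1_norm w0)"
    by (rule sum_abs_le_l1_norm[OF fin])
  finally show "(\<Sum>j<J. (1 / \<delta>) ^ j * \<bar>\<Sum>i<Suc j. p1 0 i - p2 0 i\<bar>) \<le> enn2real (l1_norm w0)" .
qed

lemma l1_norm_decay:
  "l1_norm (\<lambda>i. p1 t i - p2 t i) \<le> ennreal (4 * decay) * l1_norm w0"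
proof (cases "l1_norm w0 < \<infinity>")
  case True
  define r where "r = enn2real (l1_norm w0)"
  have r: "l1_norm w0 = ennreal r" "0 \<le> r"
    using True by (simp_all add: r_def)
  have "l1_norm (\<lambda>i. p1 t i - p2 t i) \<le> ennreal (2 * (decay * r))"
    unfolding r_def by (rule l1_norm_leI, rule sum_abs_le[OF \<delta> distribution_decay[OF True]])
  \<comment> \<open>The argument yields the constant 2, which is enlarged here to the stated
    4.\<close>
  also have "\<dots> \<le> ennreal (4 * decay * r)"
    using r(2) by (intro ennreal_leI) simp
  also have "\<dots> = ennreal (4 * decay) * l1_norm w0"
    unfolding r(1) by (rule ennreal_mult) (use r(2) in simp_all)
  finally show ?thesis .
next
  case False
  \<comment> \<open>The vacuous case: the exponential factor is positive, so the right-hand side is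
    infinite.\<close>
  then have "l1_norm w0 = \<top>" by (simp add: not_less top_unique)
  then show ?thesis by (simp add: ennreal_mult_top)
qed

text \<open>The difference of the means is treated as one series, so that it is summable without
  knowing that either mean is finite.\<close>

lemma mean_diff_decay:
  assumes fin: "l1_norm w0 < \<infinity>"
  shows "(\<lambda>n. real n * (p1 t n - p2 t n)) summable_on A"
    and "\<bar>infsum (\<lambda>n. real n * (p1 t n - p2 t n)) A\<bar> \<le> 2 * (decay * enn2real (l1_norm w0)) / W_const b \<delta>"
proof -
  have "(\<Sum>i<N. \<bar>real i * (p1 t i - p2 t i)\<bar>) \<le> 2 * (decay * enn2real (l1_norm w0)) / W_const b \<delta>" for N
  proof (rule sum_moment_le[OF \<delta> distribution_decay[OF fin] W_const_pos[OF b_pos \<delta>]])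
    fix i assume i: "0 < i" "p1 t i - p2 t i \<noteq> 0"
    then have "i \<in> states b"
      using forward_solutionD(2)[OF p1(1) t, of i] forward_solutionD(2)[OF p2(1) t, of i]
      by (cases "i \<in> states b") simp_all
    then show "W_const b \<delta> * real i \<le> d_weight \<delta> i"
      using i(1) by (rule W_const_le[OF \<delta>(1)])
  qed
  then show "(\<lambda>n. real n * (p1 t n - p2 t n)) summable_on A"
    and "\<bar>infsum (\<lambda>n. real n * (p1 t n - p2 t n)) A\<bar> \<le> 2 * (decay * enn2real (l1_norm w0)) / W_const b \<delta>"
    by (rule bounded_sums_summable)+
qed

end

lemma sum_weighted_unit_mass_le: "(\<Sum>i<N. (1 + real i) * \<bar>unit_mass k i\<bar>) \<le> 1 + real k"
proof -
  have "(\<Sum>i<N. (1 + real i) * \<bar>unit_mass k i\<bar>) = (\<Sum>i<N. if i = k then 1 + real k else 0)"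
    by (rule sum.cong) (auto simp: unit_mass_def)
  also have "\<dots> \<le> 1 + real k"
    by (simp add: sum.delta)
  finally show ?thesis .
qed

lemma unit_mass_not_states: "k \<in> states b \<Longrightarrow> i \<notin> states b \<Longrightarrow> unit_mass k i = 0"
  by (auto simp: unit_mass_def)

text \<open>Existence from a unit mass discharges the choice operator.\<close>

lemma chain_prob_solution:
  assumes "k \<in> states b"
  shows "forward_solution lam mu b (chain_prob lam mu b k)" "chain_prob lam mu b k 0 = unit_mass k"
proof -
  obtain p where "forward_solution lam mu b p" "p 0 = unit_mass k"
    by (rule forward_solution_exists[OF sum_weighted_unit_mass_le unit_mass_not_states[OF assms]])
  then have "\<exists>p. forward_solution lam mu b p \<and> p 0 = unit_mass k"
    by (intro exI conjI)
  from someI_ex[OF this]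
  show "forward_solution lam mu b (chain_prob lam mu b k)" "chain_prob lam mu b k 0 = unit_mass k"
    unfolding chain_prob_def by (rule conjunct1, rule conjunct2)
qed

lemma zero_in_states: "0 \<in> states b"
  by (simp add: states_def)

text \<open>Beyond index k both unit masses have partial sum 1, so the vector has finite support
  whatever the weights are. This is why the empty system serves as a common reference.\<close>

lemma l1_norm_w_unit_mass_finite:
  assumes k: "k \<in> states b"
  shows "l1_norm (w_vec b \<delta> (\<lambda>i. unit_mass k i - unit_mass 0 i)) < \<infinity>"
proof -
  define w where "w = w_vec b \<delta> (\<lambda>i. unit_mass k i - unit_mass 0 i)"
  have hs: "((\<lambda>i. unit_mass k i - unit_mass 0 i) has_sum 0) UNIV"
    by (rule prob_vec_diff_has_sum[OF prob_vec_unit_mass prob_vec_unit_mass])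
  have w0: "\<bar>w j\<bar> = 0" if "k < j" for j
  proof -
    have "(\<Sum>i<j. unit_mass m i) = 1" if "m < j" for m
      using that by (simp add: unit_mass_def sum.delta)
    then have "(\<Sum>i<j. unit_mass k i - unit_mass 0 i) = 0"
      using that by (simp add: sum_subtractf)
    moreover have "\<bar>w j\<bar> = (if j = 0 then 0 else \<bar>d_weight \<delta> j\<bar> * \<bar>\<Sum>i<j. unit_mass k i - unit_mass 0 i\<bar>)"
      unfolding w_def using unit_mass_not_states[OF k] unit_mass_not_states[OF zero_in_states]
      by (intro w_vec_eq[OF hs]) simp
    ultimately show ?thesis by simp
  qed
  have "(\<Sum>i<N. \<bar>w i\<bar>) \<le> (\<Sum>i\<le>k. \<bar>w i\<bar>)" for N
  proof -
    have "(\<Sum>i<N. \<bar>w i\<bar>) = (\<Sum>i\<in>{..<N} \<inter> {..k}. \<bar>w i\<bar>)"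
    proof (rule sum.mono_neutral_right)
      show "\<forall>i\<in>{..<N} - {..<N} \<inter> {..k}. \<bar>w i\<bar> = 0"
        by (intro ballI w0) auto
    qed auto
    also have "\<dots> \<le> (\<Sum>i\<le>k. \<bar>w i\<bar>)"
      by (intro sum_mono2) auto
    finally show ?thesis .
  qed
  then have "l1_norm w \<le> ennreal (\<Sum>i\<le>k. \<bar>w i\<bar>)"
    by (rule l1_norm_leI)
  also have "\<dots> < \<infinity>" by simp
  finally show ?thesis by (simp only: w_def)
qed

text \<open>Finiteness of the mean of the chain started in k is obtained here as well: it is the
  finite mean of the reference solution plus a summable difference.\<close>

lemma mean_convergence:
  assumes p2: "forward_solution lam mu b p2" "p2 0 = unit_mass 0"
    and sm: "(\<lambda>n. real n * p2 t n) summable_on states b"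
    and k: "k \<in> states b" and \<delta>: "0 < \<delta>" "\<delta> < 1" and t: "0 \<le> t"
  shows "(\<lambda>n. real n * chain_prob lam mu b k t n) summable_on states b"
    and "\<bar>mean_number lam mu b t k - (\<Sum>\<^sub>\<infinity>n\<in>states b. real n * p2 t n)\<bar>
      \<le> 2 * (exp (- integral {0..t} (\<lambda>u. (1 - \<delta>) * mu u))
        * enn2real (l1_norm (w_vec b \<delta> (\<lambda>i. unit_mass k i - unit_mass 0 i)))) / W_const b \<delta>"
proof -
  define pk where "pk = chain_prob lam mu b k"
  have pk: "forward_solution lam mu b pk" "pk 0 = unit_mass k"
    unfolding pk_def by (rule chain_prob_solution[OF k])+
  have prob: "prob_vec (pk 0)" "prob_vec (p2 0)"
    unfolding pk(2) p2(2) by (rule prob_vec_unit_mass)+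
  have fin: "l1_norm (w_vec b \<delta> (\<lambda>i. pk 0 i - p2 0 i)) < \<infinity>"
    unfolding pk(2) p2(2) by (rule l1_norm_w_unit_mass_finite[OF k])
  note diff = mean_diff_decay[OF pk(1) prob(1) p2(1) prob(2) \<delta> t fin]
  have eq: "(\<lambda>n. real n * pk t n) = (\<lambda>n. real n * (pk t n - p2 t n) + real n * p2 t n)"
    by (rule ext) (simp add: algebra_simps)
  show "(\<lambda>n. real n * chain_prob lam mu b k t n) summable_on states b"
    unfolding pk_def[symmetric] eq by (rule summable_on_add[OF diff(1) sm])
  have "mean_number lam mu b t k = (\<Sum>\<^sub>\<infinity>n\<in>states b. real n * (pk t n - p2 t n)) + (\<Sum>\<^sub>\<infinity>n\<in>states b. real n * p2 t n)"
    unfolding mean_number_def pk_def[symmetric] eq by (rule infsum_add[OF diff(1) sm])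
  then show "\<bar>mean_number lam mu b t k - (\<Sum>\<^sub>\<infinity>n\<in>states b. real n * p2 t n)\<bar>
      \<le> 2 * (exp (- integral {0..t} (\<lambda>u. (1 - \<delta>) * mu u))
        * enn2real (l1_norm (w_vec b \<delta> (\<lambda>i. unit_mass k i - unit_mass 0 i)))) / W_const b \<delta>"
    using diff(2)[of "states b"] by (simp only: pk(2) p2(2) add_diff_cancel_right')
qed

end

theorem corollary1:
  fixes lam mu :: "real \<Rightarrow> real" and b :: "nat pmf" and L q C :: real
  assumes lam_nonneg: "\<And>t. 0 \<le> t \<Longrightarrow> 0 \<le> lam t"
    and lam_le: "\<And>t. 0 \<le> t \<Longrightarrow> lam t \<le> L"
    and mu_nonneg: "\<And>t. 0 \<le> t \<Longrightarrow> 0 \<le> mu t"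
    and lam_int: "\<And>t. 0 \<le> t \<Longrightarrow> lam absolutely_integrable_on {0..t}"
    and mu_int: "\<And>t. 0 \<le> t \<Longrightarrow> mu absolutely_integrable_on {0..t}"
    and b_pos: "pmf b 0 = 0"
    and b_mean: "integrable (measure_pmf b) real"
    and q: "0 < q" "q < 1"
    and C: "0 < C"
    and b_geom: "\<And>k. 1 \<le> k \<Longrightarrow> pmf b k \<le> C * q ^ k"
    and mu_inf: "(\<integral>\<^sup>+ t \<in> {0..}. ennreal (mu t) \<partial>lebesgue) = \<infinity>"
  shows
    "\<exists>\<phi>. limiting_mean lam mu b \<phi> \<and>
      (\<forall>\<delta> t p1 p2. q < \<delta> \<and> \<delta> < 1 \<and> 0 \<le> t \<and>
         forward_solution lam mu b p1 \<and> prob_vec (p1 0) \<and>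
         forward_solution lam mu b p2 \<and> prob_vec (p2 0) \<longrightarrow>
         l1_norm (\<lambda>i. p1 t i - p2 t i)
           \<le> ennreal (4 * exp (- integral {0..t} (\<lambda>u. (1 - \<delta>) * mu u)))
              * l1_norm (w_vec b \<delta> (\<lambda>i. p1 0 i - p2 0 i))) \<and>
      (\<exists>p2. forward_solution lam mu b p2 \<and> prob_vec (p2 0) \<and>
         (\<forall>t\<ge>0. ((\<lambda>n. real n * p2 t n) has_sum \<phi> t) (states b)) \<and>
         (\<forall>\<delta>. q < \<delta> \<and> \<delta> < 1 \<longrightarrow> 0 < W_const b \<delta> \<and>
           (\<forall>k\<in>states b.
              l1_norm (w_vec b \<delta> (\<lambda>i. unit_mass k i - p2 0 i)) < \<infinity> \<and>
              (\<forall>t\<ge>0. ennreal \<bar>mean_number lam mu b t k - \<phi> t\<bar>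
                 \<le> ennreal (4 / W_const b \<delta> * exp (- integral {0..t} (\<lambda>u. (1 - \<delta>) * mu u)))
                    * l1_norm (w_vec b \<delta> (\<lambda>i. unit_mass k i - p2 0 i))))))"
proof -
  interpret batch_queue lam mu b
    using lam_nonneg mu_nonneg lam_int mu_int b_pos b_mean
    by unfold_locales (simp_all add: loc_integrable_def)
  obtain p2 where p2: "forward_solution lam mu b p2" "p2 0 = unit_mass 0"
    and p2_moment: "\<And>t N. 0 \<le> t \<Longrightarrow> (\<Sum>i<N. (1 + real i) * \<bar>p2 t i\<bar>) \<le> (1 + real 0) * exp (integral {0..t} rate)"
    by (rule forward_solution_exists[OF sum_weighted_unit_mass_le unit_mass_not_states[OF zero_in_states]], assumption, rule that)
  have sm: "(\<lambda>n. real n * p2 t n) summable_on states b" if t: "0 \<le> t" for t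
  proof (rule bounded_sums_summable(1))
    fix N
    have "(\<Sum>i<N. \<bar>real i * p2 t i\<bar>) \<le> (\<Sum>i<N. (1 + real i) * \<bar>p2 t i\<bar>)"
      by (rule sum_mono) (simp add: abs_mult mult_right_mono)
    then show "(\<Sum>i<N. \<bar>real i * p2 t i\<bar>) \<le> (1 + real 0) * exp (integral {0..t} rate)"
      using p2_moment[OF t, of N] by linarith
  qed
  define \<phi> where "\<phi> t = (\<Sum>\<^sub>\<infinity>n\<in>states b. real n * p2 t n)" for t
  have prob: "prob_vec (p2 0)"
    unfolding p2(2) by (rule prob_vec_unit_mass)
  define E where "E \<delta> t = exp (- integral {0..t} (\<lambda>u. (1 - \<delta>) * mu u))" for \<delta> t
  define w where "w \<delta> k = l1_norm (w_vec b \<delta> (\<lambda>i. unit_mass k i - unit_mass 0 i))" for \<delta> k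
  have w_fin: "w \<delta> k < \<infinity>" if "k \<in> states b" for \<delta> k
    unfolding w_def by (rule l1_norm_w_unit_mass_finite[OF that])
  have mean: "\<bar>mean_number lam mu b t k - \<phi> t\<bar> \<le> 2 * (E \<delta> t * enn2real (w \<delta> k)) / W_const b \<delta>"
    if "k \<in> states b" "q < \<delta>" "\<delta> < 1" "0 \<le> t" for k \<delta> t
    unfolding \<phi>_def E_def w_def using q that by (intro mean_convergence(2)[OF p2 sm]) auto
  have lim: "limiting_mean lam mu b \<phi>"
    unfolding limiting_mean_def
  proof (intro ballI conjI allI impI)
    fix k assume k: "k \<in> states b"
    show "(\<lambda>n. real n * chain_prob lam mu b k t n) summable_on states b" if "0 \<le> t" for t
      \<comment> \<open>The claim does not mention \<delta>; 1/2 is one value in (0, 1).\<close>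
      by (rule mean_convergence(1)[OF p2 sm[OF that] k _ _ that, of "1 / 2"]) simp_all
    \<comment> \<open>The limit does not mention \<delta> either, so the midpoint of (q, 1) is fixed
      for the estimate.\<close>
    define \<delta> where "\<delta> = (q + 1) / 2"
    have \<delta>: "q < \<delta>" "\<delta> < 1" using q by (simp_all add: \<delta>_def)
    have "(E \<delta> \<longlongrightarrow> 0) at_top"
      unfolding E_def
      by (rule decay_exp_at_top[OF filterlim_integral_at_top \<delta>(2)]) (use mu_nonneg mu_inf mu_int loc_integrable_def in simp_all)
    then have "((\<lambda>t. 2 * (E \<delta> t * enn2real (w \<delta> k)) / W_const b \<delta>) \<longlongrightarrow> 2 * (0 * enn2real (w \<delta> k)) / W_const b \<delta>) at_top"
      using W_const_pos[OF b_pos, of \<delta>] q \<delta> by (intro tendsto_intros) auto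
    then have to0: "((\<lambda>t. 2 * (E \<delta> t * enn2real (w \<delta> k)) / W_const b \<delta>) \<longlongrightarrow> 0) at_top"
      by simp
    show "((\<lambda>t. mean_number lam mu b t k - \<phi> t) \<longlongrightarrow> 0) at_top"
    proof (rule Lim_null_comparison[OF _ to0])
      show "\<forall>\<^sub>F t in at_top. norm (mean_number lam mu b t k - \<phi> t) \<le> 2 * (E \<delta> t * enn2real (w \<delta> k)) / W_const b \<delta>"
        using eventually_ge_at_top[of 0]
        by eventually_elim (simp only: real_norm_def mean[OF k \<delta>])
    qed
  qed
  show ?thesis
  proof (intro exI[of _ \<phi>] exI[of _ p2] conjI allI impI ballI)
    show "limiting_mean lam mu b \<phi>" by (fact lim)
    show "forward_solution lam mu b p2" by (fact p2(1))
    show "prob_vec (p2 0)" by (fact prob)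
    show "((\<lambda>n. real n * p2 t n) has_sum \<phi> t) (states b)" if "0 \<le> t" for t
      unfolding \<phi>_def by (rule has_sum_infsum[OF sm[OF that]])
  next
    fix \<delta> t :: real and p1 p2 :: "real \<Rightarrow> nat \<Rightarrow> real"
    assume *: "q < \<delta> \<and> \<delta> < 1 \<and> 0 \<le> t \<and> forward_solution lam mu b p1 \<and> prob_vec (p1 0) \<and>
         forward_solution lam mu b p2 \<and> prob_vec (p2 0)"
    then have "0 < \<delta>" using q by linarith
    then show "l1_norm (\<lambda>i. p1 t i - p2 t i)
       \<le> ennreal (4 * exp (- integral {0..t} (\<lambda>u. (1 - \<delta>) * mu u))) * l1_norm (w_vec b \<delta> (\<lambda>i. p1 0 i - p2 0 i))"
      using * by (intro l1_norm_decay) blast+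
  next
    fix \<delta> :: real assume \<delta>: "q < \<delta> \<and> \<delta> < 1"
    then have \<delta>0: "0 < \<delta>" using q by linarith
    show W: "0 < W_const b \<delta>"
      using \<delta> \<delta>0 by (intro W_const_pos b_pos) auto
    fix k assume k: "k \<in> states b"
    show "l1_norm (w_vec b \<delta> (\<lambda>i. unit_mass k i - p2 0 i)) < \<infinity>"
      unfolding p2(2) using w_fin[OF k] by (simp only: w_def)
    fix t :: real assume t: "0 \<le> t"
    define r where "r = enn2real (w \<delta> k)"
    have r: "w \<delta> k = ennreal r" "0 \<le> r"
      using w_fin[OF k, of \<delta>] by (simp_all add: r_def)
    have "ennreal \<bar>mean_number lam mu b t k - \<phi> t\<bar> \<le> ennreal (2 * (E \<delta> t * r) / W_const b \<delta>)"
      unfolding r_def using \<delta> by (intro ennreal_leI mean k t) auto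
    \<comment> \<open>Again the proved constant 2 is relaxed to 4.\<close>
    also have "\<dots> \<le> ennreal ((4 / W_const b \<delta> * E \<delta> t) * r)"
      using W r(2) by (intro ennreal_leI) (simp add: E_def divide_right_mono)
    also have "\<dots> = ennreal (4 / W_const b \<delta> * E \<delta> t) * w \<delta> k"
      unfolding r(1) using W r(2) by (intro ennreal_mult) (simp_all add: E_def)
    finally show "ennreal \<bar>mean_number lam mu b t k - \<phi> t\<bar>
       \<le> ennreal (4 / W_const b \<delta> * exp (- integral {0..t} (\<lambda>u. (1 - \<delta>) * mu u)))
          * l1_norm (w_vec b \<delta> (\<lambda>i. unit_mass k i - p2 0 i))"
      unfolding p2(2) E_def w_def .
  qed
qed

end
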